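(* Let $n=2$. Assume that $g\in C^1(\mathbb R)$ is convex, with $$|g'(t)|\le b+d|t|\qquad\text{for all }t\in\mathbb R$$ for some $b,d\ge0$, and for some $a>0$ set $$W_2(\xi):=\tfrac12|\xi|^2+\tfrac14a|\xi|^4+g(\det\xi),\qquad\xi\in\mathbb R^{2\times2}.$$ If $b\le2$ and $d\le3a$, then $DW_2:\mathbb R^{2\times2}\to\mathbb R^{2\times2}$ is strictly quasimonotone and the data set $\mathcal D_{\mathrm{loc},DW_2}:=\{(F,DW_2(F)):F\in\mathbb R^{2\times2}\}$ is locally $(4,\frac43)$-div-curl-closed.
   Context: $|\xi|$ is the Euclidean (Frobenius) norm and $A\cdot B=\sum_{ij}A_{ij}B_{ij}$. With $n=2$, $p=4$, $q=4/3$: for open $\omega\subseteq\mathbb R^n$, $X_{p,q}(\omega):=L^p(\omega;\mathbb R^{n\times n})\times L^q(\omega;\mathbb R^{n\times n})$. Distributional operators act rowwise: $(\mathrm{curl}\,F)_{ijk}=\partial_kF_{ij}-\partial_jF_{ik}$, $(\mathrm{div}\,P)_i=\sum_j\partial_jP_{ij}$. $W^{-1,p}(\omega)$ is the dual of $W^{1,q}_0(\omega)$ and $W^{-1,q}(\omega)$ is the dual of $W^{1,p}_0(\omega)$. A sequence $(F_k,P_k)\in X_{p,q}(\omega)$ is div-curl-convergent to $(F,P)$ if it converges weakly in $X_{p,q}(\omega)$ and $\mathrm{curl}\,F_k\to\mathrm{curl}\,F$ strongly in $W^{-1,p}(\omega;\mathbb R^{n\times n\times n})$ and $\mathrm{div}\,P_k\to\mathrm{div}\,P$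 strongly in $W^{-1,q}(\omega;\mathbb R^n)$. A set $\mathcal D_{\mathrm{loc}}\subseteq\mathbb R^{n\times n}\times\mathbb R^{n\times n}$ is locally $(p,q)$-div-curl-closed if, for all bounded nonempty open $\omega\subseteq\mathbb R^n$ and all $(F_*,P_* )\in\mathbb R^{n\times n}\times\mathbb R^{n\times n}$: if there is a sequence $(F_k,P_k)\in X_{p,q}(\omega)$ div-curl-converging to the constant function $(F_*,P_* )$ with $(F_k,P_k)\in\mathcal D_{\mathrm{loc}}$ a.e., then $(F_*,P_* )\in\mathcal D_{\mathrm{loc}}$. A Borel measurable, locally bounded $T:\mathbb R^{n\times n}\to\mathbb R^{n\times n}$ is strictly quasimonotone if there is $B\in C^0(\mathbb R^{n\times n}\times\mathbb R^{n\times n};[0,\infty))$ with $B(F,G)=0$ if and only if $G=0$ such that $\int_\omega(T(F+D\varphi)-T(F))\cdot D\varphi\,dx\ge\int_\omega B(F,D\varphi)\,dx$ for all bounded Lipschitz (open) sets $\omega\subseteq\mathbb R^n$, all $F\in\mathbb R^{n\times n}$ and all $\varphi\in C^\infty_c(\omega;\mathbb R^n)$. *)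

theory Defs
  imports "HOL-Analysis.Analysis"
begin

definition grad :: "('a::real_inner \<Rightarrow> real) \<Rightarrow> 'a \<Rightarrow> 'a" where
  "grad f x = (THE D. GDERIV f x :> D)"


subsection \<open>Test functions and Lipschitz sets\<close>

text \<open>A function is of class \<open>C^(m+1)\<close> iff it is differentiable and all its directional
  derivatives are of class \<open>C^m\<close>.\<close>

primrec class_C :: "nat \<Rightarrow> ('a::real_normed_vector \<Rightarrow> 'b::real_normed_vector) \<Rightarrow> bool" where
  "class_C 0 f \<longleftrightarrow> continuous_on UNIV f"
| "class_C (Suc m) f \<longleftrightarrow>
     (\<forall>x. f differentiable (at x)) \<and> (\<forall>v. class_C m (\<lambda>x. frechet_derivative f (at x) v))"

text \<open>Elements of \<open>C\<^sub>c\<^sup>\<infinity>(\<omega>)\<close> are extended by zero to the whole space.\<close>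

definition test_functions ::
    "'a::euclidean_space set \<Rightarrow> ('a \<Rightarrow> 'b::real_normed_vector) set" where
  "test_functions \<omega> = {\<phi>. (\<forall>m. class_C m \<phi>) \<and>
     compact (closure {x. \<phi> x \<noteq> 0}) \<and> closure {x. \<phi> x \<noteq> 0} \<subseteq> \<omega>}"

text \<open>Near each boundary point, \<open>\<omega>\<close> is the set of points above the graph, in some unit
  direction \<open>e\<close>, of a Lipschitz function on the hyperplane orthogonal to \<open>e\<close>.\<close>

definition bounded_lipschitz_set :: "'a::euclidean_space set \<Rightarrow> bool" where
  "bounded_lipschitz_set \<omega> \<longleftrightarrow> open \<omega> \<and> bounded \<omega> \<and>
     (\<forall>x\<in>frontier \<omega>. \<exists>U e h L. open U \<and> x \<in> U \<and> norm e = 1 \<and>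
        L-lipschitz_on {y. y \<bullet> e = 0} h \<and>
        \<omega> \<inter> U = {y \<in> U. y \<bullet> e > h (y - (y \<bullet> e) *\<^sub>R e)})"


subsection \<open>Strict quasimonotonicity\<close>

definition locally_bounded ::
    "('a::topological_space \<Rightarrow> 'b::metric_space) \<Rightarrow> bool" where
  "locally_bounded T \<longleftrightarrow> (\<forall>x. \<exists>U. open U \<and> x \<in> U \<and> bounded (T ` U))"

definition strictly_quasimonotone :: "(real^'n^'n \<Rightarrow> real^'n^'n) \<Rightarrow> bool" where
  "strictly_quasimonotone T \<longleftrightarrow>
     T \<in> borel_measurable borel \<and> locally_bounded T \<and>
     (\<exists>B :: (real^'n^'n) \<times> (real^'n^'n) \<Rightarrow> real.
        continuous_on UNIV B \<and> (\<forall>Z. B Z \<ge> 0) \<and> (\<forall>F G. B (F, G) = 0 \<longleftrightarrow> G = 0) \<and>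
        (\<forall>(\<omega> :: (real^'n) set) F. \<forall>\<phi> \<in> test_functions \<omega>. bounded_lipschitz_set \<omega> \<longrightarrow>
           (LINT x|lebesgue_on \<omega>. (T (F + jacobian \<phi> (at x)) - T F) \<bullet> jacobian \<phi> (at x))
             \<ge> (LINT x|lebesgue_on \<omega>. B (F, jacobian \<phi> (at x)))))"


subsection \<open>Lebesgue spaces and weak convergence\<close>

definition Lp :: "real \<Rightarrow> 'a::euclidean_space set \<Rightarrow> ('a \<Rightarrow> 'b::euclidean_space) set" where
  "Lp p \<omega> = {f \<in> borel_measurable (lebesgue_on \<omega>).
     integrable (lebesgue_on \<omega>) (\<lambda>x. norm (f x) powr p)}"

definition Lp_norm ::
    "real \<Rightarrow> 'a::euclidean_space set \<Rightarrow> ('a \<Rightarrow> 'b::euclidean_space) \<Rightarrow> real" where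
  "Lp_norm p \<omega> f = (LINT x|lebesgue_on \<omega>. norm (f x) powr p) powr (1 / p)"

type_synonym 'n field_pair = "(real^'n \<Rightarrow> real^'n^'n) \<times> (real^'n \<Rightarrow> real^'n^'n)"

definition Xpq :: "real \<Rightarrow> real \<Rightarrow> (real^'n) set \<Rightarrow> 'n field_pair set" where
  "Xpq p q \<omega> = Lp p \<omega> \<times> Lp q \<omega>"

text \<open>Bounded linear functionals on \<open>Xpq\<close>. Elements of \<open>Xpq\<close> are functions rather than classes
  modulo null sets; boundedness makes the functionals compatible with a.e. equality.\<close>

definition Xpq_dual :: "real \<Rightarrow> real \<Rightarrow> (real^'n) set \<Rightarrow> ('n field_pair \<Rightarrow> real) set" where
  "Xpq_dual p q \<omega> = {\<Lambda>.
     (\<forall>(F, P) \<in> Xpq p q \<omega>. \<forall>(F', P') \<in> Xpq p q \<omega>.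
        \<Lambda> (\<lambda>x. F x + F' x, \<lambda>x. P x + P' x) = \<Lambda> (F, P) + \<Lambda> (F', P')) \<and>
     (\<forall>(F, P) \<in> Xpq p q \<omega>. \<forall>c. \<Lambda> (\<lambda>x. c *\<^sub>R F x, \<lambda>x. c *\<^sub>R P x) = c * \<Lambda> (F, P)) \<and>
     (\<exists>C. \<forall>(F, P) \<in> Xpq p q \<omega>. \<bar>\<Lambda> (F, P)\<bar> \<le> C * (Lp_norm p \<omega> F + Lp_norm q \<omega> P))}"

definition Xpq_weakly_converges ::
    "real \<Rightarrow> real \<Rightarrow> (real^'n) set \<Rightarrow> (nat \<Rightarrow> 'n field_pair) \<Rightarrow> 'n field_pair \<Rightarrow> bool" where
  "Xpq_weakly_converges p q \<omega> Z Z' \<longleftrightarrow>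
     (\<forall>m. Z m \<in> Xpq p q \<omega>) \<and> Z' \<in> Xpq p q \<omega> \<and>
     (\<forall>\<Lambda> \<in> Xpq_dual p q \<omega>. (\<lambda>m. \<Lambda> (Z m)) \<longlonglongrightarrow> \<Lambda> Z')"


subsection \<open>Sobolev spaces and their duals\<close>

text \<open>A Sobolev function is represented by the pair of the function and (a representative of)
  its weak gradient, which is determined a.e. by the function.\<close>

type_synonym 'n sobolev_pair = "(real^'n \<Rightarrow> real) \<times> (real^'n \<Rightarrow> real^'n)"

definition W1 :: "real \<Rightarrow> (real^'n) set \<Rightarrow> 'n sobolev_pair set" where
  "W1 r \<omega> = {(u, G). u \<in> Lp r \<omega> \<and> G \<in> Lp r \<omega> \<and>
     (\<forall>\<phi> \<in> test_functions \<omega>. \<forall>j.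
        (LINT x|lebesgue_on \<omega>. u x * grad \<phi> x $ j) = - (LINT x|lebesgue_on \<omega>. G x $ j * \<phi> x))}"

definition W1_norm :: "real \<Rightarrow> (real^'n) set \<Rightarrow> 'n sobolev_pair \<Rightarrow> real" where
  "W1_norm r \<omega> = (\<lambda>(u, G). Lp_norm r \<omega> u + Lp_norm r \<omega> G)"

text \<open>The closure of \<open>C\<^sub>c\<^sup>\<infinity>(\<omega>)\<close> in \<open>W1\<close>.\<close>

definition W1_zero :: "real \<Rightarrow> (real^'n) set \<Rightarrow> 'n sobolev_pair set" where
  "W1_zero r \<omega> = {(u, G) \<in> W1 r \<omega>. \<exists>\<phi>. (\<forall>m::nat. \<phi> m \<in> test_functions \<omega>) \<and>
     (\<lambda>m. W1_norm r \<omega> (\<lambda>x. \<phi> m x - u x, \<lambda>x. grad (\<phi> m) x - G x)) \<longlonglongrightarrow> 0}"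

text \<open>Operator norm on the dual of \<open>W1_zero r \<omega>\<close>, i.e. on \<open>W\<^sup>-\<^sup>1\<^sup>,\<^sup>s(\<omega>)\<close> for conjugate exponents
  \<open>r\<close> and \<open>s\<close>.\<close>

definition W1_dual_norm :: "real \<Rightarrow> (real^'n) set \<Rightarrow> ('n sobolev_pair \<Rightarrow> real) \<Rightarrow> ennreal" where
  "W1_dual_norm r \<omega> T = (SUP w \<in> {w \<in> W1_zero r \<omega>. W1_norm r \<omega> w \<le> 1}. ennreal \<bar>T w\<bar>)"

definition W1_dual_converges ::
    "real \<Rightarrow> (real^'n) set \<Rightarrow> (nat \<Rightarrow> 'n sobolev_pair \<Rightarrow> real) \<Rightarrow> ('n sobolev_pair \<Rightarrow> real) \<Rightarrow> bool"
where
  "W1_dual_converges r \<omega> S T \<longleftrightarrow> (\<lambda>m. W1_dual_norm r \<omega> (\<lambda>w. S m w - T w)) \<longlonglongrightarrow> 0"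

text \<open>The distribution \<open>\<partial>\<^sub>k f\<close>, in its continuous extension from test functions \<open>\<phi>\<close>,
  identified with \<open>(\<phi>, grad \<phi>)\<close>, to all of \<open>W1_zero r \<omega>\<close>, where \<open>f \<in> Lp s \<omega>\<close> and
  \<open>1 / r + 1 / s = 1\<close>.\<close>

definition distr_deriv ::
    "(real^'n) set \<Rightarrow> 'n \<Rightarrow> (real^'n \<Rightarrow> real) \<Rightarrow> 'n sobolev_pair \<Rightarrow> real" where
  "distr_deriv \<omega> k f = (\<lambda>(u, G). - (LINT x|lebesgue_on \<omega>. f x * G x $ k))"

definition distr_curl ::
    "(real^'n) set \<Rightarrow> (real^'n \<Rightarrow> real^'n^'n) \<Rightarrow> 'n \<Rightarrow> 'n \<Rightarrow> 'n \<Rightarrow> 'n sobolev_pair \<Rightarrow> real" where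
  "distr_curl \<omega> F i j k w =
     distr_deriv \<omega> k (\<lambda>x. F x $ i $ j) w - distr_deriv \<omega> j (\<lambda>x. F x $ i $ k) w"

definition distr_div ::
    "(real^'n) set \<Rightarrow> (real^'n \<Rightarrow> real^'n^'n) \<Rightarrow> 'n \<Rightarrow> 'n sobolev_pair \<Rightarrow> real" where
  "distr_div \<omega> P i w = (\<Sum>j\<in>UNIV. distr_deriv \<omega> j (\<lambda>x. P x $ i $ j) w)"


subsection \<open>Div-curl convergence\<close>

text \<open>For conjugate exponents \<open>p\<close> and \<open>q\<close>, the spaces \<open>W\<^sup>-\<^sup>1\<^sup>,\<^sup>p\<close> and \<open>W\<^sup>-\<^sup>1\<^sup>,\<^sup>q\<close> are the duals of
  \<open>W1_zero q\<close> and \<open>W1_zero p\<close>, respectively. Tensor-valued strong convergence is componentwise.\<close>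

definition div_curl_converges ::
    "real \<Rightarrow> real \<Rightarrow> (real^'n) set \<Rightarrow> (nat \<Rightarrow> 'n field_pair) \<Rightarrow> 'n field_pair \<Rightarrow> bool" where
  "div_curl_converges p q \<omega> Z Z' \<longleftrightarrow>
     Xpq_weakly_converges p q \<omega> Z Z' \<and>
     (\<forall>i j k. W1_dual_converges q \<omega>
        (\<lambda>m. distr_curl \<omega> (fst (Z m)) i j k) (distr_curl \<omega> (fst Z') i j k)) \<and>
     (\<forall>i. W1_dual_converges p \<omega>
        (\<lambda>m. distr_div \<omega> (snd (Z m)) i) (distr_div \<omega> (snd Z') i))"

definition locally_div_curl_closed ::
    "real \<Rightarrow> real \<Rightarrow> ((real^'n^'n) \<times> (real^'n^'n)) set \<Rightarrow> bool" where
  "locally_div_curl_closed p q D \<longleftrightarrow>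
     (\<forall>\<omega> :: (real^'n) set. \<forall>F P. bounded \<omega> \<and> \<omega> \<noteq> {} \<and> open \<omega> \<longrightarrow>
        (\<exists>Z. div_curl_converges p q \<omega> Z (\<lambda>x. F, \<lambda>x. P) \<and>
             (\<forall>m. AE x in lebesgue_on \<omega>. (fst (Z m) x, snd (Z m) x) \<in> D)) \<longrightarrow>
        (F, P) \<in> D)"


subsection \<open>The energy density\<close>

definition W2 :: "real \<Rightarrow> (real \<Rightarrow> real) \<Rightarrow> real^2^2 \<Rightarrow> real" where
  "W2 a g \<xi> = 1 / 2 * norm \<xi> ^ 2 + 1 / 4 * a * norm \<xi> ^ 4 + g (det \<xi>)"

definition data_set :: "(real^'n^'n \<Rightarrow> real^'n^'n) \<Rightarrow> ((real^'n^'n) \<times> (real^'n^'n)) set" where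
  "data_set T = {(F, T F) | F. True}"

end

theory Submission
  imports Defs
begin

text \<open>
  Writing $T = DW_2$ and $\gamma = g'$, the excess
  $B(F,G) = (T(F+G) - T(F)) \cdot G - \gamma(\det F) \det G$ is positive for $G \neq 0$: monotonicity of
  $\gamma$ makes $(\gamma(\det(F+G)) - \gamma(\det F))(\det(F+G) - \det F)$ nonnegative, and the growth bound with
  $b \le 2$, $d \le 3a$ lets the quadratic and quartic parts absorb what is left. The subtracted term
  integrates to zero along gradients, because the determinant is a null Lagrangian; this is strict
  quasimonotonicity.

  For closedness, let $G_k = F_k - F_*$. By the div-curl lemma $\int \eta\, B(F_*, G_k) \to 0$ for cut-off
  functions $\eta \ge 0$ up to a term that is linear in $G_k$, and hence tends to zero. Since
  $|T(F_* + G) - T(F_*)| \le \delta + C_\delta B(F_*, G)$ for every $\delta > 0$, the weak limit of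
  $T(F_k)$ is $T(F_*)$.

  The div-curl lemma is obtained without Sobolev theory. A minimiser of the $p$-Laplace energy corrects the
  divergence by a strongly convergent field; a solenoidal field tested against shifts is a rotated gradient of its
  stream function, and mollification transfers the estimate to the fields themselves. The uniform $L^4$
  bound for weakly convergent sequences is a gliding hump argument.
\<close>

text \<open>With H = F + G, the bounds on \<open>b\<close> and \<open>d\<close> make
  |\<open>\<gamma>\<close> (det H) det G| at most |G|^2 + (3/4) a |H|^2 |G|^2. The first summand
  uses up the quadratic part of the energy; what is left of the quartic part is nonnegative, but it
  vanishes at G = - 3 F, and positivity needs a separate argument there.

  In the limit passage the null Lagrangian is not treated on its own. Since det G = (cof G . G) / 2,
  it is absorbed into the stress field by subtracting (\<open>\<gamma>\<close> (det F) / 2) cof G.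
  The rows of cof G are rotated rows of G, so their divergence is a curl of G and stays controlled.
  One application of the div-curl lemma per row then suffices.

  The correction is made on the divergence side because the energy to be minimised there has
  exponent 4: it is polynomial, so that convexity and first variation are elementary. The curl is
  left uncorrected: the stream function of a shifted solenoidal field is a local line integral, and
  cut off by a test function it can itself be used to test the small curl. The mollification radius
  is fixed before the index of the sequence is sent to infinity.\<close>

lemma norm_integral_le:
  fixes f :: "'a \<Rightarrow> 'b::{banach, second_countable_topology}"
  assumes "integrable M g" "AE x in M. norm (f x) \<le> g x"
  shows "norm (LINT x|M. f x) \<le> (LINT x|M. g x)"
proof -
  have "AE x in M. 0 \<le> g x"
    using assms(2) by eventually_elim (auto intro: order_trans[OF norm_ge_zero])
  then have "(LINT x|M. norm (f x)) \<le> (LINT x|M. g x)"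
    by (intro integral_mono_AE' assms)
  then show ?thesis using integral_norm_bound[of M f] by linarith
qed

section \<open>Closure properties of the classes \<open>class_C\<close>\<close>

lemma class_C_SucI:
  assumes "\<And>x. (f has_derivative f' x) (at x)" and "\<And>v. class_C m (\<lambda>x. f' x v)"
  shows "class_C (Suc m) f"
proof -
  have "frechet_derivative f (at x) = f' x" for x
    using frechet_derivative_at[OF assms(1)] by simp
  then show ?thesis
    using assms by (auto simp: differentiable_def)
qed

lemma class_C_Suc_imp:
  fixes f :: "'a::real_normed_vector \<Rightarrow> 'b::real_normed_vector"
  shows "class_C (Suc m) f \<Longrightarrow> class_C m f"
proof (induction m arbitrary: f)
  case 0
  then show ?case
    by (auto simp: continuous_on_eq_continuous_at intro: differentiable_imp_continuous_within)
next
  case (Suc m)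
  then show ?case by (metis class_C.simps(2))
qed

lemma class_C_imp_continuous:
  fixes f :: "'a::real_normed_vector \<Rightarrow> 'b::real_normed_vector"
  shows "class_C m f \<Longrightarrow> continuous_on UNIV f"
  by (induction m) (simp, metis class_C_Suc_imp)

lemma class_C_const: "class_C m (\<lambda>x. c)"
  by (induction m arbitrary: c) (simp, intro class_C_SucI, rule has_derivative_const)

lemma class_C_bounded_linear:
  assumes "bounded_linear f" shows "class_C m f"
proof (cases m)
  case 0
  then show ?thesis
    using assms by (simp add: linear_continuous_on)
next
  case (Suc n)
  show ?thesis unfolding Suc
    by (rule class_C_SucI[where f'="\<lambda>x. f"]) (auto simp: class_C_const assms bounded_linear_imp_has_derivative)
qed

lemma class_C_add:
  fixes f g :: "'a::real_normed_vector \<Rightarrow> 'b::real_normed_vector"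
  shows "class_C m f \<Longrightarrow> class_C m g \<Longrightarrow> class_C m (\<lambda>x. f x + g x)"
proof (induction m arbitrary: f g)
  case (Suc m)
  show ?case
    by (rule class_C_SucI[where f'="\<lambda>x v. frechet_derivative f (at x) v + frechet_derivative g (at x) v"])
      (use Suc in \<open>auto intro!: has_derivative_add simp: frechet_derivative_works[symmetric]\<close>)
qed (simp add: continuous_on_add)

lemma class_C_compose_linear:
  fixes f :: "'a::real_normed_vector \<Rightarrow> 'b::real_normed_vector"
    and l :: "'b \<Rightarrow> 'c::real_normed_vector"
  assumes l: "bounded_linear l"
  shows "class_C m f \<Longrightarrow> class_C m (\<lambda>x. l (f x))"
proof (induction m arbitrary: f)
  case 0
  then show ?case
    using continuous_on_compose2[OF linear_continuous_on[OF l, of UNIV]] by auto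
next
  case (Suc m)
  show ?case
    by (rule class_C_SucI[where f'="\<lambda>x v. l (frechet_derivative f (at x) v)"])
      (use Suc in \<open>auto intro!: bounded_linear.has_derivative[OF l] simp: frechet_derivative_works[symmetric]\<close>)
qed

lemma class_C_compose_affine:
  fixes f :: "'b::real_normed_vector \<Rightarrow> 'c::real_normed_vector"
    and l :: "'a::real_normed_vector \<Rightarrow> 'b"
  assumes l: "bounded_linear l"
  shows "class_C m f \<Longrightarrow> class_C m (\<lambda>x. f (l x + c))"
proof (induction m arbitrary: f)
  case 0
  have "continuous_on UNIV (\<lambda>x. l x + c)"
    by (intro continuous_intros linear_continuous_on l)
  with 0 show ?case
    using continuous_on_compose2[of UNIV f UNIV "\<lambda>x. l x + c"] by auto
next
  case (Suc m)
  show ?case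
  proof (rule class_C_SucI[where f'="\<lambda>x v. frechet_derivative f (at (l x + c)) (l v)"])
    fix x
    have "((\<lambda>x. l x + c) has_derivative l) (at x)"
      using bounded_linear_imp_has_derivative[OF l] by (auto intro!: derivative_eq_intros)
    then show "((\<lambda>x. f (l x + c)) has_derivative (\<lambda>v. frechet_derivative f (at (l x + c)) (l v))) (at x)"
      using diff_chain_at[of "\<lambda>x. l x + c" l x f] Suc.prems
      by (auto simp: frechet_derivative_works o_def)
  next
    fix v
    show "class_C m (\<lambda>x. frechet_derivative f (at (l x + c)) (l v))"
      using Suc.IH[of "\<lambda>y. frechet_derivative f (at y) (l v)"] Suc.prems by simp
  qed
qed

lemma class_C_mult:
  fixes f g :: "'a::real_normed_vector \<Rightarrow> real"
  shows "class_C m f \<Longrightarrow> class_C m g \<Longrightarrow> class_C m (\<lambda>x. f x * g x)"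
proof (induction m arbitrary: f g)
  case (Suc m)
  show ?case
  proof (rule class_C_SucI[where f'="\<lambda>x v. f x * frechet_derivative g (at x) v + frechet_derivative f (at x) v * g x"])
    fix x
    show "((\<lambda>x. f x * g x) has_derivative
        (\<lambda>v. f x * frechet_derivative g (at x) v + frechet_derivative f (at x) v * g x)) (at x)"
      using Suc.prems by (auto intro!: has_derivative_mult simp: frechet_derivative_works[symmetric])
    fix v
    show "class_C m (\<lambda>x. f x * frechet_derivative g (at x) v + frechet_derivative f (at x) v * g x)"
      using Suc.prems class_C_Suc_imp[of m f] class_C_Suc_imp[of m g]
      by (intro class_C_add Suc.IH) auto
  qed
qed (simp add: continuous_on_mult)

lemma class_C_sum:
  fixes f :: "'i \<Rightarrow> 'a::real_normed_vector \<Rightarrow> 'b::real_normed_vector"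
  assumes "\<And>i. i \<in> I \<Longrightarrow> class_C m (f i)"
  shows "class_C m (\<lambda>x. \<Sum>i\<in>I. f i x)"
  using assms
proof (induction I rule: infinite_finite_induct)
  case (insert i I)
  then show ?case using class_C_add[of m "f i" "\<lambda>x. \<Sum>i\<in>I. f i x"] by simp
qed (auto simp: class_C_const)

lemma class_C_norm_squared: "class_C m (\<lambda>x::'a::euclidean_space. (norm x)\<^sup>2)"
proof -
  have "class_C m (\<lambda>x::'a. \<Sum>b\<in>Basis. (x \<bullet> b) * (x \<bullet> b))"
    by (intro class_C_sum class_C_mult class_C_bounded_linear bounded_linear_inner_left)
  then show ?thesis
    by (simp add: power2_norm_eq_inner euclidean_inner[symmetric])
qed

subsection \<open>Bump functions\<close>

text \<open>The index \<open>j\<close> makes the family closed under differentiation: the derivative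
  of \<open>flat j\<close> is a combination of \<open>flat (Suc j)\<close> and
  \<open>flat (Suc (Suc j))\<close>. The member \<open>flat 0\<close> is the usual smooth function
  that is flat at 0.\<close>

definition flat :: "nat \<Rightarrow> real \<Rightarrow> real" where
  "flat j t = (if t \<le> 0 then 0 else (1 / t) ^ j * exp (- 1 / t))"

lemma power_le_exp: "(x::real) ^ n \<le> real n ^ n * exp x" if "x \<ge> 0"
proof (cases "n = 0")
  case False
  have "x / n \<le> exp (x / n)"
    using exp_ge_add_one_self[of "x / n"] by linarith
  then have "(x / n) ^ n \<le> exp (x / n) ^ n"
    using that by (intro power_mono) auto
  also have "\<dots> = exp x"
    using False by (simp add: exp_of_nat_mult[symmetric])
  finally show ?thesis using False by (simp add: power_divide field_simps)
qed (use that in auto)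

text \<open>The exponential beats the power j + 2 of 1 / t, which leaves a factor t^2 to spare. This
  factor makes the difference quotient at 0 tend to 0 in \<open>flat_deriv\<close>.\<close>

lemma flat_bound: "\<bar>flat j t\<bar> \<le> real (j + 2) ^ (j + 2) * t\<^sup>2"
proof (cases "t > 0")
  case True
  have "(1 / t) ^ (j + 2) \<le> real (j + 2) ^ (j + 2) * exp (1 / t)"
    using True by (intro power_le_exp) auto
  then have "(1 / t) ^ (j + 2) * exp (- (1 / t)) \<le> real (j + 2) ^ (j + 2) * exp (1 / t) * exp (- (1 / t))"
    by (intro mult_right_mono) auto
  also have "\<dots> = real (j + 2) ^ (j + 2)"
    by (simp only: mult.assoc exp_add[symmetric]) simp
  finally have "(1 / t) ^ (j + 2) * exp (- (1 / t)) \<le> real (j + 2) ^ (j + 2)" .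
  then have "t\<^sup>2 * ((1 / t) ^ (j + 2) * exp (- (1 / t))) \<le> t\<^sup>2 * real (j + 2) ^ (j + 2)"
    using True by (intro mult_left_mono) auto
  moreover have "t\<^sup>2 * ((1 / t) ^ (j + 2) * exp (- (1 / t))) = (1/t) ^ j * exp (- (1 / t))"
    using True by (simp add: power_add power_divide field_simps power2_eq_square)
  ultimately show ?thesis
    using True by (simp add: flat_def abs_mult mult.commute)
qed (simp add: flat_def)

lemma flat_deriv:
  "(flat j has_real_derivative (- real j * flat (Suc j) t + flat (Suc (Suc j)) t)) (at t)"
proof -
  consider "t < 0" | "t = 0" | "t > 0" by linarith
  then show ?thesis
  proof cases
    case 1
    have "(flat j has_real_derivative 0) (at t)"
      by (rule has_field_derivative_transform_within_open[where f="\<lambda>t. 0" and S="{..<0}"])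
        (use 1 in \<open>auto simp: flat_def\<close>)
    then show ?thesis using 1 by (simp add: flat_def)
  next
    case 2
    let ?C = "real (j + 2) ^ (j + 2)"
    have "(\<lambda>h. (flat j (0 + h) - flat j 0) / h) \<midarrow>0\<rightarrow> 0"
    proof (rule Lim_null_comparison[where g="\<lambda>h. ?C * \<bar>h\<bar>"])
      show "\<forall>\<^sub>F h in at 0. norm ((flat j (0 + h) - flat j 0) / h) \<le> ?C * \<bar>h\<bar>"
      proof (rule always_eventually, rule allI)
        fix h :: real
        show "norm ((flat j (0 + h) - flat j 0) / h) \<le> ?C * \<bar>h\<bar>"
          using flat_bound[of j h] by (cases "h = 0") (auto simp: flat_def[of j 0] divide_simps power2_eq_square abs_mult mult.assoc)
      qed
      have "((\<lambda>h. ?C * \<bar>h\<bar>) \<longlongrightarrow> ?C * \<bar>0\<bar>) (at (0::real))" by (intro tendsto_intros)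
      then show "((\<lambda>h. ?C * \<bar>h\<bar>) \<longlongrightarrow> 0) (at (0::real))" by simp
    qed
    then have "(flat j has_real_derivative 0) (at 0)"
      by (simp add: DERIV_def)
    then show ?thesis using 2 by (simp add: flat_def)
  next
    case 3
    have "((\<lambda>t. (1 / t) ^ j * exp (- 1 / t)) has_real_derivative
        (- real j * flat (Suc j) t + flat (Suc (Suc j)) t)) (at t)"
      using 3
      by (auto intro!: derivative_eq_intros simp: flat_def)
        (cases j; simp add: field_simps power2_eq_square)
    then show ?thesis
      by (rule has_field_derivative_transform_within_open[where S="{0<..}"])
        (use 3 in \<open>auto simp: flat_def\<close>)
  qed
qed

text \<open>The chain rule raises the index of \<open>flat\<close>, so the induction on
  \<open>m\<close> has to leave \<open>j\<close> arbitrary.\<close>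

lemma class_C_flat_compose:
  fixes q :: "'a::real_normed_vector \<Rightarrow> real"
  assumes q: "\<And>m. class_C m q"
  shows "class_C m (\<lambda>x. flat j (q x))"
proof (induction m arbitrary: j)
  case 0
  have "continuous_on UNIV (flat j)"
    by (auto simp: continuous_on_eq_continuous_at intro!: DERIV_isCont flat_deriv)
  then show ?case
    using q[of 0] by (auto intro: continuous_on_compose2)
next
  case (Suc m)
  let ?D = "\<lambda>x v. (- real j * flat (Suc j) (q x) + flat (Suc (Suc j)) (q x)) * frechet_derivative q (at x) v"
  show ?case
  proof (rule class_C_SucI[where f'="?D"])
    fix x
    have "(q has_derivative frechet_derivative q (at x)) (at x)"
      using q[of "Suc 0"] by (auto simp: frechet_derivative_works[symmetric])
    from diff_chain_at[OF this flat_deriv[THEN has_field_derivative_imp_has_derivative]]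
    show "((\<lambda>x. flat j (q x)) has_derivative ?D x) (at x)"
      by (simp add: o_def)
    fix v
    have "class_C m (\<lambda>x. frechet_derivative q (at x) v)"
      using q[of "Suc m"] by auto
    then show "class_C m (\<lambda>x. ?D x v)"
      by (intro class_C_mult class_C_add Suc.IH class_C_const)
  qed
qed

subsection \<open>Test functions\<close>

lemma test_functions_mono: "\<omega> \<subseteq> \<omega>' \<Longrightarrow> test_functions \<omega> \<subseteq> test_functions \<omega>'"
  by (auto simp: test_functions_def)

lemma zero_outside_support: "x \<notin> closure {x. \<phi> x \<noteq> 0} \<Longrightarrow> \<phi> x = 0"
  using closure_subset[of "{x. \<phi> x \<noteq> 0}"] by auto

lemma test_functionsD:
  assumes "\<phi> \<in> test_functions \<omega>"
  shows "class_C m \<phi>" "compact (closure {x. \<phi> x \<noteq> 0})" "closure {x. \<phi> x \<noteq> 0} \<subseteq> \<omega>"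
    "bounded {x. \<phi> x \<noteq> 0}" "x \<notin> \<omega> \<Longrightarrow> \<phi> x = 0"
    "continuous_on UNIV \<phi>" "\<phi> differentiable (at x)"
    "(\<phi> has_derivative frechet_derivative \<phi> (at x)) (at x)"
    "bounded_linear (frechet_derivative \<phi> (at x))"
proof -
  show *: "class_C m \<phi>" for m using assms by (auto simp: test_functions_def)
  show "compact (closure {x. \<phi> x \<noteq> 0})" and c: "closure {x. \<phi> x \<noteq> 0} \<subseteq> \<omega>"
    using assms by (auto simp: test_functions_def)
  then show "bounded {x. \<phi> x \<noteq> 0}"
    by (intro bounded_subset[OF compact_imp_bounded closure_subset])
  show "x \<notin> \<omega> \<Longrightarrow> \<phi> x = 0"
    using c zero_outside_support[of x \<phi>] by blast
  show "continuous_on UNIV \<phi>" using *[of 0] by simp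
  show "\<phi> differentiable (at x)" using *[of "Suc 0"] by auto
  then show "(\<phi> has_derivative frechet_derivative \<phi> (at x)) (at x)"
    by (simp add: frechet_derivative_works)
  then show "bounded_linear (frechet_derivative \<phi> (at x))"
    by (rule has_derivative_bounded_linear)
qed

lemma test_functionsI:
  fixes \<phi> :: "'a::euclidean_space \<Rightarrow> 'b::real_normed_vector"
  assumes "\<And>m. class_C m \<phi>" and K: "compact K" "K \<subseteq> \<omega>" "\<And>x. x \<notin> K \<Longrightarrow> \<phi> x = 0"
  shows "\<phi> \<in> test_functions \<omega>"
proof -
  have "closure {x. \<phi> x \<noteq> 0} \<subseteq> K"
    using K by (intro closure_minimal) (auto intro: compact_imp_closed)
  then show ?thesis
    using assms unfolding test_functions_def
    by (auto simp: compact_eq_bounded_closed intro: bounded_subset)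
qed

lemma test_functions_UNIV_I:
  fixes \<phi> :: "'a::euclidean_space \<Rightarrow> 'b::real_normed_vector"
  assumes "\<And>m. class_C m \<phi>" "bounded {x. \<phi> x \<noteq> 0}"
  shows "\<phi> \<in> test_functions UNIV"
  using assms by (auto simp: test_functions_def)

lemma frechet_derivative_zero_outside:
  fixes \<phi> :: "'a::euclidean_space \<Rightarrow> 'b::real_normed_vector"
  assumes "x \<notin> closure {x. \<phi> x \<noteq> 0}"
  shows "frechet_derivative \<phi> (at x) v = 0"
proof -
  have "((\<lambda>x. 0) has_derivative (\<lambda>v. 0)) (at x)" by simp
  then have "(\<phi> has_derivative (\<lambda>v. 0)) (at x)"
    by (rule has_derivative_transform_within_open[where s="- closure {x. \<phi> x \<noteq> 0}"])
      (use assms in \<open>auto dest: zero_outside_support\<close>)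
  then show ?thesis
    using frechet_derivative_at by (metis (full_types))
qed

lemma test_functions_derivative:
  fixes \<phi> :: "'a::euclidean_space \<Rightarrow> 'b::real_normed_vector"
  assumes "\<phi> \<in> test_functions \<omega>"
  shows "(\<lambda>x. frechet_derivative \<phi> (at x) v) \<in> test_functions \<omega>"
proof (rule test_functionsI[of _ "closure {x. \<phi> x \<noteq> 0}"])
  show "class_C m (\<lambda>x. frechet_derivative \<phi> (at x) v)" for m
    using test_functionsD(1)[OF assms, of "Suc m"] by auto
  show "compact (closure {x. \<phi> x \<noteq> 0})" "closure {x. \<phi> x \<noteq> 0} \<subseteq> \<omega>"
    by (rule test_functionsD[OF assms])+
  show "frechet_derivative \<phi> (at x) v = 0" if "x \<notin> closure {x. \<phi> x \<noteq> 0}" for x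
    by (rule frechet_derivative_zero_outside[OF that])
qed

lemma test_functions_mult:
  fixes \<phi> \<psi> :: "'a::euclidean_space \<Rightarrow> real"
  assumes "\<phi> \<in> test_functions \<omega>" "\<And>m. class_C m \<psi>"
  shows "(\<lambda>x. \<phi> x * \<psi> x) \<in> test_functions \<omega>"
proof (rule test_functionsI)
  show "class_C m (\<lambda>x. \<phi> x * \<psi> x)" for m
    by (rule class_C_mult[OF test_functionsD(1)[OF assms(1)] assms(2)])
  show "\<phi> x * \<psi> x = 0" if "x \<notin> closure {x. \<phi> x \<noteq> 0}" for x
    using zero_outside_support[OF that] by simp
qed (rule test_functionsD[OF assms(1)])+

lemma test_functions_compose_linear:
  fixes \<phi> :: "'a::euclidean_space \<Rightarrow> 'b::real_normed_vector"
  assumes "\<phi> \<in> test_functions \<omega>" "bounded_linear l"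
  shows "(\<lambda>x. l (\<phi> x)) \<in> test_functions \<omega>"
proof (rule test_functionsI)
  show "class_C m (\<lambda>x. l (\<phi> x))" for m
    by (rule class_C_compose_linear[OF assms(2) test_functionsD(1)[OF assms(1)]])
  show "l (\<phi> x) = 0" if "x \<notin> closure {x. \<phi> x \<noteq> 0}" for x
    using zero_outside_support[OF that] linear_0[OF bounded_linear.linear[OF assms(2)]] by simp
qed (rule test_functionsD[OF assms(1)])+

lemma test_functions_add:
  fixes \<phi> \<psi> :: "'a::euclidean_space \<Rightarrow> 'b::real_normed_vector"
  assumes "\<phi> \<in> test_functions \<omega>" "\<psi> \<in> test_functions \<omega>"
  shows "(\<lambda>x. \<phi> x + \<psi> x) \<in> test_functions \<omega>"
proof (rule test_functionsI)
  show "class_C m (\<lambda>x. \<phi> x + \<psi> x)" for m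
    by (rule class_C_add[OF test_functionsD(1)[OF assms(1)] test_functionsD(1)[OF assms(2)]])
  let ?K = "closure {x. \<phi> x \<noteq> 0} \<union> closure {x. \<psi> x \<noteq> 0}"
  show "\<phi> x + \<psi> x = 0" if "x \<notin> ?K" for x
    using zero_outside_support[of x \<phi>] zero_outside_support[of x \<psi>] that by simp
  show "compact ?K" "?K \<subseteq> \<omega>"
    using test_functionsD(2,3)[OF assms(1)] test_functionsD(2,3)[OF assms(2)] by (auto simp only: compact_Un Un_subset_iff)
qed

lemma test_functions_bounded:
  fixes \<phi> :: "'a::euclidean_space \<Rightarrow> 'b::real_normed_vector"
  assumes "\<phi> \<in> test_functions \<omega>"
  shows "\<exists>B>0. \<forall>x. norm (\<phi> x) \<le> B"
proof -
  let ?K = "closure {x. \<phi> x \<noteq> 0}"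
  have "compact (\<phi> ` ?K)"
    by (rule compact_continuous_image[OF continuous_on_subset[OF test_functionsD(6)[OF assms]] test_functionsD(2)[OF assms]]) simp
  then obtain B where B: "B > 0" "\<And>y. y \<in> \<phi> ` ?K \<Longrightarrow> norm y \<le> B"
    by (meson bounded_pos compact_imp_bounded)
  have "norm (\<phi> x) \<le> B" for x
  proof (cases "\<phi> x = 0")
    case False
    then have "x \<in> ?K" using zero_outside_support[of x \<phi>] by blast
    then show ?thesis by (intro B(2) imageI)
  qed (use B(1) in simp)
  then show ?thesis using B(1) by blast
qed

lemma test_functions_lipschitz:
  fixes \<phi> :: "'a::euclidean_space \<Rightarrow> real"
  assumes "\<phi> \<in> test_functions \<omega>"
  shows "\<exists>L\<ge>0. \<forall>x y. \<bar>\<phi> x - \<phi> y\<bar> \<le> L * norm (x - y)"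
proof -
  have "\<forall>b. \<exists>B. \<forall>x. \<bar>frechet_derivative \<phi> (at x) b\<bar> \<le> B"
    using test_functions_bounded[OF test_functions_derivative[OF assms]] by (metis real_norm_def)
  from choice[OF this] obtain B where B: "\<And>b x. \<bar>frechet_derivative \<phi> (at x) b\<bar> \<le> B b"
    by blast
  have B0: "B b \<ge> 0" for b using B[of 0 b] by linarith
  let ?L = "\<Sum>b\<in>Basis. B b"
  have "\<bar>\<phi> x - \<phi> y\<bar> \<le> ?L * norm (x - y)" for x y
  proof -
    have "norm (\<phi> x - \<phi> y) \<le> ?L * norm (x - y)"
    proof (rule differentiable_bound[of UNIV \<phi> "\<lambda>x. frechet_derivative \<phi> (at x)"])
      fix z
      show "(\<phi> has_derivative frechet_derivative \<phi> (at z)) (at z)"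
        using test_functionsD(8)[OF assms] .
      show "onorm (frechet_derivative \<phi> (at z)) \<le> ?L"
      proof (rule onorm_le)
        fix v :: 'a
        interpret bounded_linear "frechet_derivative \<phi> (at z)"
          by (rule test_functionsD(9)[OF assms])
        have "frechet_derivative \<phi> (at z) v = frechet_derivative \<phi> (at z) (\<Sum>b\<in>Basis. (v \<bullet> b) *\<^sub>R b)"
          by (simp add: euclidean_representation)
        also have "\<dots> = (\<Sum>b\<in>Basis. (v \<bullet> b) * frechet_derivative \<phi> (at z) b)"
          by (simp add: sum scaleR)
        also have "norm \<dots> \<le> (\<Sum>b\<in>Basis. norm v * B b)"
          unfolding real_norm_def abs_mult[symmetric]
          by (rule order.trans[OF sum_abs]) (auto simp: abs_mult intro!: sum_mono mult_mono B B0 Basis_le_norm)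
        finally show "norm (frechet_derivative \<phi> (at z) v) \<le> ?L * norm v"
          by (simp add: sum_distrib_right sum_distrib_left mult.commute)
      qed
    qed auto
    then show ?thesis by simp
  qed
  moreover have "?L \<ge> 0" using B0 by (simp add: sum_nonneg)
  ultimately show ?thesis by blast
qed

text \<open>Each partial derivative is again a test function and hence Lipschitz. What matters is
  that the quadratic error bound is uniform in \<open>x\<close>: it can then be integrated against a
  weight.\<close>

lemma test_functions_second_order:
  fixes \<phi> :: "'a::euclidean_space \<Rightarrow> real"
  assumes "\<phi> \<in> test_functions \<omega>"
  shows "\<exists>L\<ge>0. \<forall>x h. \<bar>\<phi> (x + h) - \<phi> x - frechet_derivative \<phi> (at x) h\<bar> \<le> L * (norm h)\<^sup>2"
proof -
  have "\<forall>b. \<exists>L. L \<ge> 0 \<and> (\<forall>x y. \<bar>frechet_derivative \<phi> (at x) b - frechet_derivative \<phi> (at y) b\<bar> \<le> L * norm (x - y))"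
    using test_functions_lipschitz[OF test_functions_derivative[OF assms]] by blast
  from choice[OF this] obtain L where L0: "\<And>b. L b \<ge> 0" and
    L: "\<And>b x y. \<bar>frechet_derivative \<phi> (at x) b - frechet_derivative \<phi> (at y) b\<bar> \<le> L b * norm (x - y)"
    by blast
  let ?L = "\<Sum>b\<in>Basis. L b"
  have *: "\<bar>frechet_derivative \<phi> (at x) h - frechet_derivative \<phi> (at y) h\<bar> \<le> ?L * norm (x - y) * norm h" for x y h
  proof -
    have rep: "frechet_derivative \<phi> (at z) h = (\<Sum>b\<in>Basis. (h \<bullet> b) * frechet_derivative \<phi> (at z) b)" for z
    proof -
      interpret bounded_linear "frechet_derivative \<phi> (at z)"
        by (rule test_functionsD(9)[OF assms])
      show ?thesis
        by (subst euclidean_representation[of h, symmetric], subst sum) (simp add: scaleR)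
    qed
    have "frechet_derivative \<phi> (at x) h - frechet_derivative \<phi> (at y) h =
        (\<Sum>b\<in>Basis. (h \<bullet> b) * (frechet_derivative \<phi> (at x) b - frechet_derivative \<phi> (at y) b))"
      by (subst (1 2) rep) (simp add: sum_subtractf right_diff_distrib)
    also have "\<bar>\<dots>\<bar> \<le> (\<Sum>b\<in>Basis. norm h * (L b * norm (x - y)))"
      by (rule order.trans[OF sum_abs]) (auto simp: abs_mult intro!: sum_mono mult_mono L Basis_le_norm)
    finally show ?thesis by (simp add: sum_distrib_right sum_distrib_left mult_ac)
  qed
  have "\<bar>\<phi> (x + h) - \<phi> x - frechet_derivative \<phi> (at x) h\<bar> \<le> ?L * (norm h)\<^sup>2" for x h
  proof -
    have L': "?L \<ge> 0" using L0 by (simp add: sum_nonneg)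
    have "norm (\<phi> (x + h) - \<phi> x - frechet_derivative \<phi> (at x) (x + h - x)) \<le> norm (x + h - x) * (?L * norm h)"
    proof (rule differentiable_bound_linearization[where S="cball x (norm h)"])
      fix z assume z: "z \<in> cball x (norm h)"
      show "(\<phi> has_derivative frechet_derivative \<phi> (at z)) (at z within cball x (norm h))"
        using test_functionsD(8)[OF assms] has_derivative_at_withinI by blast
      show "onorm (frechet_derivative \<phi> (at z) - frechet_derivative \<phi> (at x)) \<le> ?L * norm h"
      proof (rule onorm_le)
        fix v
        have "norm ((frechet_derivative \<phi> (at z) - frechet_derivative \<phi> (at x)) v) \<le> ?L * norm (z - x) * norm v"
          using *[of z v x] by simp
        also have "\<dots> \<le> ?L * norm h * norm v"
          using z L' by (intro mult_right_mono mult_left_mono) (auto simp: dist_norm norm_minus_commute)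
        finally show "norm ((frechet_derivative \<phi> (at z) - frechet_derivative \<phi> (at x)) v) \<le> ?L * norm h * norm v" .
      qed
    qed (auto simp: dist_norm mult_left_le_one_le)
    then show ?thesis by (simp add: power2_eq_square mult_ac)
  qed
  moreover have "?L \<ge> 0" using L0 by (simp add: sum_nonneg)
  ultimately show ?thesis by blast
qed

text \<open>Convolution with \<open>w\<close> and averaging along a segment are both of this form.\<close>

lemma has_derivative_integral_translates:
  fixes \<phi> :: "'a::euclidean_space \<Rightarrow> real"
  assumes \<phi>: "\<phi> \<in> test_functions UNIV" and w: "integrable M w" and \<tau>: "\<tau> \<in> borel_measurable M"
  shows "((\<lambda>z. LINT y|M. w y * \<phi> (z - \<tau> y)) has_derivative
    (\<lambda>v. LINT y|M. w y * frechet_derivative \<phi> (at (z - \<tau> y)) v)) (at z)"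
proof -
  note [measurable] = \<tau> borel_measurable_integrable[OF w]
  have integ: "integrable M (\<lambda>y. w y * \<theta> (z - \<tau> y))" if \<theta>: "\<theta> \<in> test_functions UNIV" for \<theta> :: "'a \<Rightarrow> real" and z
  proof -
    obtain B where B: "B > 0" "\<And>x. norm (\<theta> x) \<le> B" using test_functions_bounded[OF \<theta>] by blast
    have [measurable]: "\<theta> \<in> borel_measurable borel"
      using test_functionsD(6)[OF \<theta>] by (rule borel_measurable_continuous_onI)
    show ?thesis
    proof (rule Bochner_Integration.integrable_bound)
      show "integrable M (\<lambda>y. B * norm (w y))" by (intro integrable_mult_right integrable_norm w)
      show "(\<lambda>y. w y * \<theta> (z - \<tau> y)) \<in> borel_measurable M" by measurable
      have "norm (w y * \<theta> (z - \<tau> y)) \<le> norm (B * norm (w y))" for y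
        using B mult_left_mono[of "norm (\<theta> (z - \<tau> y))" B "norm (w y)"] by (auto simp: abs_mult mult.commute)
      then show "AE y in M. norm (w y * \<theta> (z - \<tau> y)) \<le> norm (B * norm (w y))" by simp
    qed
  qed
  note integD = integ[OF test_functions_derivative[OF \<phi>]]
  obtain L where L: "L \<ge> 0"
    "\<And>x h. \<bar>\<phi> (x + h) - \<phi> x - frechet_derivative \<phi> (at x) h\<bar> \<le> L * (norm h)\<^sup>2"
    using test_functions_second_order[OF \<phi>] by blast
  have lin_at: "linear (frechet_derivative \<phi> (at x))" for x
    by (intro bounded_linear.linear test_functionsD(9)[OF \<phi>])
  let ?I = "LINT y|M. norm (w y)"
  let ?G = "\<lambda>v. LINT y|M. w y * frechet_derivative \<phi> (at (z - \<tau> y)) v"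
  have lin: "linear ?G"
  proof (rule linearI)
    fix u v c
    show "?G (u + v) = ?G u + ?G v"
      by (subst Bochner_Integration.integral_add[symmetric])
        (auto intro!: integD Bochner_Integration.integral_cong
          simp: linear_add[OF lin_at] distrib_left)
    show "?G (c *\<^sub>R u) = c *\<^sub>R ?G u"
      by (subst Bochner_Integration.integral_scaleR_right[symmetric])
        (auto intro!: integD Bochner_Integration.integral_cong
          simp: linear_scale[OF lin_at] mult_ac)
  qed
  \<comment> \<open>Integrating the uniform second-order bound against |w| gives a remainder
    quadratic in \<open>h\<close>; differentiation under the integral sign thus needs no limit
    theorem.\<close>
  have rem: "norm ((LINT y|M. w y * \<phi> (z + h - \<tau> y)) - (LINT y|M. w y * \<phi> (z - \<tau> y)) - ?G h) \<le> L * ?I * (norm h)\<^sup>2" for h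
  proof -
    have "(LINT y|M. w y * \<phi> (z + h - \<tau> y)) - (LINT y|M. w y * \<phi> (z - \<tau> y)) - ?G h =
       (LINT y|M. w y * \<phi> (z + h - \<tau> y) - w y * \<phi> (z - \<tau> y) - w y * frechet_derivative \<phi> (at (z - \<tau> y)) h)"
      by (subst Bochner_Integration.integral_diff, auto intro!: integD integ \<phi> Bochner_Integration.integrable_diff)+
    also have "norm \<dots> \<le> (LINT y|M. norm (w y) * (L * (norm h)\<^sup>2))"
    proof (rule norm_integral_le)
      show "integrable M (\<lambda>y. norm (w y) * (L * (norm h)\<^sup>2))"
        by (intro integrable_mult_left integrable_norm w)
      have "norm (w y * \<phi> (z + h - \<tau> y) - w y * \<phi> (z - \<tau> y) - w y * frechet_derivative \<phi> (at (z - \<tau> y)) h)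
        \<le> norm (w y) * (L * (norm h)\<^sup>2)" for y
      proof -
        have "\<bar>\<phi> (z + h - \<tau> y) - \<phi> (z - \<tau> y) - frechet_derivative \<phi> (at (z - \<tau> y)) h\<bar> \<le> L * (norm h)\<^sup>2"
          using L(2)[of "z - \<tau> y" h] by (simp add: algebra_simps)
        from mult_left_mono[OF this abs_ge_zero[of "w y"]] show ?thesis
          by (simp add: abs_mult[symmetric] algebra_simps)
      qed
      then show "AE y in M. norm (w y * \<phi> (z + h - \<tau> y) - w y * \<phi> (z - \<tau> y) - w y * frechet_derivative \<phi> (at (z - \<tau> y)) h)
        \<le> norm (w y) * (L * (norm h)\<^sup>2)" by simp
    qed
    finally show ?thesis by (simp add: mult_ac)
  qed
  show ?thesis
  proof (rule has_derivativeI)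
    show "bounded_linear ?G" using lin by (simp add: linear_conv_bounded_linear)
    have lim: "((\<lambda>x. L * ?I * norm (x - z)) \<longlongrightarrow> 0) (at z)"
    proof -
      have "((\<lambda>x. L * ?I * norm (x - z)) \<longlongrightarrow> L * ?I * norm (z - z)) (at z)" by (intro tendsto_intros)
      then show ?thesis by simp
    qed
    show "((\<lambda>x. ((LINT y|M. w y * \<phi> (x - \<tau> y)) - (LINT y|M. w y * \<phi> (z - \<tau> y)) - ?G (x - z)) /\<^sub>R norm (x - z)) \<longlongrightarrow> 0) (at z)"
    proof (rule Lim_null_comparison[OF _ lim], rule always_eventually, rule allI)
      fix x
      show "norm (((LINT y|M. w y * \<phi> (x - \<tau> y)) - (LINT y|M. w y * \<phi> (z - \<tau> y)) - ?G (x - z)) /\<^sub>R norm (x - z)) \<le> L * ?I * norm (x - z)"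
        using rem[of "x - z"] by (cases "x = z") (auto simp: field_simps power2_eq_square)
    qed
  qed
qed

lemma frechet_derivative_integral_translates:
  fixes \<phi> :: "'a::euclidean_space \<Rightarrow> real"
  assumes \<phi>: "\<phi> \<in> test_functions UNIV" and w: "integrable M w" and \<tau>: "\<tau> \<in> borel_measurable M"
  shows "frechet_derivative (\<lambda>z. LINT y|M. w y * \<phi> (z - \<tau> y)) (at z) v =
    (LINT y|M. w y * frechet_derivative \<phi> (at (z - \<tau> y)) v)"
  using frechet_derivative_at[OF has_derivative_integral_translates[OF assms]] by metis

lemma class_C_integral_translates:
  fixes \<phi> :: "'a::euclidean_space \<Rightarrow> real"
  assumes "\<phi> \<in> test_functions UNIV" and w: "integrable M w" and \<tau>: "\<tau> \<in> borel_measurable M"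
  shows "class_C m (\<lambda>z. LINT y|M. w y * \<phi> (z - \<tau> y))"
  using assms(1)
proof (induction m arbitrary: \<phi>)
  case 0
  then show ?case
    using has_derivative_continuous[OF has_derivative_integral_translates[OF _ w \<tau>]]
    by (auto simp: continuous_on_eq_continuous_at)
next
  case (Suc m)
  show ?case
    by (rule class_C_SucI[OF has_derivative_integral_translates[OF Suc.prems w \<tau>]])
      (rule Suc.IH[OF test_functions_derivative[OF Suc.prems]])
qed

subsection \<open>Integrals of test functions\<close>

lemma lborel_distr_affine:
  assumes "c = 1 \<or> c = -1"
  shows "distr lborel borel (\<lambda>x::'a::euclidean_space. t + c *\<^sub>R x) = lborel"
proof -
  have "\<bar>c\<bar> ^ DIM('a) = 1" "c \<noteq> 0" using assms by auto
  then show ?thesis using lborel_affine[of c t] by (simp add: density_1)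
qed

lemma
  fixes f :: "'a::euclidean_space \<Rightarrow> 'b::{banach, second_countable_topology}"
  assumes [measurable]: "f \<in> borel_measurable borel" and c: "c = 1 \<or> c = -1"
  shows integral_lborel_affine: "(LINT x|lborel. f (t + c *\<^sub>R x)) = (LINT x|lborel. f x)"
    and integrable_lborel_affine: "integrable lborel (\<lambda>x. f (t + c *\<^sub>R x)) \<longleftrightarrow> integrable lborel f"
proof -
  show "(LINT x|lborel. f (t + c *\<^sub>R x)) = (LINT x|lborel. f x)"
    by (subst (2) lborel_distr_affine[OF c, of t, symmetric]) (simp add: integral_distr)
  show "integrable lborel (\<lambda>x. f (t + c *\<^sub>R x)) \<longleftrightarrow> integrable lborel f"
    by (subst (2) lborel_distr_affine[OF c, of t, symmetric]) (simp add: integrable_distr_eq)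
qed

lemma nn_integral_lborel_affine:
  fixes f :: "'a::euclidean_space \<Rightarrow> ennreal"
  assumes [measurable]: "f \<in> borel_measurable borel" and c: "c = 1 \<or> c = -1"
  shows "(\<integral>\<^sup>+x. f (t + c *\<^sub>R x) \<partial>lborel) = (\<integral>\<^sup>+x. f x \<partial>lborel)"
  by (subst (2) lborel_distr_affine[OF c, of t, symmetric]) (simp add: nn_integral_distr)

lemma integrable_lborel_bounded_support:
  fixes f :: "'a::euclidean_space \<Rightarrow> 'b::{banach, second_countable_topology}"
  assumes "continuous_on UNIV f" "bounded {x. f x \<noteq> 0}"
  shows "integrable lborel f"
proof -
  obtain r where "{x. f x \<noteq> 0} \<subseteq> ball 0 r"
    using bounded_subset_ballD[OF assms(2)] by blast
  then have r: "x \<in> cball 0 r" if "f x \<noteq> 0" for x using that ball_subset_cball by blast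
  have "integrable lborel (\<lambda>x. indicator (cball 0 r) x *\<^sub>R f x)"
    by (intro borel_integrable_compact compact_cball continuous_on_subset[OF assms(1)]) auto
  also have "(\<lambda>x. indicator (cball 0 r) x *\<^sub>R f x) = f"
    using r by (auto simp: fun_eq_iff indicator_def)
  finally show ?thesis .
qed

lemma test_functions_integrable:
  fixes \<phi> :: "'a::euclidean_space \<Rightarrow> 'b::{banach, second_countable_topology}"
  assumes "\<phi> \<in> test_functions \<omega>"
  shows "integrable lborel \<phi>"
  by (rule integrable_lborel_bounded_support[OF test_functionsD(6,4)[OF assms]])

lemma test_functions_measurable:
  fixes \<phi> :: "'a::euclidean_space \<Rightarrow> 'b::real_normed_vector"
  assumes "\<phi> \<in> test_functions \<omega>"
  shows "\<phi> \<in> borel_measurable borel"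
  by (rule borel_measurable_continuous_onI[OF test_functionsD(6)[OF assms]])

lemma test_functions_UNIV:
  "\<phi> \<in> test_functions \<omega> \<Longrightarrow> \<phi> \<in> test_functions UNIV"
  using test_functions_mono[of \<omega> UNIV] by auto

text \<open>Translation invariance: the integral of \<phi>(z + y) over y does not depend on z, and
  its derivative at z = 0 is the integral in question.\<close>

lemma integral_frechet_derivative_eq_0:
  fixes \<phi> :: "'a::euclidean_space \<Rightarrow> real"
  assumes "\<phi> \<in> test_functions \<omega>"
  shows "(LINT x|lborel. frechet_derivative \<phi> (at x) v) = 0"
proof -
  note \<phi> = test_functions_UNIV[OF assms]
  note [measurable] = test_functions_measurable[OF assms] test_functions_measurable[OF test_functions_derivative[OF assms]]
  obtain r where r: "{x. \<phi> x \<noteq> 0} \<subseteq> ball 0 r"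
    using test_functionsD(4)[OF assms] bounded_subset_ballD by blast
  \<comment> \<open>An integrable weight that equals 1 wherever \<phi>(z + y) can be nonzero for |z|
    < 1. The margin 1 in the radius is what permits differentiating at z = 0.\<close>
  define w :: "'a \<Rightarrow> real" where "w = indicator (ball 0 (r + 1))"
  have w: "integrable lborel w"
    using emeasure_lborel_ball_finite[of "0::'a" "r + 1"]
    by (auto simp: w_def intro!: integrable_real_indicator)
  let ?g = "\<lambda>z. LINT y|lborel. w y * \<phi> (z - - y)"
  have const: "?g z = (LINT y|lborel. \<phi> y)" if "z \<in> ball 0 1" for z
  proof -
    have "w y * \<phi> (z - - y) = \<phi> (z + y)" for y
    proof (cases "\<phi> (z + y) = 0")
      case False
      then have "norm (z + y) < r" using r by auto
      moreover have "norm z < 1" using that by simp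
      ultimately have "norm y < r + 1"
        using norm_triangle_ineq4[of "z + y" z] by simp
      then show ?thesis by (simp add: w_def)
    qed simp
    then have "?g z = (LINT y|lborel. \<phi> (z + 1 *\<^sub>R y))"
      by (simp only: scaleR_one)
    then show ?thesis
      using integral_lborel_affine[of \<phi> 1 z] by simp
  qed
  have "((\<lambda>z::'a. LINT y|lborel. \<phi> y) has_derivative (\<lambda>v. 0)) (at 0)" by simp
  then have d0: "(?g has_derivative (\<lambda>v. 0)) (at 0)"
  proof (rule has_derivative_transform_within_open)
    show "(LINT y|lborel. \<phi> y) = ?g z" if "z \<in> ball 0 1" for z
      using const[OF that] by simp
  qed auto
  have d1: "(?g has_derivative (\<lambda>v. LINT y|lborel. w y * frechet_derivative \<phi> (at (0 - - y)) v)) (at 0)"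
    by (rule has_derivative_integral_translates[OF \<phi> w]) measurable
  have "(LINT y|lborel. w y * frechet_derivative \<phi> (at (0 - - y)) v) = 0"
    using fun_cong[OF has_derivative_unique[OF d1 d0], of v] .
  also have "(\<lambda>y. w y * frechet_derivative \<phi> (at (0 - - y)) v) = (\<lambda>y. frechet_derivative \<phi> (at y) v)"
  proof
    fix y
    show "w y * frechet_derivative \<phi> (at (0 - - y)) v = frechet_derivative \<phi> (at y) v"
    proof (cases "y \<in> closure {x. \<phi> x \<noteq> 0}")
      case True
      then have "y \<in> cball 0 r" using closure_minimal[of "{x. \<phi> x \<noteq> 0}" "cball 0 r"] r ball_subset_cball by blast
      then show ?thesis by (simp add: w_def)
    next
      case False
      then show ?thesis by (simp add: frechet_derivative_zero_outside)
    qed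
  qed
  finally show ?thesis .
qed

lemma frechet_derivative_mult_test:
  fixes \<phi> \<psi> :: "'a::euclidean_space \<Rightarrow> real"
  assumes "class_C 1 \<phi>" "class_C 1 \<psi>"
  shows "frechet_derivative (\<lambda>x. \<phi> x * \<psi> x) (at x) v =
    \<phi> x * frechet_derivative \<psi> (at x) v + frechet_derivative \<phi> (at x) v * \<psi> x"
proof -
  have "((\<lambda>x. \<phi> x * \<psi> x) has_derivative
    (\<lambda>v. \<phi> x * frechet_derivative \<psi> (at x) v + frechet_derivative \<phi> (at x) v * \<psi> x)) (at x)"
    using assms by (intro has_derivative_mult) (auto simp: frechet_derivative_works[symmetric])
  from frechet_derivative_at[OF this] show ?thesis by metis
qed

lemma integral_by_parts_test:
  fixes \<phi> \<psi> :: "'a::euclidean_space \<Rightarrow> real"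
  assumes "\<phi> \<in> test_functions \<omega>" "\<And>m. class_C m \<psi>"
  shows "(LINT x|lborel. frechet_derivative \<phi> (at x) v * \<psi> x) = - (LINT x|lborel. \<phi> x * frechet_derivative \<psi> (at x) v)"
proof -
  have "class_C m (\<lambda>x. frechet_derivative \<psi> (at x) v)" for m
    using assms(2)[of "Suc m"] by auto
  note 1 = test_functions_integrable[OF test_functions_mult[OF assms(1) this]]
  note 2 = test_functions_integrable[OF test_functions_mult[OF test_functions_derivative[OF assms(1)] assms(2)], of v]
  have "0 = (LINT x|lborel. \<phi> x * frechet_derivative \<psi> (at x) v + frechet_derivative \<phi> (at x) v * \<psi> x)"
    using integral_frechet_derivative_eq_0[OF test_functions_mult[OF assms], of v]
    by (simp only: frechet_derivative_mult_test[OF test_functionsD(1)[OF assms(1)] assms(2)])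
  then show ?thesis using 1 2 by simp
qed

text \<open>Differentiating the convolution of \<open>\<partial>\<^sub>u \<phi>\<close> with \<open>\<psi>\<close>, with the derivative
  falling on either factor, avoids the symmetry of second derivatives.\<close>

lemma integral_mixed_partials:
  fixes \<phi> \<psi> :: "'a::euclidean_space \<Rightarrow> real"
  assumes "\<phi> \<in> test_functions \<omega>" "\<psi> \<in> test_functions \<omega>"
  shows "(LINT x|lborel. frechet_derivative \<phi> (at x) u * frechet_derivative \<psi> (at x) v) =
    (LINT x|lborel. frechet_derivative \<phi> (at x) v * frechet_derivative \<psi> (at x) u)"
proof -
  note \<phi> = test_functions_UNIV[OF assms(1)] and \<psi> = test_functions_UNIV[OF assms(2)]
  note D\<phi> = test_functions_derivative[OF \<phi>] and D\<psi> = test_functions_derivative[OF \<psi>]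
  note [measurable] = test_functions_measurable[OF \<phi>] test_functions_measurable[OF \<psi>]
    test_functions_measurable[OF D\<phi>] test_functions_measurable[OF D\<psi>]
  have shift: "class_C m (\<lambda>x. \<psi> (z + x))" for m z
    using class_C_compose_affine[OF bounded_linear_ident test_functionsD(1)[OF \<psi>], of m z] by (simp add: add.commute)
  have Dshift: "frechet_derivative (\<lambda>x. \<psi> (z + x)) (at x) v = frechet_derivative \<psi> (at (z + x)) v" for z x v
  proof -
    have "((+) z has_derivative (\<lambda>v. v)) (at x)" by (auto intro!: derivative_eq_intros)
    then have "((\<lambda>x. \<psi> (z + x)) has_derivative frechet_derivative \<psi> (at (z + x))) (at x)"
      using diff_chain_at[of "\<lambda>x. z + x" "\<lambda>v. v" x \<psi>] test_functionsD(8)[OF \<psi>, of "z + x"]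
      by (simp add: o_def)
    from frechet_derivative_at[OF this] show ?thesis by metis
  qed
  let ?g = "\<lambda>z. LINT y|lborel. frechet_derivative \<phi> (at y) u * \<psi> (z - - y)"
  let ?k = "\<lambda>z. LINT y|lborel. frechet_derivative \<psi> (at y) u * \<phi> (z - - y)"
  \<comment> \<open>Integration by parts moves the derivative in direction \<open>u\<close> onto
    \<psi>, and a translation then moves \<open>z\<close> into \<phi>. Differentiating both
    expressions at z = 0 in direction \<open>v\<close> gives the claim.\<close>
  have gk: "?g z = - ?k (- z)" for z
  proof -
    have "?g z = - (LINT y|lborel. \<phi> y * frechet_derivative \<psi> (at (z + y)) u)"
      using integral_by_parts_test[OF \<phi> shift, of u z] by (simp add: Dshift)
    also have "(LINT y|lborel. \<phi> y * frechet_derivative \<psi> (at (z + y)) u) =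
        (LINT y|lborel. \<phi> (- z + (z + 1 *\<^sub>R y)) * frechet_derivative \<psi> (at (z + 1 *\<^sub>R y)) u)"
      by simp
    also have "\<dots> = (LINT y|lborel. \<phi> (- z + y) * frechet_derivative \<psi> (at y) u)"
      by (rule integral_lborel_affine) auto
    finally show ?thesis by (simp add: mult.commute)
  qed
  have dg: "(?g has_derivative (\<lambda>v. LINT y|lborel. frechet_derivative \<phi> (at y) u * frechet_derivative \<psi> (at (0 - - y)) v)) (at 0)"
    by (rule has_derivative_integral_translates[OF \<psi> test_functions_integrable[OF D\<phi>]]) measurable
  have dk: "(?k has_derivative (\<lambda>v. LINT y|lborel. frechet_derivative \<psi> (at y) u * frechet_derivative \<phi> (at (0 - - y)) v)) (at 0)"
    by (rule has_derivative_integral_translates[OF \<phi> test_functions_integrable[OF D\<psi>]]) measurable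
  have dk': "((\<lambda>z. - ?k (- z)) has_derivative (\<lambda>v. - (LINT y|lborel. frechet_derivative \<psi> (at y) u * frechet_derivative \<phi> (at (0 - - y)) (- v)))) (at 0)"
    using diff_chain_at[of uminus uminus 0 ?k] dk
    by (auto simp: o_def intro!: has_derivative_minus has_derivative_ident)
  have "(LINT y|lborel. frechet_derivative \<phi> (at y) u * frechet_derivative \<psi> (at (0 - - y)) v) =
     - (LINT y|lborel. frechet_derivative \<psi> (at y) u * frechet_derivative \<phi> (at (0 - - y)) (- v))"
    using fun_cong[OF has_derivative_unique[OF dg[unfolded gk] dk'], of v] by simp
  moreover have "frechet_derivative \<phi> (at y) (- v) = - frechet_derivative \<phi> (at y) v" for y
    using linear_neg[OF bounded_linear.linear[OF test_functionsD(9)[OF \<phi>]]] .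
  ultimately show ?thesis by (simp add: mult.commute)
qed

lemma bump_exists:
  assumes "r > 0"
  obtains \<rho> :: "'a::euclidean_space \<Rightarrow> real"
  where "\<rho> \<in> test_functions (ball x0 r)" "\<And>x. \<rho> x \<ge> 0" "(LINT x|lborel. \<rho> x) = 1"
proof -
  define \<beta> :: "'a \<Rightarrow> real" where "\<beta> x = flat 0 ((r / 2)\<^sup>2 - (norm (x + - x0))\<^sup>2)" for x
  have C: "class_C m \<beta>" for m
  proof -
    have "class_C m (\<lambda>x. (r / 2)\<^sup>2 + - 1 *\<^sub>R (norm (x + - x0))\<^sup>2)" for m
      by (intro class_C_add class_C_const class_C_compose_linear[OF bounded_linear_scaleR_right]
          class_C_compose_affine[OF bounded_linear_ident class_C_norm_squared])
    from class_C_flat_compose[OF this] show ?thesis unfolding \<beta>_def by simp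
  qed
  have \<beta>: "\<beta> \<in> test_functions (ball x0 r)"
  proof (rule test_functionsI[OF C compact_cball[of x0 "r/2"]])
    show "\<beta> x = 0" if "x \<notin> cball x0 (r / 2)" for x
    proof -
      have "r / 2 \<le> norm (x + - x0)" using that by (simp add: dist_norm norm_minus_commute)
      then have "(r / 2)\<^sup>2 \<le> (norm (x + - x0))\<^sup>2" using assms by (intro power_mono) auto
      then show ?thesis by (simp add: \<beta>_def flat_def)
    qed
  qed (use assms in auto)
  have nonneg: "\<beta> x \<ge> 0" for x by (simp add: \<beta>_def flat_def)
  let ?I = "LINT x|lborel. \<beta> x"
  \<comment> \<open>The value of \<beta> at distance r / 4 from the centre. It bounds \<beta> from
    below on the smaller ball, so the integral is positive and \<beta> can be normalised.\<close>
  let ?c = "exp (- 1 / ((r / 2)\<^sup>2 - (r / 4)\<^sup>2))"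
  have "?c * measure lborel (ball x0 (r / 4)) = (LINT x|lborel. ?c * indicator (ball x0 (r/4)) x)"
    by simp
  also have "\<dots> \<le> ?I"
  proof (rule integral_mono'[OF test_functions_integrable[OF \<beta>]])
    show "?c * indicator (ball x0 (r/4)) x \<le> \<beta> x" for x
    proof (cases "x \<in> ball x0 (r / 4)")
      case True
      have "(norm (x + - x0))\<^sup>2 \<le> (r / 4)\<^sup>2"
        using True assms by (intro power_mono) (auto simp: dist_norm norm_minus_commute)
      moreover have "(r / 4)\<^sup>2 < (r / 2)\<^sup>2"
        using assms by (intro power_strict_mono) auto
      ultimately show ?thesis
        using True by (auto simp: \<beta>_def flat_def intro!: divide_left_mono mult_pos_pos)
    qed (simp add: nonneg)
  qed (simp add: nonneg)
  finally have "?c * measure lborel (ball x0 (r / 4)) \<le> ?I" .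
  moreover have "?c * measure lborel (ball x0 (r / 4)) > 0"
    using content_ball_pos[of "r / 4" x0] assms by (intro mult_pos_pos) auto
  ultimately have I: "?I > 0" by linarith
  show ?thesis
  proof (rule that[of "\<lambda>x. (1 / ?I) *\<^sub>R \<beta> x"])
    show "(\<lambda>x. (1 / ?I) *\<^sub>R \<beta> x) \<in> test_functions (ball x0 r)"
      by (rule test_functions_compose_linear[OF \<beta> bounded_linear_scaleR_right])
  qed (use I nonneg in auto)
qed

subsection \<open>Lebesgue norms\<close>

text \<open>The measure is arbitrary because the same inequalities serve
  \<open>lebesgue_on \<omega>\<close>, \<open>lborel\<close> and the index measure of an average of
  translates.\<close>

definition memL :: "'a measure \<Rightarrow> real \<Rightarrow> ('a \<Rightarrow> 'b::euclidean_space) \<Rightarrow> bool" where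
  "memL M p f \<longleftrightarrow> f \<in> borel_measurable M \<and> integrable M (\<lambda>x. norm (f x) powr p)"

definition nrm :: "'a measure \<Rightarrow> real \<Rightarrow> ('a \<Rightarrow> 'b::euclidean_space) \<Rightarrow> real" where
  "nrm M p f = (LINT x|M. norm (f x) powr p) powr (1 / p)"

lemma Lp_eq: "f \<in> Lp p \<omega> \<longleftrightarrow> memL (lebesgue_on \<omega>) p f"
  by (simp add: Lp_def memL_def)

lemma Lp_norm_eq: "Lp_norm p \<omega> f = nrm (lebesgue_on \<omega>) p f"
  by (simp add: Lp_norm_def nrm_def)

lemma memL_measurable [measurable_dest]: "memL M p f \<Longrightarrow> f \<in> borel_measurable M"
  by (simp add: memL_def)

lemma memL_integrable: "memL M p f \<Longrightarrow> integrable M (\<lambda>x. norm (f x) powr p)"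
  by (simp add: memL_def)

lemma nrm_nonneg [simp]: "nrm M p f \<ge> 0"
  by (simp add: nrm_def)

lemma nrm_powr: "p > 0 \<Longrightarrow> nrm M p f powr p = (LINT x|M. norm (f x) powr p)"
  by (simp add: nrm_def powr_powr)

lemma nrm_le: "p > 0 \<Longrightarrow> c \<ge> 0 \<Longrightarrow> (LINT x|M. norm (f x) powr p) \<le> c powr p \<Longrightarrow> nrm M p f \<le> c"
  using powr_mono2[of "1 / p" "LINT x|M. norm (f x) powr p" "c powr p"]
  by (simp add: nrm_def powr_powr)

lemma memL_mono:
  assumes "memL M p g" "f \<in> borel_measurable M" "AE x in M. norm (f x) \<le> norm (g x)" "p > 0"
  shows "memL M p f" "nrm M p f \<le> nrm M p g"
proof -
  have *: "AE x in M. norm (f x) powr p \<le> norm (g x) powr p"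
    using assms(3) by eventually_elim (use assms(4) in \<open>auto intro: powr_mono2\<close>)
  note [measurable] = assms(2)
  have "integrable M (\<lambda>x. norm (f x) powr p)"
    by (rule Bochner_Integration.integrable_bound[OF memL_integrable[OF assms(1)]]) (use * in auto)
  then show "memL M p f" using assms(2) by (simp add: memL_def)
  have "(LINT x|M. norm (f x) powr p) \<le> (LINT x|M. norm (g x) powr p)"
    by (rule integral_mono_AE'[OF memL_integrable[OF assms(1)] *]) simp
  then show "nrm M p f \<le> nrm M p g"
    using assms(4) by (auto simp: nrm_def intro: powr_mono2)
qed

lemma nrm_cong_AE:
  assumes "AE x in M. norm (f x) = norm (g x)" "f \<in> borel_measurable M" "g \<in> borel_measurable M"
  shows "nrm M p f = nrm M p g"
proof -
  note [measurable] = assms(2,3)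
  have "(LINT x|M. norm (f x) powr p) = (LINT x|M. norm (g x) powr p)"
    by (rule integral_cong_AE) (use assms(1) in auto)
  then show ?thesis by (simp add: nrm_def)
qed

lemma memL_scaleR:
  assumes "memL M p f" "p > 0"
  shows "memL M p (\<lambda>x. c *\<^sub>R f x)" "nrm M p (\<lambda>x. c *\<^sub>R f x) = \<bar>c\<bar> * nrm M p f"
proof -
  note [measurable] = memL_measurable[OF assms(1)]
  show "memL M p (\<lambda>x. c *\<^sub>R f x)"
    using memL_integrable[OF assms(1)] by (simp add: memL_def powr_mult)
  show "nrm M p (\<lambda>x. c *\<^sub>R f x) = \<bar>c\<bar> * nrm M p f"
    using assms(2) by (simp add: nrm_def powr_mult powr_powr)
qed

text \<open>Replaces two norms by strictly larger, hence positive, numbers by which one may divide.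
  Vanishing norms then need no separate case.\<close>

lemma le_mult_of_less:
  fixes A B c :: real
  assumes "A \<ge> 0" "B \<ge> 0" "\<And>A' B'. A' > A \<Longrightarrow> B' > B \<Longrightarrow> c \<le> A' * B'"
  shows "c \<le> A * B"
proof -
  have "(\<lambda>n. (A + 1 / real (Suc n)) * (B + 1 / real (Suc n))) \<longlonglongrightarrow> (A + 0) * (B + 0)"
    by (intro tendsto_intros LIMSEQ_Suc lim_1_over_n)
  then show ?thesis
    using assms(3)[of "A + 1 / real (Suc n)" "B + 1 / real (Suc n)" for n]
    by (intro LIMSEQ_le_const[of _ "A * B" c]) auto
qed

lemma nrm_less_powr:
  assumes "nrm M p f < A" "p > 0" "memL M p f"
  shows "(LINT x|M. norm (f x) powr p) \<le> A powr p"
  using assms powr_mono2[of p "nrm M p f" A] by (simp add: nrm_powr)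

lemma Holder_norm:
  fixes f :: "'a \<Rightarrow> 'b::euclidean_space" and g :: "'a \<Rightarrow> 'c::euclidean_space"
  assumes pq: "p > 1" "q > 1" "1 / p + 1 / q = 1" and f: "memL M p f" and g: "memL M q g"
  shows "integrable M (\<lambda>x. norm (f x) * norm (g x))"
    and "(LINT x|M. norm (f x) * norm (g x)) \<le> nrm M p f * nrm M q g"
proof -
  note [measurable] = memL_measurable[OF f] memL_measurable[OF g]
  note fi = memL_integrable[OF f] and gi = memL_integrable[OF g]
  show *: "integrable M (\<lambda>x. norm (f x) * norm (g x))"
  proof (rule Bochner_Integration.integrable_bound)
    show "integrable M (\<lambda>x. norm (f x) powr p / p + norm (g x) powr q / q)"
      using fi gi by auto
    show "AE x in M. norm (norm (f x) * norm (g x)) \<le> norm (norm (f x) powr p / p + norm (g x) powr q / q)"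
      using Youngs_inequality[OF pq] pq by (auto simp: abs_of_nonneg)
  qed auto
  show "(LINT x|M. norm (f x) * norm (g x)) \<le> nrm M p f * nrm M q g"
  proof (rule le_mult_of_less)
    fix A B assume AB: "A > nrm M p f" "B > nrm M q g"
    then have pos: "A > 0" "B > 0" by (auto intro: le_less_trans[OF nrm_nonneg])
    have "(LINT x|M. norm (f x) * norm (g x)) \<le>
      (LINT x|M. A * B * (norm (f x) powr p / (p * A powr p) + norm (g x) powr q / (q * B powr q)))"
    proof (rule integral_mono[OF *])
      fix x
      have "norm (f x) * norm (g x) = A * B * ((norm (f x) / A) * (norm (g x) / B))"
        using pos by simp
      also have "\<dots> \<le> A * B * ((norm (f x) / A) powr p / p + (norm (g x) / B) powr q / q)"
        using pos by (intro mult_left_mono Youngs_inequality[OF pq]) auto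
      finally show "norm (f x) * norm (g x) \<le> A * B * (norm (f x) powr p / (p * A powr p) + norm (g x) powr q / (q * B powr q))"
        using pos by (simp add: powr_divide mult.commute)
    qed (use fi gi in auto)
    also have "\<dots> = A * B * ((LINT x|M. norm (f x) powr p) / (p * A powr p) + (LINT x|M. norm (g x) powr q) / (q * B powr q))"
      using fi gi by simp
    also have "\<dots> \<le> A * B * (A powr p / (p * A powr p) + B powr q / (q * B powr q))"
      using pos pq nrm_less_powr[OF AB(1) _ f] nrm_less_powr[OF AB(2) _ g]
      by (intro mult_left_mono add_mono divide_right_mono) auto
    also have "\<dots> = A * B" using pos pq by simp
    finally show "(LINT x|M. norm (f x) * norm (g x)) \<le> A * B" .
  qed auto
qed

lemma Holder_inner:
  fixes f g :: "'a \<Rightarrow> 'b::euclidean_space"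
  assumes pq: "p > 1" "q > 1" "1 / p + 1 / q = 1" and f: "memL M p f" and g: "memL M q g"
  shows "integrable M (\<lambda>x. f x \<bullet> g x)"
    and "\<bar>LINT x|M. f x \<bullet> g x\<bar> \<le> nrm M p f * nrm M q g"
proof -
  note [measurable] = memL_measurable[OF f] memL_measurable[OF g]
  note * = Holder_norm[OF assms]
  show "integrable M (\<lambda>x. f x \<bullet> g x)"
    by (rule Bochner_Integration.integrable_bound[OF *(1)]) (auto simp: abs_mult Cauchy_Schwarz_ineq2)
  have "norm (LINT x|M. f x \<bullet> g x) \<le> (LINT x|M. norm (f x) * norm (g x))"
    by (rule norm_integral_le[OF *(1)]) (auto simp: Cauchy_Schwarz_ineq2)
  with *(2) show "\<bar>LINT x|M. f x \<bullet> g x\<bar> \<le> nrm M p f * nrm M q g" by simp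
qed

lemma powr_convex_nonneg:
  fixes u v t p :: real
  assumes "u \<ge> 0" "v \<ge> 0" "0 < t" "t < 1" "p \<ge> 1"
  shows "(t * u + (1 - t) * v) powr p \<le> t * u powr p + (1 - t) * v powr p"
proof -
  have s: "s powr p \<le> s" if "0 < s" "s < 1" for s :: real
    using powr_mono'[of 1 p s] that assms(5) by simp
  consider "u = 0" | "v = 0" | "u > 0" "v > 0" using assms by linarith
  then show ?thesis
  proof cases
    case 1
    then show ?thesis using s[of "1 - t"] assms by (auto simp: powr_mult intro: mult_right_mono)
  next
    case 2
    then show ?thesis using s[of t] assms by (auto simp: powr_mult intro: mult_right_mono)
  next
    case 3
    then show ?thesis
      using convex_onD[OF powr_convex[OF assms(5)], of "1 - t" u v] assms by (simp add: mult.commute)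
  qed
qed

text \<open>For A and B slightly above the two norms, (|f| + |g|) / (A + B) is the convex
  combination of |f| / A and |g| / B with weights A / (A + B) and B / (A + B). Convexity of the p-th
  power and integration give the bound A + B.\<close>

lemma Minkowski:
  fixes f g :: "'a \<Rightarrow> 'b::euclidean_space"
  assumes p: "p \<ge> 1" and f: "memL M p f" and g: "memL M p g"
  shows "memL M p (\<lambda>x. f x + g x)" and "nrm M p (\<lambda>x. f x + g x) \<le> nrm M p f + nrm M p g"
proof -
  note [measurable] = memL_measurable[OF f] memL_measurable[OF g]
  note fi = memL_integrable[OF f] and gi = memL_integrable[OF g]
  have pt: "norm (f x + g x) powr p \<le> (A + B) powr p * (A / (A + B) * (norm (f x) powr p / A powr p) +
      B / (A + B) * (norm (g x) powr p / B powr p))" if "A > 0" "B > 0" for A B x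
  proof -
    have t: "1 - A / (A + B) = B / (A + B)" using that by (simp add: field_simps)
    have "norm (f x + g x) powr p \<le> (norm (f x) + norm (g x)) powr p"
      using p by (intro powr_mono2 norm_triangle_ineq) auto
    also have "norm (f x) + norm (g x) = (A + B) * (A / (A + B) * (norm (f x) / A) + (1 - A / (A + B)) * (norm (g x) / B))"
    proof -
      have "A + B \<noteq> 0" using that by simp
      then show ?thesis unfolding t using that by (simp add: distrib_left)
    qed
    also have "\<dots> powr p = (A + B) powr p * (A / (A + B) * (norm (f x) / A) + (1 - A / (A + B)) * (norm (g x) / B)) powr p"
      using that by (intro powr_mult)
    also have "\<dots> \<le> (A + B) powr p * (A / (A + B) * (norm (f x) / A) powr p + (1 - A / (A + B)) * (norm (g x) / B) powr p)"
      using that p by (intro mult_left_mono powr_convex_nonneg) auto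
    finally show ?thesis unfolding t using that by (simp add: powr_divide)
  qed
  have int: "integrable M (\<lambda>x. (A + B) powr p * (A / (A + B) * (norm (f x) powr p / A powr p) +
      B / (A + B) * (norm (g x) powr p / B powr p)))" for A B
    using fi gi by auto
  have i: "integrable M (\<lambda>x. norm (f x + g x) powr p)"
    by (rule Bochner_Integration.integrable_bound[OF int[of 1 1]])
      (use pt[of 1 1] in \<open>auto intro!: AE_I2 order_trans[OF _ abs_ge_self]\<close>)
  then show "memL M p (\<lambda>x. f x + g x)" by (simp add: memL_def)
  show "nrm M p (\<lambda>x. f x + g x) \<le> nrm M p f + nrm M p g"
  proof (rule field_le_epsilon)
    fix e :: real assume "e > 0"
    define A where "A = nrm M p f + e / 2"
    define B where "B = nrm M p g + e / 2"
    have AB: "A > nrm M p f" "B > nrm M p g" using \<open>e > 0\<close> by (auto simp: A_def B_def)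
    then have pos: "A > 0" "B > 0" by (auto intro: le_less_trans[OF nrm_nonneg])
    have "(LINT x|M. norm (f x + g x) powr p) \<le> (LINT x|M. (A + B) powr p * (A / (A + B) * (norm (f x) powr p / A powr p) +
      B / (A + B) * (norm (g x) powr p / B powr p)))"
      by (rule integral_mono[OF i int pt[OF pos]])
    also have "\<dots> = (A + B) powr p * (A / (A + B) * ((LINT x|M. norm (f x) powr p) / A powr p) +
      B / (A + B) * ((LINT x|M. norm (g x) powr p) / B powr p))"
      using fi gi by simp
    also have "\<dots> \<le> (A + B) powr p * (A / (A + B) * (A powr p / A powr p) + B / (A + B) * (B powr p / B powr p))"
      using pos p nrm_less_powr[OF AB(1) _ f] nrm_less_powr[OF AB(2) _ g]
      by (intro mult_left_mono add_mono divide_right_mono) auto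
    also have "\<dots> = (A + B) powr p" using pos by (simp add: add_divide_distrib[symmetric])
    finally have "nrm M p (\<lambda>x. f x + g x) \<le> A + B"
      using pos p by (intro nrm_le) auto
    then show "nrm M p (\<lambda>x. f x + g x) \<le> nrm M p f + nrm M p g + e"
      by (simp add: A_def B_def)
  qed
qed

lemma Minkowski_diff:
  fixes f g :: "'a \<Rightarrow> 'b::euclidean_space"
  assumes p: "p \<ge> 1" and f: "memL M p f" and g: "memL M p g"
  shows "memL M p (\<lambda>x. f x - g x)" and "nrm M p (\<lambda>x. f x - g x) \<le> nrm M p f + nrm M p g"
  using Minkowski[OF p f memL_scaleR(1)[OF g, of "-1"]] memL_scaleR(2)[OF g, of "-1"] p by auto

text \<open>Hoelder's inequality for |f|^r against the indicator of \<open>A\<close>, with exponent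
  p / r and its conjugate.\<close>

lemma memL_finite_support:
  fixes f :: "'a \<Rightarrow> 'b::euclidean_space"
  assumes rp: "0 < r" "r < p" and f: "memL M p f"
    and A: "A \<in> sets M" "emeasure M A < \<infinity>" "\<And>x. x \<in> space M \<Longrightarrow> x \<notin> A \<Longrightarrow> f x = 0"
  shows "memL M r f" and "nrm M r f \<le> measure M A powr (1 / r - 1 / p) * nrm M p f"
proof -
  note [measurable] = memL_measurable[OF f] A(1)
  let ?q = "1 / (1 - r / p)"
  have pq: "p / r > 1" "?q > 1" "1 / (p / r) + 1 / ?q = 1" using rp by (auto simp: field_simps)
  have 1: "memL M (p / r) (\<lambda>x. norm (f x) powr r)"
    using memL_integrable[OF f] rp by (simp add: memL_def powr_powr)
  have 2: "memL M ?q (\<lambda>x. indicator A x :: real)"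
  proof -
    have "(\<lambda>x. norm (indicator A x :: real) powr ?q) = indicator A"
      by (auto simp: fun_eq_iff indicator_def)
    then show ?thesis using A(2) by (simp add: memL_def)
  qed
  have eq: "norm (norm (f x) powr r) * norm (indicator A x :: real) = norm (f x) powr r" if "x \<in> space M" for x
    using A(3)[OF that] by (auto simp: indicator_def)
  have "integrable M (\<lambda>x. norm (f x) powr r)"
    using Holder_norm(1)[OF pq 1 2] by (rule back_subst[where P="\<lambda>b. b"]) (intro Bochner_Integration.integrable_cong eq refl)
  then show "memL M r f" by (simp add: memL_def)
  have "(LINT x|M. norm (f x) powr r) = (LINT x|M. norm (norm (f x) powr r) * norm (indicator A x :: real))"
    by (intro Bochner_Integration.integral_cong refl) (use eq in simp)
  also have "\<dots> \<le> nrm M (p / r) (\<lambda>x. norm (f x) powr r) * nrm M ?q (\<lambda>x. indicator A x :: real)"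
    by (rule Holder_norm(2)[OF pq 1 2])
  also have "nrm M (p / r) (\<lambda>x. norm (f x) powr r) = nrm M p f powr r"
    using rp by (simp add: nrm_def powr_powr)
  also have "nrm M ?q (\<lambda>x. indicator A x :: real) = measure M A powr (1 - r / p)"
  proof -
    have "(\<lambda>x. norm (indicator A x :: real) powr ?q) = indicator A"
      by (auto simp: fun_eq_iff indicator_def)
    then show ?thesis using rp A(1) sets.sets_into_space[OF A(1)] by (simp add: nrm_def Int_absorb2)
  qed
  finally have "(LINT x|M. norm (f x) powr r) \<le> nrm M p f powr r * measure M A powr (1 - r / p)" .
  also have "\<dots> = (measure M A powr (1 / r - 1 / p) * nrm M p f) powr r"
  proof -
    have "(1 / r - 1 / p) * r = 1 - r / p" using rp by (simp add: field_simps)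
    then show ?thesis by (simp only: powr_mult powr_powr mult.commute)
  qed
  finally show "nrm M r f \<le> measure M A powr (1 / r - 1 / p) * nrm M p f"
    using rp by (intro nrm_le) auto
qed

section \<open>The exponent 4: completeness, uniform convexity and representation of
  functionals\<close>

lemma powr_4 [simp]: "norm x powr 4 = norm x ^ 4"
  by (cases "x = 0") (auto simp: powr_numeral)

text \<open>On a support of finite measure a Cauchy sequence in L^4 is Cauchy in L^1, so a
  subsequence converges almost everywhere. Fatou's lemma then shows that the pointwise limit is the
  L^4 limit of the whole sequence.\<close>

lemma L4_complete:
  fixes u :: "nat \<Rightarrow> 'a \<Rightarrow> 'b::euclidean_space"
  assumes u: "\<And>n. memL M 4 (u n)"
    and A: "A \<in> sets M" "emeasure M A < \<infinity>" "\<And>n x. x \<in> space M \<Longrightarrow> x \<notin> A \<Longrightarrow> u n x = 0"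
    and cauchy: "\<And>e. e > 0 \<Longrightarrow> \<exists>N. \<forall>i\<ge>N. \<forall>j\<ge>N. (LINT x|M. norm (u i x - u j x) ^ 4) < e"
  obtains h where "memL M 4 h" "\<And>x. x \<in> space M \<Longrightarrow> x \<notin> A \<Longrightarrow> h x = 0"
    "(\<lambda>n. nrm M 4 (\<lambda>x. u n x - h x)) \<longlonglongrightarrow> 0"
proof -
  note [measurable] = memL_measurable[OF u]
  have diff: "memL M 4 (\<lambda>x. u i x - u j x)" for i j
    by (intro Minkowski_diff u) auto
  have nrm1: "nrm M 1 f = (LINT x|M. norm (f x))" for f :: "'a \<Rightarrow> 'b" by (simp add: nrm_def)
  let ?K = "measure M A powr (1 / 1 - 1 / 4)"
  have L1: "\<exists>N. \<forall>i\<ge>N. \<forall>j\<ge>N. (LINT x|M. norm (u i x - u j x)) < e" if e: "e > 0" for e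
  proof -
    define d where "d = (e / (?K + 1)) powr 4"
    have K: "?K + 1 > 0" using powr_ge_zero[of "measure M A" "1 / 1 - 1 / 4"] by linarith
    have "d > 0" using e K by (simp add: d_def)
    then obtain N where N: "\<And>i j. i \<ge> N \<Longrightarrow> j \<ge> N \<Longrightarrow> (LINT x|M. norm (u i x - u j x) ^ 4) < d"
      using cauchy by meson
    have "(LINT x|M. norm (u i x - u j x)) < e" if "i \<ge> N" "j \<ge> N" for i j
    proof -
      have "nrm M 4 (\<lambda>x. u i x - u j x) \<le> e / (?K + 1)"
        using N[OF that] e K by (intro nrm_le) (auto simp: d_def)
      then have "?K * nrm M 4 (\<lambda>x. u i x - u j x) \<le> ?K * (e / (?K + 1))"
        by (intro mult_left_mono) auto
      also have "\<dots> < e" using e K by (simp add: field_simps)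
      finally show ?thesis
        using memL_finite_support(2)[of 1 4 M "\<lambda>x. u i x - u j x" A] diff A nrm1[of "\<lambda>x. u i x - u j x"] by fastforce
    qed
    then show ?thesis by blast
  qed
  have int: "integrable M (u n)" for n
    using memL_finite_support(1)[of 1 4 M "u n" A] u A
    by (auto simp: memL_def integrable_norm_iff)
  obtain r where r: "strict_mono r" and cau: "AE x in M. Cauchy (\<lambda>i. u (r i) x)"
    using cauchy_L1_AE_cauchy_subseq[OF int L1] by blast
  \<comment> \<open>Where the subsequence diverges the value is arbitrary, but this happens only on
    a null set. Off \<open>A\<close> the sequence is constantly 0, so the limit vanishes there at
    every point.\<close>
  define h where "h x = lim (\<lambda>i. u (r i) x)" for x
  have [measurable]: "h \<in> borel_measurable M"
    unfolding h_def by (rule borel_measurable_lim_metric) auto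
  have hA: "h x = 0" if "x \<in> space M" "x \<notin> A" for x
    using A(3)[OF that] by (simp add: h_def)
  have lim: "AE x in M. (\<lambda>i. u (r i) x) \<longlonglongrightarrow> h x"
    using cau by eventually_elim (auto simp: h_def Cauchy_convergent_iff convergent_LIMSEQ_iff)
  \<comment> \<open>Fatou's lemma in the second index, along the almost everywhere convergent
    subsequence.\<close>
  have bound: "(\<integral>\<^sup>+x. ennreal (norm (u n x - h x) ^ 4) \<partial>M) \<le> ennreal e"
    if N: "\<And>i j. i \<ge> N \<Longrightarrow> j \<ge> N \<Longrightarrow> (LINT x|M. norm (u i x - u j x) ^ 4) < e" and "n \<ge> N" for n N e
  proof -
    have "(\<integral>\<^sup>+x. ennreal (norm (u n x - h x) ^ 4) \<partial>M) =
        (\<integral>\<^sup>+x. liminf (\<lambda>i. ennreal (norm (u n x - u (r i) x) ^ 4)) \<partial>M)"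
    proof (rule nn_integral_cong_AE)
      show "AE x in M. ennreal (norm (u n x - h x) ^ 4) = liminf (\<lambda>i. ennreal (norm (u n x - u (r i) x) ^ 4))"
        using lim
      proof eventually_elim
        case (elim x)
        have "(\<lambda>i. ennreal (norm (u n x - u (r i) x) ^ 4)) \<longlonglongrightarrow> ennreal (norm (u n x - h x) ^ 4)"
          by (intro tendsto_ennrealI tendsto_intros elim)
        then show ?case using lim_imp_Liminf[OF sequentially_bot] by metis
      qed
    qed
    also have "\<dots> \<le> liminf (\<lambda>i. \<integral>\<^sup>+x. ennreal (norm (u n x - u (r i) x) ^ 4) \<partial>M)"
      by (rule nn_integral_liminf) measurable
    also have "\<dots> \<le> ennreal e"
    proof (rule Liminf_le)
      show "\<forall>\<^sub>F i in sequentially. (\<integral>\<^sup>+x. ennreal (norm (u n x - u (r i) x) ^ 4) \<partial>M) \<le> ennreal e"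
        using eventually_ge_at_top[of N]
      proof eventually_elim
        case (elim i)
        then have "r i \<ge> N" using seq_suble[OF r, of i] by linarith
        have "(\<integral>\<^sup>+x. ennreal (norm (u n x - u (r i) x) ^ 4) \<partial>M) = ennreal (LINT x|M. norm (u n x - u (r i) x) ^ 4)"
          using memL_integrable[OF diff] by (intro nn_integral_eq_integral) auto
        then show ?case using N[OF \<open>n \<ge> N\<close> \<open>r i \<ge> N\<close>] by (simp add: ennreal_leI)
      qed
    qed simp
    finally show ?thesis .
  qed
  have memd: "memL M 4 (\<lambda>x. u n x - h x)" and nb: "(LINT x|M. norm (u n x - h x) ^ 4) \<le> e"
    if N: "\<And>i j. i \<ge> N \<Longrightarrow> j \<ge> N \<Longrightarrow> (LINT x|M. norm (u i x - u j x) ^ 4) < e" and "n \<ge> N" "e > 0" for n N e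
  proof -
    have "integrable M (\<lambda>x. norm (u n x - h x) ^ 4)"
      using le_less_trans[OF bound[OF N \<open>n \<ge> N\<close>]] by (intro integrableI_bounded) auto
    then show "memL M 4 (\<lambda>x. u n x - h x)" by (simp add: memL_def)
    show "(LINT x|M. norm (u n x - h x) ^ 4) \<le> e"
      using bound[OF N \<open>n \<ge> N\<close>] \<open>e > 0\<close> by (simp add: integral_eq_nn_integral enn2real_leI)
  qed
  obtain N where N: "\<And>i j. i \<ge> N \<Longrightarrow> j \<ge> N \<Longrightarrow> (LINT x|M. norm (u i x - u j x) ^ 4) < 1"
    using cauchy[of 1] by auto
  have "memL M 4 (\<lambda>x. u N x - (u N x - h x))"
    by (intro Minkowski_diff u memd[OF N]) auto
  then have "memL M 4 h" by simp
  moreover have "(\<lambda>n. nrm M 4 (\<lambda>x. u n x - h x)) \<longlonglongrightarrow> 0"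
  proof (rule LIMSEQ_I)
    fix e :: real assume e: "e > 0"
    have "(e / 2) powr 4 > 0" using e by simp
    then obtain N where N: "\<And>i j. i \<ge> N \<Longrightarrow> j \<ge> N \<Longrightarrow> (LINT x|M. norm (u i x - u j x) ^ 4) < (e / 2) powr 4"
      using cauchy by meson
    have "nrm M 4 (\<lambda>x. u n x - h x) \<le> e / 2" if "n \<ge> N" for n
      using nb[OF N that] e by (intro nrm_le) auto
    then show "\<exists>N. \<forall>n\<ge>N. norm (nrm M 4 (\<lambda>x. u n x - h x) - 0) < e"
      using e by (intro exI[of _ N]) fastforce
  qed
  ultimately show ?thesis using that hA by blast
qed

lemma nrm_4: "(LINT x|M. norm (f x) ^ 4) = nrm M 4 f ^ 4"
proof -
  have "nrm M 4 f powr 4 = (LINT x|M. norm (f x) powr 4)" by (rule nrm_powr) simp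
  moreover have "nrm M 4 f powr 4 = nrm M 4 f ^ 4" using powr_4[of "nrm M 4 f"] by simp
  ultimately show ?thesis by simp
qed

lemma abs_nrm_diff_le:
  fixes f g :: "'a \<Rightarrow> 'b::euclidean_space"
  assumes "p \<ge> 1" "memL M p f" "memL M p g"
  shows "\<bar>nrm M p f - nrm M p g\<bar> \<le> nrm M p (\<lambda>x. f x - g x)"
proof -
  have d: "memL M p (\<lambda>x. f x - g x)" by (rule Minkowski_diff[OF assms])
  have "nrm M p (\<lambda>x. g x - f x) = nrm M p (\<lambda>x. f x - g x)"
    by (simp add: nrm_def norm_minus_commute)
  then show ?thesis
    using Minkowski(2)[OF assms(1) d assms(3)] Minkowski(2)[OF assms(1) Minkowski_diff(1)[OF assms(1,3,2)] assms(2)]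
    by simp
qed

lemma memL_bounded_support:
  fixes f :: "'a \<Rightarrow> 'b::euclidean_space"
  assumes [measurable]: "f \<in> borel_measurable M" "A \<in> sets M" and "emeasure M A < \<infinity>"
    and "\<And>x. x \<in> space M \<Longrightarrow> norm (f x) \<le> B" "\<And>x. x \<in> space M \<Longrightarrow> x \<notin> A \<Longrightarrow> f x = 0" and "p > 0"
  shows "memL M p f"
proof -
  have "integrable M (\<lambda>x. norm (f x) powr p)"
  proof (rule Bochner_Integration.integrable_bound)
    show "integrable M (\<lambda>x. B powr p * indicator A x)"
      using assms(3) by (intro integrable_mult_right integrable_real_indicator) auto
    show "AE x in M. norm (norm (f x) powr p) \<le> norm (B powr p * indicator A x)"
      using assms(4-6) by (intro AE_I2) (auto simp: indicator_def intro!: powr_mono2)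
  qed auto
  then show ?thesis by (simp add: memL_def)
qed

text \<open>The duality map of L^4, without normalisation: |h|^2 h lies in the conjugate space, and
  its pairing with \<open>h\<close> is the fourth power of the norm. It is the Euler-Lagrange field
  of the 4-energy and, once normalised, a norming functional.\<close>

lemma norm_cube_memL:
  fixes h :: "'a \<Rightarrow> 'b::euclidean_space"
  assumes "memL M 4 h"
  shows "memL M (4/3) (\<lambda>x. (norm (h x))\<^sup>2 *\<^sub>R h x)"
    and "nrm M (4/3) (\<lambda>x. (norm (h x))\<^sup>2 *\<^sub>R h x) = nrm M 4 h ^ 3"
proof -
  note [measurable] = memL_measurable[OF assms]
  have eq: "norm ((norm (h x))\<^sup>2 *\<^sub>R h x) powr (4/3) = norm (h x) powr 4" for x
  proof (cases "h x = 0")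
    case False
    have "norm ((norm (h x))\<^sup>2 *\<^sub>R h x) = norm (h x) powr 3"
      using False by (simp add: powr_numeral power2_eq_square power3_eq_cube)
    then show ?thesis by (simp only: powr_powr) simp
  qed simp
  show "memL M (4/3) (\<lambda>x. (norm (h x))\<^sup>2 *\<^sub>R h x)"
    using memL_integrable[OF assms] unfolding memL_def eq by auto
  have "nrm M (4/3) (\<lambda>x. (norm (h x))\<^sup>2 *\<^sub>R h x) = (nrm M 4 h powr 4) powr (1 / (4/3))"
    unfolding nrm_def[of M "4/3"] eq by (subst nrm_powr) auto
  also have "\<dots> = nrm M 4 h powr 3" by (simp only: powr_powr) simp
  also have "\<dots> = nrm M 4 h ^ 3" by (cases "nrm M 4 h = 0") (auto simp: powr_numeral less_le)
  finally show "nrm M (4/3) (\<lambda>x. (norm (h x))\<^sup>2 *\<^sub>R h x) = nrm M 4 h ^ 3" .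
qed

text \<open>A Clarkson inequality, obtained from the parallelogram law and convexity of the square.
  It is the uniform convexity that makes minimising sequences Cauchy.\<close>

lemma norm_midpoint_4_le:
  fixes x y :: "'a::real_inner"
  shows "norm ((1/2) *\<^sub>R (x + y)) ^ 4 + norm ((1/2) *\<^sub>R (x - y)) ^ 4 \<le> (norm x ^ 4 + norm y ^ 4) / 2"
proof -
  define u where "u = (norm (x + y))\<^sup>2 / 4"
  define v where "v = (norm (x - y))\<^sup>2 / 4"
  have uv: "u + v = ((norm x)\<^sup>2 + (norm y)\<^sup>2) / 2"
    unfolding u_def v_def by (simp add: power2_norm_eq_inner inner_simps inner_commute field_simps)
  have "norm ((1/2) *\<^sub>R (x + y)) ^ 4 = u\<^sup>2" "norm ((1/2) *\<^sub>R (x - y)) ^ 4 = v\<^sup>2"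
    by (simp_all add: u_def v_def power_divide flip: power_mult)
  moreover have "u\<^sup>2 + v\<^sup>2 \<le> (u + v)\<^sup>2"
    by (simp add: u_def v_def power2_sum)
  moreover have "(((norm x)\<^sup>2 + (norm y)\<^sup>2) / 2)\<^sup>2 \<le> (norm x ^ 4 + norm y ^ 4) / 2"
  proof -
    have "0 \<le> ((norm x)\<^sup>2 - (norm y)\<^sup>2)\<^sup>2" by simp
    then show ?thesis by (simp add: power2_eq_square power4_eq_xxxx field_simps)
  qed
  ultimately show ?thesis unfolding uv by linarith
qed

text \<open>A one-sided first variation of the fourth power with a remainder that is quadratic in
  \<open>t\<close> and integrable; it replaces differentiation under the integral sign. The
  constants 11 and 14 are generous, any others would do.\<close>

lemma norm_4_expansion:
  fixes x y :: "'a::real_inner"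
  assumes "\<bar>t\<bar> \<le> 1"
  shows "norm (x + t *\<^sub>R y) ^ 4 \<le> norm x ^ 4 + 4 * t * (((norm x)\<^sup>2 *\<^sub>R x) \<bullet> y) + t\<^sup>2 * (11 * norm x ^ 4 + 14 * norm y ^ 4)"
proof -
  define a where "a = (norm x)\<^sup>2" define b where "b = (norm y)\<^sup>2" define c where "c = x \<bullet> y"
  have c2: "c\<^sup>2 \<le> a * b"
    using Cauchy_Schwarz_ineq[of x y] by (simp add: a_def b_def c_def power2_norm_eq_inner)
  have n: "(norm (x + t *\<^sub>R y))\<^sup>2 = a + 2 * t * c + t\<^sup>2 * b"
    unfolding a_def b_def c_def power2_norm_eq_inner
    by (simp add: inner_simps inner_commute power2_eq_square algebra_simps)
  have "norm (x + t *\<^sub>R y) ^ 4 = (a + 2 * t * c + t\<^sup>2 * b)\<^sup>2"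
    by (simp add: n[symmetric] flip: power_mult)
  also have "\<dots> = a\<^sup>2 + 4 * t * (a * c) + t\<^sup>2 * (4 * c\<^sup>2 + 2 * a * b + 4 * t * c * b + t\<^sup>2 * b\<^sup>2)"
    by (simp add: power2_eq_square algebra_simps)
  also have "\<dots> \<le> a\<^sup>2 + 4 * t * (a * c) + t\<^sup>2 * (11 * a\<^sup>2 + 14 * b\<^sup>2)"
  proof -
    have "4 * t * c * b \<le> 2 * (t * c)\<^sup>2 + 2 * b\<^sup>2"
      using zero_le_power2[of "t * c - b"] by (simp add: power2_diff algebra_simps)
    moreover have t2: "t\<^sup>2 \<le> 1" using assms by (simp add: abs_square_le_1)
    then have "(t * c)\<^sup>2 \<le> c\<^sup>2" by (simp add: power_mult_distrib mult_left_le_one_le)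
    moreover have "t\<^sup>2 * b\<^sup>2 \<le> b\<^sup>2" using t2 by (simp add: mult_left_le_one_le)
    moreover have "2 * (a * b) \<le> a\<^sup>2 + b\<^sup>2"
      using zero_le_power2[of "a - b"] by (simp add: power2_diff algebra_simps)
    moreover have "0 \<le> a\<^sup>2" "0 \<le> b\<^sup>2" by auto
    ultimately have "4 * c\<^sup>2 + 2 * a * b + 4 * t * c * b + t\<^sup>2 * b\<^sup>2 \<le> 11 * a\<^sup>2 + 14 * b\<^sup>2"
      using c2 by linarith
    then show ?thesis by (intro add_left_mono mult_left_mono) auto
  qed
  finally show ?thesis by (simp add: a_def b_def c_def flip: power_mult)
qed

text \<open>The first-order condition at a minimum, in the form in which it follows from a quadratic
  remainder bound.\<close>

lemma linear_term_eq_0: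
  fixes X K :: real
  assumes var: "\<And>t. \<bar>t\<bar> \<le> 1 \<Longrightarrow> 0 \<le> t * X + t\<^sup>2 * K" and "K \<ge> 0"
  shows "X = 0"
proof (rule ccontr)
  assume X: "X \<noteq> 0"
  \<comment> \<open>The choice t = - X / S satisfies |t| <= 1, and S > K makes the quadratic term
    too small to compensate the negative linear one.\<close>
  define S where "S = \<bar>X\<bar> + K"
  have S: "S > 0" "\<bar>X\<bar> \<le> S" "K - S < 0" using X assms(2) by (auto simp: S_def)
  have "0 \<le> (- X / S) * X + (- X / S)\<^sup>2 * K"
    using S by (intro var) (auto simp: abs_divide)
  also have "\<dots> = X\<^sup>2 / S\<^sup>2 * (K - S)"
    using S(1) by (simp add: power2_eq_square field_simps)
  also have "\<dots> < 0" using X S by (intro mult_pos_neg) auto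
  finally show False by simp
qed

lemma conj_4_43: "(4/3::real) > 1" "(4::real) > 1" "1 / (4/3) + 1 / (4::real) = 1" "1 / (4::real) + 1 / (4/3) = 1"
  by auto

text \<open>Minimising \<open>\<integral> \<bar>u\<bar>\<^sup>4 / 4 - s \<bullet> u\<close> over \<open>D\<close> (a 4-Laplace problem when \<open>D\<close> consists of
  gradients) represents the functional \<open>u \<mapsto> \<integral> s \<bullet> u\<close> on \<open>D\<close> by a field whose norm is the norm of
  the functional.\<close>

lemma norm_preserving_representation:
  fixes s :: "'a \<Rightarrow> 'b::euclidean_space"
  assumes D: "\<And>u. u \<in> D \<Longrightarrow> memL M 4 u" "\<And>u x. u \<in> D \<Longrightarrow> x \<in> space M \<Longrightarrow> x \<notin> A \<Longrightarrow> u x = 0"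
    and add: "\<And>u v. u \<in> D \<Longrightarrow> v \<in> D \<Longrightarrow> (\<lambda>x. u x + v x) \<in> D"
    and scale: "\<And>u c. u \<in> D \<Longrightarrow> (\<lambda>x. c *\<^sub>R u x) \<in> D"
    and ne: "D \<noteq> {}"
    and A: "A \<in> sets M" "emeasure M A < \<infinity>"
    and s: "memL M (4/3) s" and bound: "\<And>u. u \<in> D \<Longrightarrow> \<bar>LINT x|M. s x \<bullet> u x\<bar> \<le> \<epsilon> * nrm M 4 u" and "\<epsilon> \<ge> 0"
  shows "\<exists>R. memL M (4/3) R \<and> (\<forall>x\<in>space M. x \<notin> A \<longrightarrow> R x = 0) \<and>
    nrm M (4/3) R \<le> \<epsilon> \<and> (\<forall>w\<in>D. (LINT x|M. R x \<bullet> w x) = (LINT x|M. s x \<bullet> w x))"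
proof -
  note Hi = Holder_inner[OF conj_4_43(1,2,3)]
  define J where "J u = (1/4) * nrm M 4 u ^ 4 - (LINT x|M. s x \<bullet> u x)" for u :: "'a \<Rightarrow> 'b"
  have lower: "J u \<ge> - 1/4 - \<epsilon>\<^sup>2 / 2" if "u \<in> D" for u
  proof -
    let ?N = "nrm M 4 u"
    have "(LINT x|M. s x \<bullet> u x) \<le> \<epsilon> * ?N" using bound[OF that] by linarith
    \<comment> \<open>These squares give N^4 / 4 >= N^2 / 2 - 1 / 4 and \<epsilon> N <= N^2 / 2 +
      \<epsilon>^2 / 2.\<close>
    moreover have "0 \<le> (?N\<^sup>2 - 1)\<^sup>2" "0 \<le> (?N - \<epsilon>)\<^sup>2" by auto
    ultimately show ?thesis
      by (simp add: J_def power2_eq_square power4_eq_xxxx field_simps)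
  qed
  define m where "m = Inf (J ` D)"
  have bdd: "bdd_below (J ` D)" using lower by (auto intro!: bdd_belowI)
  have m_le: "m \<le> J u" if "u \<in> D" for u
    unfolding m_def using that by (intro cInf_lower bdd) auto
  have "\<exists>u\<in>D. J u < m + 1 / real (Suc n)" for n
  proof -
    have "m < m + 1 / real (Suc n)" by simp
    then show ?thesis unfolding m_def using cInf_less_iff[of "J ` D"] ne bdd by blast
  qed
  then obtain u where u: "\<And>n. u n \<in> D" and Ju: "\<And>n. J (u n) < m + 1 / real (Suc n)" by metis
  note uL = D(1)[OF u]
  have i4: "integrable M (\<lambda>x. norm (f x) ^ 4)" if "memL M 4 f" for f :: "'a \<Rightarrow> 'b"
    using memL_integrable[OF that] by simp
  \<comment> \<open>The midpoint lies in \<open>D\<close>, so its energy is at least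
    \<open>m\<close>, while both endpoints are within 1 / (n + 1) of \<open>m\<close>. The linear
    terms cancel, and the convexity gain, 1 / 16 of the integral on the left, is at most twice the
    sum of the two excesses; hence 32 = 2 * 16.\<close>
  have cau: "(LINT x|M. norm (u i x - u j x) ^ 4) \<le> 32 / real (Suc i) + 32 / real (Suc j)" for i j
  proof -
    let ?mid = "\<lambda>x. (1/2) *\<^sub>R (u i x + u j x)"
    have mid: "?mid \<in> D" by (intro scale add u)
    have d: "memL M 4 (\<lambda>x. (1/2) *\<^sub>R (u i x - u j x))"
      by (intro memL_scaleR Minkowski_diff uL) auto
    have "(LINT x|M. norm (?mid x) ^ 4) + (LINT x|M. norm ((1/2) *\<^sub>R (u i x - u j x)) ^ 4) =
      (LINT x|M. norm (?mid x) ^ 4 + norm ((1/2) *\<^sub>R (u i x - u j x)) ^ 4)"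
      by (rule Bochner_Integration.integral_add[symmetric]; rule i4[OF D(1)[OF mid]] i4[OF d])
    also have "\<dots> \<le> (LINT x|M. (norm (u i x) ^ 4 + norm (u j x) ^ 4) / 2)"
      by (rule integral_mono[OF _ _ norm_midpoint_4_le])
        (intro Bochner_Integration.integrable_add integrable_divide i4 D(1)[OF mid] d uL)+
    also have "\<dots> = ((LINT x|M. norm (u i x) ^ 4) + (LINT x|M. norm (u j x) ^ 4)) / 2"
      using i4[OF uL[of i]] i4[OF uL[of j]] by simp
    finally have 1: "(LINT x|M. norm (?mid x) ^ 4) + (LINT x|M. norm ((1/2) *\<^sub>R (u i x - u j x)) ^ 4) \<le>
      ((LINT x|M. norm (u i x) ^ 4) + (LINT x|M. norm (u j x) ^ 4)) / 2" .
    have 2: "(LINT x|M. norm ((1/2) *\<^sub>R (u i x - u j x)) ^ 4) = (LINT x|M. norm (u i x - u j x) ^ 4) / 16"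
      by (simp add: power_divide)
    have 3: "(LINT x|M. s x \<bullet> ?mid x) = ((LINT x|M. s x \<bullet> u i x) + (LINT x|M. s x \<bullet> u j x)) / 2"
      using Hi(1)[OF s uL[of i]] Hi(1)[OF s uL[of j]] by (simp add: inner_add_right)
    show ?thesis
    proof -
      have arith: "d \<le> 32 * p + 32 * q" if "c + d / 16 \<le> (a + b) / 2" "m \<le> 1 / 4 * c - (s + s') / 2"
        "1 / 4 * a - s < m + p" "1 / 4 * b - s' < m + q" for a b c d s s' p q :: real
        using that by (simp add: field_simps)
      have e: "32 / real (Suc k) = 32 * (1 / real (Suc k))" for k by simp
      show ?thesis
        by (rule arith[OF 1[unfolded 2] m_le[OF mid, unfolded J_def 3, folded nrm_4]
              Ju[of i, unfolded J_def, folded nrm_4] Ju[of j, unfolded J_def, folded nrm_4], folded e])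
    qed
  qed
  have cauchy: "\<exists>N. \<forall>i\<ge>N. \<forall>j\<ge>N. (LINT x|M. norm (u i x - u j x) ^ 4) < e" if "e > 0" for e
  proof -
    obtain N where N: "64 / e < real N" using reals_Archimedean2 by blast
    have "32 / real (Suc i) < e / 2" if "i \<ge> N" for i
    proof -
      have "64 / e < real (Suc i)" using N that by linarith
      then show ?thesis using \<open>e > 0\<close> by (simp add: field_simps)
    qed
    note small = this
    have "(LINT x|M. norm (u i x - u j x) ^ 4) < e" if "i \<ge> N" "j \<ge> N" for i j
      using cau[of i j] small[OF that(1)] small[OF that(2)] by linarith
    then show ?thesis by blast
  qed
  obtain h where h: "memL M 4 h" "\<And>x. x \<in> space M \<Longrightarrow> x \<notin> A \<Longrightarrow> h x = 0"
    and lim: "(\<lambda>n. nrm M 4 (\<lambda>x. u n x - h x)) \<longlonglongrightarrow> 0"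
    using L4_complete[OF uL A D(2)[OF u] cauchy] by blast
  have lim_inner: "(\<lambda>n. LINT x|M. f x \<bullet> u n x) \<longlonglongrightarrow> (LINT x|M. f x \<bullet> h x)" if f: "memL M (4/3) f" for f
  proof (rule LIM_zero_cancel, rule Lim_null_comparison)
    have "norm ((LINT x|M. f x \<bullet> u n x) - (LINT x|M. f x \<bullet> h x)) \<le> nrm M (4/3) f * nrm M 4 (\<lambda>x. u n x - h x)" for n
    proof -
      have "(LINT x|M. f x \<bullet> u n x) - (LINT x|M. f x \<bullet> h x) = (LINT x|M. f x \<bullet> (u n x - h x))"
        using Hi(1)[OF f uL[of n]] Hi(1)[OF f h(1)] by (simp add: inner_diff_right)
      then show ?thesis using Hi(2)[OF f Minkowski_diff(1)[OF _ uL[of n] h(1)]] by simp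
    qed
    then show "\<forall>\<^sub>F n in sequentially. norm ((LINT x|M. f x \<bullet> u n x) - (LINT x|M. f x \<bullet> h x)) \<le> nrm M (4/3) f * nrm M 4 (\<lambda>x. u n x - h x)"
      by simp
    show "(\<lambda>n. nrm M (4/3) f * nrm M 4 (\<lambda>x. u n x - h x)) \<longlonglongrightarrow> 0"
      using tendsto_mult[OF tendsto_const lim] by simp
  qed
  have lim_nrm: "(\<lambda>n. nrm M 4 (\<lambda>x. u n x + w x)) \<longlonglongrightarrow> nrm M 4 (\<lambda>x. h x + w x)" if w: "memL M 4 w" for w
  proof (rule LIM_zero_cancel, rule Lim_null_comparison[OF _ lim])
    have "norm (nrm M 4 (\<lambda>x. u n x + w x) - nrm M 4 (\<lambda>x. h x + w x)) \<le> nrm M 4 (\<lambda>x. u n x - h x)" for n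
      using abs_nrm_diff_le[of 4 M "\<lambda>x. u n x + w x" "\<lambda>x. h x + w x"] Minkowski(1)[OF _ uL[of n] w] Minkowski(1)[OF _ h(1) w]
      by simp
    then show "\<forall>\<^sub>F n in sequentially. norm (nrm M 4 (\<lambda>x. u n x + w x) - nrm M 4 (\<lambda>x. h x + w x)) \<le> nrm M 4 (\<lambda>x. u n x - h x)"
      by simp
  qed
  have zero: "memL M 4 (\<lambda>x. 0 :: 'b)" by (simp add: memL_def)
  have limJ: "(\<lambda>n. J (u n)) \<longlonglongrightarrow> J h"
    unfolding J_def using lim_nrm[OF zero] lim_inner[OF s] by (auto intro!: tendsto_intros)
  have Jh: "J h \<le> m"
  proof (rule LIMSEQ_le[OF limJ])
    show "(\<lambda>n. m + 1 / real (Suc n)) \<longlonglongrightarrow> m"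
      using tendsto_add[OF tendsto_const[of m] LIMSEQ_Suc[OF lim_1_over_n]] by simp
  qed (use Ju in \<open>auto intro: less_imp_le\<close>)
  let ?R = "\<lambda>x. (norm (h x))\<^sup>2 *\<^sub>R h x"
  note R = norm_cube_memL[OF h(1)]
  have EL: "(LINT x|M. ?R x \<bullet> w x) = (LINT x|M. s x \<bullet> w x)" if w: "w \<in> D" for w
  proof -
    note wL = D(1)[OF w]
    let ?X = "(LINT x|M. ?R x \<bullet> w x) - (LINT x|M. s x \<bullet> w x)"
    define K where "K = (11 * (LINT x|M. norm (h x) ^ 4) + 14 * (LINT x|M. norm (w x) ^ 4)) / 4"
    have K0: "K \<ge> 0" by (simp add: K_def)
    \<comment> \<open>The limit \<open>h\<close> need not belong to \<open>D\<close>. The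
      competitors are therefore u_n + t w, which do, and the inequality m <= J (u_n + t w) is passed
      to the limit.\<close>
    have var: "0 \<le> t * ?X + t\<^sup>2 * K" if t: "\<bar>t\<bar> \<le> 1" for t
    proof -
      note tw = memL_scaleR(1)[OF wL, of t, simplified]
      have "(\<lambda>n. J (\<lambda>x. u n x + t *\<^sub>R w x)) \<longlonglongrightarrow> J (\<lambda>x. h x + t *\<^sub>R w x)"
      proof -
        have eq: "(LINT x|M. s x \<bullet> (f x + t *\<^sub>R w x)) = (LINT x|M. s x \<bullet> f x) + t * (LINT x|M. s x \<bullet> w x)" if "memL M 4 f" for f
          using Hi(1)[OF s that] Hi(1)[OF s wL] by (simp add: inner_add_right)
        show ?thesis
          unfolding J_def eq[OF uL] eq[OF h(1)] by (intro tendsto_intros lim_nrm tw lim_inner s)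
      qed
      moreover have "m \<le> J (\<lambda>x. u n x + t *\<^sub>R w x)" for n
        by (intro m_le add u scale w)
      ultimately have "m \<le> J (\<lambda>x. h x + t *\<^sub>R w x)"
        by (intro LIMSEQ_le_const[where X="\<lambda>n. J (\<lambda>x. u n x + t *\<^sub>R w x)"]) auto
      with Jh have 1: "J h \<le> J (\<lambda>x. h x + t *\<^sub>R w x)" by simp
      have 2: "(LINT x|M. s x \<bullet> (h x + t *\<^sub>R w x)) = (LINT x|M. s x \<bullet> h x) + t * (LINT x|M. s x \<bullet> w x)"
        using Hi(1)[OF s h(1)] Hi(1)[OF s wL] by (simp add: inner_add_right)
      have "(LINT x|M. norm (h x + t *\<^sub>R w x) ^ 4) \<le>
        (LINT x|M. norm (h x) ^ 4 + 4 * t * (?R x \<bullet> w x) + t\<^sup>2 * (11 * norm (h x) ^ 4 + 14 * norm (w x) ^ 4))"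
        using i4[OF h(1)] i4[OF wL] Hi(1)[OF R(1) wL] i4[OF Minkowski(1)[OF _ h(1) tw]]
        by (intro integral_mono norm_4_expansion t) auto
      also have "\<dots> = (LINT x|M. norm (h x) ^ 4) + 4 * t * (LINT x|M. ?R x \<bullet> w x) + t\<^sup>2 * (4 * K)"
        using i4[OF h(1)] i4[OF wL] Hi(1)[OF R(1) wL] by (simp add: K_def)
      finally show ?thesis using 1 unfolding J_def 2 nrm_4[symmetric] by (simp add: algebra_simps)
    qed
    have "?X = 0" by (rule linear_term_eq_0[OF var K0])
    then show ?thesis by simp
  qed
  \<comment> \<open>As \<open>h\<close> may lie outside \<open>D\<close>, the bound is used for u_n
    and passed to the limit. It gives |h|^4 <= \<epsilon> |h| in norm, so that the norm of
    \<open>?R\<close>, which is the cube of the norm of \<open>h\<close>, is at most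
    \<epsilon>.\<close>
  have bd: "(LINT x|M. ?R x \<bullet> h x) \<le> \<epsilon> * nrm M 4 h"
  proof (rule LIMSEQ_le[OF lim_inner[OF R(1)]])
    show "(\<lambda>n. \<epsilon> * nrm M 4 (u n)) \<longlonglongrightarrow> \<epsilon> * nrm M 4 h"
      using lim_nrm[OF zero] by (intro tendsto_intros) simp
    show "\<exists>N. \<forall>n\<ge>N. (LINT x|M. ?R x \<bullet> u n x) \<le> \<epsilon> * nrm M 4 (u n)"
      using EL[OF u] bound[OF u] by (auto simp: abs_le_iff)
  qed
  have "(LINT x|M. ?R x \<bullet> h x) = nrm M 4 h ^ 4"
    unfolding nrm_4[symmetric] by (simp add: power2_norm_eq_inner[symmetric] flip: power_add)
  with bd have "nrm M 4 h * nrm M 4 h ^ 3 \<le> nrm M 4 h * \<epsilon>"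
    by (simp add: power_eq_if mult.commute)
  then have "nrm M 4 h ^ 3 \<le> \<epsilon>"
    using \<open>\<epsilon> \<ge> 0\<close> nrm_nonneg[of M 4 h] by (cases "nrm M 4 h = 0") (auto simp: mult_le_cancel_left less_le)
  then show ?thesis
    using h(2) R EL by (intro exI[of _ ?R]) auto
qed

subsection \<open>Gradients of test functions\<close>

lemma inner_eqI: "(\<And>v. v \<bullet> x = v \<bullet> y) \<Longrightarrow> x = y"
  using vector_eq_ldot[of x y] by simp

lemma grad_eqI:
  fixes f :: "'a::real_inner \<Rightarrow> real"
  assumes "GDERIV f x :> D"
  shows "grad f x = D"
  unfolding grad_def
proof (rule the_equality)
  fix D' assume "GDERIV f x :> D'"
  then have "(\<lambda>h. h \<bullet> D') = (\<lambda>h. h \<bullet> D)"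
    using assms unfolding gderiv_def by (rule has_derivative_unique)
  then have "h \<bullet> D' = h \<bullet> D" for h by (rule fun_cong)
  then show "D' = D" by (rule inner_eqI)
qed (rule assms)

lemma grad_eq_sum:
  fixes \<phi> :: "'a::euclidean_space \<Rightarrow> real"
  assumes "\<phi> differentiable (at x)"
  shows "grad \<phi> x = (\<Sum>b\<in>Basis. frechet_derivative \<phi> (at x) b *\<^sub>R b)"
    and "v \<bullet> grad \<phi> x = frechet_derivative \<phi> (at x) v"
proof -
  let ?D = "\<Sum>b\<in>Basis. frechet_derivative \<phi> (at x) b *\<^sub>R b"
  have d: "(\<phi> has_derivative frechet_derivative \<phi> (at x)) (at x)"
    using assms by (simp add: frechet_derivative_works)
  have eq: "frechet_derivative \<phi> (at x) v = v \<bullet> ?D" for v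
  proof -
    interpret bounded_linear "frechet_derivative \<phi> (at x)" by (rule has_derivative_bounded_linear[OF d])
    have "frechet_derivative \<phi> (at x) v = frechet_derivative \<phi> (at x) (\<Sum>b\<in>Basis. (v \<bullet> b) *\<^sub>R b)"
      by (simp add: euclidean_representation)
    also have "\<dots> = (\<Sum>b\<in>Basis. (v \<bullet> b) * frechet_derivative \<phi> (at x) b)"
      by (simp add: sum scaleR)
    finally show ?thesis by (simp add: inner_sum_right mult.commute)
  qed
  have g: "GDERIV \<phi> x :> ?D"
    using d unfolding gderiv_def by (simp add: eq[symmetric])
  show *: "grad \<phi> x = ?D" by (rule grad_eqI[OF g])
  show "v \<bullet> grad \<phi> x = frechet_derivative \<phi> (at x) v" unfolding * by (rule eq[symmetric])
qed

lemma test_functions_sum: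
  fixes f :: "'i \<Rightarrow> 'a::euclidean_space \<Rightarrow> 'b::real_normed_vector"
  assumes "finite I" "\<And>i. i \<in> I \<Longrightarrow> f i \<in> test_functions \<omega>"
  shows "(\<lambda>x. \<Sum>i\<in>I. f i x) \<in> test_functions \<omega>"
  using assms
proof (induction I rule: finite_induct)
  case empty
  show ?case by (simp add: test_functions_def class_C_const)
next
  case (insert i I)
  then show ?case using test_functions_add[of "f i" \<omega> "\<lambda>x. \<Sum>i\<in>I. f i x"] by simp
qed

lemma test_functions_grad:
  fixes \<phi> :: "'a::euclidean_space \<Rightarrow> real"
  assumes "\<phi> \<in> test_functions \<omega>"
  shows "grad \<phi> \<in> test_functions \<omega>"
proof -
  have "grad \<phi> = (\<lambda>x. \<Sum>b\<in>Basis. frechet_derivative \<phi> (at x) b *\<^sub>R b)"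
    by (rule ext) (rule grad_eq_sum(1)[OF test_functionsD(7)[OF assms]])
  also have "\<dots> \<in> test_functions \<omega>"
    by (intro test_functions_sum finite_Basis test_functions_compose_linear[OF test_functions_derivative[OF assms] bounded_linear_scaleR_left])
  finally show ?thesis .
qed

lemma grad_add:
  fixes \<phi> \<psi> :: "'a::euclidean_space \<Rightarrow> real"
  assumes "\<phi> differentiable (at x)" "\<psi> differentiable (at x)"
  shows "grad (\<lambda>x. \<phi> x + \<psi> x) x = grad \<phi> x + grad \<psi> x"
proof -
  have d: "((\<lambda>x. \<phi> x + \<psi> x) has_derivative (\<lambda>v. frechet_derivative \<phi> (at x) v + frechet_derivative \<psi> (at x) v)) (at x)"
    using assms by (intro has_derivative_add) (auto simp: frechet_derivative_works)
  have "v \<bullet> grad (\<lambda>x. \<phi> x + \<psi> x) x = v \<bullet> (grad \<phi> x + grad \<psi> x)" for v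
    using frechet_derivative_at[OF d]
    by (simp add: inner_add_right grad_eq_sum(2)[OF assms(1)] grad_eq_sum(2)[OF assms(2)] grad_eq_sum(2)[OF differentiable_add[OF assms]] fun_eq_iff)
  then show ?thesis by (rule inner_eqI)
qed

lemma grad_scale:
  fixes \<phi> :: "'a::euclidean_space \<Rightarrow> real"
  assumes "\<phi> differentiable (at x)"
  shows "grad (\<lambda>x. c * \<phi> x) x = c *\<^sub>R grad \<phi> x"
proof -
  have d: "((\<lambda>x. c * \<phi> x) has_derivative (\<lambda>v. c * frechet_derivative \<phi> (at x) v)) (at x)"
    using assms by (intro has_derivative_mult_right) (auto simp: frechet_derivative_works)
  have "(\<lambda>x. c * \<phi> x) differentiable (at x)" using d by (auto simp: differentiable_def)
  then have "v \<bullet> grad (\<lambda>x. c * \<phi> x) x = v \<bullet> (c *\<^sub>R grad \<phi> x)" for v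
    using frechet_derivative_at[OF d]
    by (simp add: grad_eq_sum(2)[OF assms] grad_eq_sum(2) fun_eq_iff)
  then show ?thesis by (rule inner_eqI)
qed

lemma grad_mult:
  fixes \<phi> \<psi> :: "'a::euclidean_space \<Rightarrow> real"
  assumes "class_C 1 \<phi>" "class_C 1 \<psi>"
  shows "grad (\<lambda>x. \<phi> x * \<psi> x) x = \<phi> x *\<^sub>R grad \<psi> x + \<psi> x *\<^sub>R grad \<phi> x"
proof -
  have d: "\<phi> differentiable (at x)" "\<psi> differentiable (at x)" "(\<lambda>x. \<phi> x * \<psi> x) differentiable (at x)"
    using assms class_C_mult[OF assms] by auto
  have "v \<bullet> grad (\<lambda>x. \<phi> x * \<psi> x) x = v \<bullet> (\<phi> x *\<^sub>R grad \<psi> x + \<psi> x *\<^sub>R grad \<phi> x)" for v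
    by (simp add: grad_eq_sum(2)[OF d(1)] grad_eq_sum(2)[OF d(2)] grad_eq_sum(2)[OF d(3)]
        frechet_derivative_mult_test[OF assms] inner_add_right mult.commute)
  then show ?thesis by (rule inner_eqI)
qed

section \<open>Poincare's inequality and the correction of a small divergence\<close>

lemma memL_test_functions:
  fixes \<phi> :: "'a::euclidean_space \<Rightarrow> 'b::euclidean_space"
  assumes "\<phi> \<in> test_functions \<omega>" "p > 0"
  shows "memL lborel p \<phi>"
proof -
  obtain r where r: "{x. \<phi> x \<noteq> 0} \<subseteq> ball 0 r"
    using bounded_subset_ballD[OF test_functionsD(4)[OF assms(1)]] by blast
  obtain B where B: "\<And>x. norm (\<phi> x) \<le> B" using test_functions_bounded[OF assms(1)] by blast
  show ?thesis
    by (rule memL_bounded_support[of _ _ "ball 0 r" B])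
      (use r B assms test_functions_measurable[OF assms(1)] emeasure_lborel_ball_finite[of "0::'a" r] in \<open>auto\<close>)
qed

text \<open>The coordinate x . e has derivative 1 in direction \<open>e\<close>. Integrating
  \<phi>^4 times this derivative by parts yields 4 \<phi>^3 times the derivative of \<phi> times x .
  e, where |x . e| <= K; Hoelder's inequality then lets the third power of the norm be
  cancelled.\<close>

lemma Poincare_4:
  fixes \<phi> :: "'a::euclidean_space \<Rightarrow> real"
  assumes \<phi>: "\<phi> \<in> test_functions \<omega>" and K: "\<omega> \<subseteq> ball 0 K" "K > 0"
  shows "nrm lborel 4 \<phi> \<le> 4 * K * nrm lborel 4 (grad \<phi>)"
proof -
  obtain e :: 'a where e: "e \<in> Basis" using nonempty_Basis by blast
  let ?D = "\<lambda>x. frechet_derivative \<phi> (at x) e"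
  note D = test_functions_derivative[OF \<phi>, of e]
  note [measurable] = test_functions_measurable[OF \<phi>] test_functions_measurable[OF D]
  have C: "class_C m (\<lambda>x. x \<bullet> e)" for m by (intro class_C_bounded_linear bounded_linear_inner_left)
  have C1: "class_C 1 \<phi>" using test_functionsD(1)[OF \<phi>] .
  have C2: "class_C 1 (\<lambda>x. \<phi> x * \<phi> x)" by (rule class_C_mult[OF C1 C1])
  have "(\<lambda>x. \<phi> x * (\<phi> x * (\<phi> x * \<phi> x))) \<in> test_functions \<omega>"
    by (intro test_functions_mult[OF \<phi>] class_C_mult test_functionsD(1)[OF \<phi>])
  then have t4: "(\<lambda>x. (\<phi> x * \<phi> x) * (\<phi> x * \<phi> x)) \<in> test_functions \<omega>"
    by (simp only: mult.assoc)
  have dp: "frechet_derivative (\<lambda>x. (\<phi> x * \<phi> x) * (\<phi> x * \<phi> x)) (at x) e = 4 * \<phi> x ^ 3 * ?D x" for x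
    unfolding frechet_derivative_mult_test[OF C2 C2] frechet_derivative_mult_test[OF C1 C1]
    by (simp add: power3_eq_cube algebra_simps)
  have dx: "frechet_derivative (\<lambda>x. x \<bullet> e) (at x) e = 1" for x
  proof -
    have "((\<lambda>x. x \<bullet> e) has_derivative (\<lambda>x. x \<bullet> e)) (at x)"
      by (rule bounded_linear_imp_has_derivative[OF bounded_linear_inner_left])
    from frechet_derivative_at[OF this] show ?thesis using e by (simp add: fun_eq_iff[symmetric])
  qed
  let ?h = "\<lambda>x. (norm (\<phi> x))\<^sup>2 *\<^sub>R \<phi> x"
  note h = norm_cube_memL[OF memL_test_functions[OF \<phi>, of 4, simplified]]
  have Dg: "memL lborel 4 ?D" and Dle: "nrm lborel 4 ?D \<le> nrm lborel 4 (grad \<phi>)"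
  proof -
    show "memL lborel 4 ?D" by (rule memL_test_functions[OF D]) simp
    have "norm (?D x) \<le> norm (grad \<phi> x)" for x
      using grad_eq_sum(2)[OF test_functionsD(7)[OF \<phi>], of e x] Basis_le_norm[OF e, of "grad \<phi> x"]
      by (simp add: inner_commute)
    then show "nrm lborel 4 ?D \<le> nrm lborel 4 (grad \<phi>)"
      by (intro memL_mono(2)[OF memL_test_functions[OF test_functions_grad[OF \<phi>]]]) auto
  qed
  have "nrm lborel 4 \<phi> ^ 4 = (LINT x|lborel. norm (\<phi> x) ^ 4)" by (rule nrm_4[symmetric])
  also have "\<dots> = (LINT x|lborel. (\<phi> x * \<phi> x) * (\<phi> x * \<phi> x) * 1)"
    by (simp add: power_even_abs power4_eq_xxxx mult.assoc)
  also have "\<dots> = - (LINT x|lborel. 4 * \<phi> x ^ 3 * ?D x * (x \<bullet> e))"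
    using integral_by_parts_test[OF t4 C, of e] by (simp add: dp dx)
  also have "\<dots> \<le> norm (LINT x|lborel. 4 * \<phi> x ^ 3 * ?D x * (x \<bullet> e))" by simp
  also have "\<dots> \<le> (LINT x|lborel. 4 * K * (norm (?h x) * norm (?D x)))"
  proof (rule norm_integral_le)
    show "integrable lborel (\<lambda>x. 4 * K * (norm (?h x) * norm (?D x)))"
      by (intro integrable_mult_right Holder_norm(1)[OF conj_4_43(1,2,3) h(1) Dg])
    have "norm (4 * \<phi> x ^ 3 * ?D x * (x \<bullet> e)) \<le> 4 * K * (norm (?h x) * norm (?D x))" for x
    proof (cases "x \<in> \<omega>")
      case True
      then have "\<bar>x \<bullet> e\<bar> \<le> K" using K(1) Basis_le_norm[OF e, of x] by force
      then have "\<bar>4 * \<phi> x ^ 3 * ?D x\<bar> * \<bar>x \<bullet> e\<bar> \<le> \<bar>4 * \<phi> x ^ 3 * ?D x\<bar> * K"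
        by (intro mult_left_mono) auto
      moreover have "norm (?h x) = \<bar>\<phi> x\<bar> ^ 3"
        by (simp add: power2_eq_square power3_eq_cube abs_mult)
      ultimately show ?thesis by (simp add: abs_mult power_abs mult_ac)
    next
      case False
      then show ?thesis using test_functionsD(5)[OF \<phi>] by simp
    qed
    then show "AE x in lborel. norm (4 * \<phi> x ^ 3 * ?D x * (x \<bullet> e)) \<le> 4 * K * (norm (?h x) * norm (?D x))"
      by simp
  qed
  also have "\<dots> = 4 * K * (LINT x|lborel. norm (?h x) * norm (?D x))" by simp
  also have "\<dots> \<le> 4 * K * (nrm lborel 4 \<phi> ^ 3 * nrm lborel 4 (grad \<phi>))"
  proof (intro mult_left_mono)
    have "(LINT x|lborel. norm (?h x) * norm (?D x)) \<le> nrm lborel 4 \<phi> ^ 3 * nrm lborel 4 ?D"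
      using Holder_norm(2)[OF conj_4_43(1,2,3) h(1) Dg] unfolding h(2) .
    also have "\<dots> \<le> nrm lborel 4 \<phi> ^ 3 * nrm lborel 4 (grad \<phi>)"
      by (intro mult_left_mono Dle) auto
    finally show "(LINT x|lborel. norm (?h x) * norm (?D x)) \<le> nrm lborel 4 \<phi> ^ 3 * nrm lborel 4 (grad \<phi>)" .
  qed (use K in auto)
  finally have "nrm lborel 4 \<phi> ^ 3 * nrm lborel 4 \<phi> \<le> nrm lborel 4 \<phi> ^ 3 * (4 * K * nrm lborel 4 (grad \<phi>))"
    by (simp add: power_eq_if mult_ac)
  then show ?thesis
    using nrm_nonneg[of lborel 4 \<phi>] K by (cases "nrm lborel 4 \<phi> = 0") (auto simp: mult_le_cancel_left less_le)
qed

text \<open>The point is that s - R is exactly solenoidal in \<omega>, while \<open>R\<close> is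
  only as large as the divergence of \<open>s\<close>. Poincare's inequality bounds the full Sobolev
  norm by that of the gradient, whence the factor 4 K + 1; the functional is then represented on the
  space of gradients.\<close>

lemma divergence_correction:
  fixes s :: "'a::euclidean_space \<Rightarrow> 'a"
  assumes \<omega>: "open \<omega>" "\<omega> \<subseteq> ball 0 K" "K > 0" and s: "memL lborel (4/3) s" and "\<epsilon> \<ge> 0"
    and div: "\<And>\<phi>. \<phi> \<in> test_functions \<omega> \<Longrightarrow>
      \<bar>LINT x|lborel. s x \<bullet> grad \<phi> x\<bar> \<le> \<epsilon> * (nrm lborel 4 \<phi> + nrm lborel 4 (grad \<phi>))"
  shows "\<exists>R. memL lborel (4/3) R \<and> (\<forall>x. x \<notin> \<omega> \<longrightarrow> R x = 0) \<and> nrm lborel (4/3) R \<le> (4 * K + 1) * \<epsilon> \<and>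
    (\<forall>\<phi>\<in>test_functions \<omega>. (LINT x|lborel. R x \<bullet> grad \<phi> x) = (LINT x|lborel. s x \<bullet> grad \<phi> x))"
proof -
  let ?D = "grad ` (test_functions \<omega> :: ('a \<Rightarrow> real) set)"
  have em: "emeasure lborel \<omega> < \<infinity>"
    using emeasure_mono[OF \<omega>(2), of lborel] emeasure_lborel_ball_finite[of 0 K] by (auto intro: le_less_trans)
  have z: "(\<lambda>x. 0) \<in> test_functions \<omega>" by (simp add: test_functions_def class_C_const)
  have "\<exists>R. memL lborel (4/3) R \<and> (\<forall>x\<in>space lborel. x \<notin> \<omega> \<longrightarrow> R x = 0) \<and> nrm lborel (4/3) R \<le> (4 * K + 1) * \<epsilon> \<and>
    (\<forall>w\<in>?D. (LINT x|lborel. R x \<bullet> w x) = (LINT x|lborel. s x \<bullet> w x))"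
  proof (rule norm_preserving_representation)
    show "memL lborel 4 u" if "u \<in> ?D" for u
      using that by (auto intro: memL_test_functions test_functions_grad)
    show "u x = 0" if "u \<in> ?D" "x \<notin> \<omega>" for u x
      using that test_functionsD(5)[OF test_functions_grad] by auto
    show "(\<lambda>x. u x + v x) \<in> ?D" if uv: "u \<in> ?D" "v \<in> ?D" for u v
    proof -
      obtain \<phi> \<psi> where \<phi>: "\<phi> \<in> test_functions \<omega>" "u = grad \<phi>" and \<psi>: "\<psi> \<in> test_functions \<omega>" "v = grad \<psi>"
        using uv by blast
      have "(\<lambda>x. u x + v x) = grad (\<lambda>x. \<phi> x + \<psi> x)"
        unfolding \<phi>(2) \<psi>(2) by (rule ext) (rule grad_add[symmetric]; rule test_functionsD(7)[OF \<phi>(1)] test_functionsD(7)[OF \<psi>(1)])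
      then show ?thesis using test_functions_add[OF \<phi>(1) \<psi>(1)] by blast
    qed
    show "(\<lambda>x. c *\<^sub>R u x) \<in> ?D" if u: "u \<in> ?D" for u c
    proof -
      obtain \<phi> where \<phi>: "\<phi> \<in> test_functions \<omega>" "u = grad \<phi>" using u by blast
      have "(\<lambda>x. c *\<^sub>R u x) = grad (\<lambda>x. c * \<phi> x)"
        unfolding \<phi>(2) by (rule ext) (rule grad_scale[symmetric, OF test_functionsD(7)[OF \<phi>(1)]])
      then show ?thesis using test_functions_compose_linear[OF \<phi>(1) bounded_linear_mult_right] by blast
    qed
    show "?D \<noteq> {}" using z by blast
    show "\<omega> \<in> sets lborel" using \<omega>(1) by simp
    show "\<bar>LINT x|lborel. s x \<bullet> u x\<bar> \<le> (4 * K + 1) * \<epsilon> * nrm lborel 4 u" if u: "u \<in> ?D" for u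
    proof -
      obtain \<phi> where \<phi>: "\<phi> \<in> test_functions \<omega>" "u = grad \<phi>" using u by blast
      have "\<bar>LINT x|lborel. s x \<bullet> u x\<bar> \<le> \<epsilon> * (nrm lborel 4 \<phi> + nrm lborel 4 (grad \<phi>))"
        unfolding \<phi>(2) by (rule div[OF \<phi>(1)])
      also have "\<dots> \<le> \<epsilon> * (4 * K * nrm lborel 4 (grad \<phi>) + nrm lborel 4 (grad \<phi>))"
        using Poincare_4[OF \<phi>(1) \<omega>(2,3)] \<open>\<epsilon> \<ge> 0\<close> by (intro mult_left_mono) auto
      finally show ?thesis by (simp add: \<phi>(2) algebra_simps)
    qed
    show "0 \<le> (4 * K + 1) * \<epsilon>" using \<omega>(3) \<open>\<epsilon> \<ge> 0\<close> by simp
  qed (use em s in auto)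
  then show ?thesis by simp
qed

subsection \<open>Averages of translates\<close>

text \<open>The index measure and the shift \<tau> are kept general so that one L^p bound covers
  both a mollifier (index y, shift y) and a line integral (index t in [0, 1], shift t y).\<close>

definition average :: "'i measure \<Rightarrow> ('i \<Rightarrow> real) \<Rightarrow> ('i \<Rightarrow> 'a::euclidean_space) \<Rightarrow> ('a \<Rightarrow> 'b::euclidean_space) \<Rightarrow> 'a \<Rightarrow> 'b" where
  "average M w \<tau> f x = (LINT y|M. w y *\<^sub>R f (x - \<tau> y))"

text \<open>Hoelder's inequality for the factors w^(1/q) and w^(1/p) g. In extended nonnegative form
  it needs no integrability of \<open>g\<close>: if the right-hand side is infinite there is nothing
  to prove, so it can be applied at every point before Tonelli's theorem.\<close>

lemma nn_Jensen_powr: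
  fixes g :: "'i \<Rightarrow> 'b::euclidean_space"
  assumes w: "integrable M w" "\<And>y. w y \<ge> 0" "(LINT y|M. w y) = 1"
    and [measurable]: "g \<in> borel_measurable M" and p: "p > 1"
  shows "ennreal (norm (LINT y|M. w y *\<^sub>R g y) powr p) \<le> (\<integral>\<^sup>+y. ennreal (w y * norm (g y) powr p) \<partial>M)"
proof (cases "(\<integral>\<^sup>+y. ennreal (w y * norm (g y) powr p) \<partial>M) = \<infinity>")
  case False
  note [measurable] = borel_measurable_integrable[OF w(1)]
  have int: "integrable M (\<lambda>y. w y * norm (g y) powr p)"
    using False w(2) by (intro integrableI_bounded) (auto simp: less_top abs_mult)
  define q where "q = p / (p - 1)"
  have q: "q > 1" "1 / q + 1 / p = 1" using p by (auto simp: q_def field_simps)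
  let ?F = "\<lambda>y. w y powr (1 / q)" and ?G = "\<lambda>y. w y powr (1 / p) *\<^sub>R g y"
  have F: "norm (?F y) powr q = w y" for y using w(2) q(1) by (simp add: powr_powr)
  have G: "norm (?G y) powr p = w y * norm (g y) powr p" for y
    using w(2) p by (simp add: powr_mult powr_powr)
  have FG: "norm (?F y) * norm (?G y) = norm (w y *\<^sub>R g y)" for y
    using w(2)[of y] q(2) by (simp add: mult.assoc[symmetric] powr_add[symmetric])
  have mF: "memL M q ?F" using w(1) unfolding memL_def F by auto
  have mG: "memL M p ?G" using int unfolding memL_def G by auto
  have "norm (LINT y|M. w y *\<^sub>R g y) \<le> (LINT y|M. norm (?F y) * norm (?G y))"
    by (rule norm_integral_le[OF Holder_norm(1)[OF q(1) p q(2) mF mG]]) (simp only: FG order_refl eventually_True)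
  also have "\<dots> \<le> nrm M q ?F * nrm M p ?G" by (rule Holder_norm(2)[OF q(1) p q(2) mF mG])
  also have "\<dots> = (LINT y|M. w y * norm (g y) powr p) powr (1 / p)"
    unfolding nrm_def F G w(3) by simp
  finally have "norm (LINT y|M. w y *\<^sub>R g y) powr p \<le> ((LINT y|M. w y * norm (g y) powr p) powr (1 / p)) powr p"
    using p by (intro powr_mono2) auto
  also have "\<dots> = (LINT y|M. w y * norm (g y) powr p)"
    using p w(2) by (simp add: powr_powr)
  finally have "ennreal (norm (LINT y|M. w y *\<^sub>R g y) powr p) \<le> ennreal (LINT y|M. w y * norm (g y) powr p)"
    by (rule ennreal_leI)
  also have "\<dots> = (\<integral>\<^sup>+y. ennreal (w y * norm (g y) powr p) \<partial>M)"
    using int w(2) by (intro nn_integral_eq_integral[symmetric]) auto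
  finally show ?thesis .
qed simp

text \<open>Jensen's inequality at each point, then exchange of the integrals, then translation
  invariance in \<open>x\<close>.\<close>

lemma average_memL:
  fixes f :: "'a::euclidean_space \<Rightarrow> 'b::euclidean_space"
  assumes M: "sigma_finite_measure M" and w: "integrable M w" "\<And>y. w y \<ge> 0" "(LINT y|M. w y) = 1"
    and \<tau> [measurable]: "\<tau> \<in> borel_measurable M" and p: "p > 1" and f: "memL lborel p f"
  shows "memL lborel p (average M w \<tau> f)" and "nrm lborel p (average M w \<tau> f) \<le> nrm lborel p f"
proof -
  interpret M: sigma_finite_measure M by fact
  interpret P: pair_sigma_finite M "lborel :: 'a measure" ..
  note [measurable] = borel_measurable_integrable[OF w(1)]
  have fm [measurable]: "f \<in> borel_measurable borel" using memL_measurable[OF f] by simp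
  have [measurable]: "average M w \<tau> f \<in> borel_measurable borel"
  proof -
    have "(\<lambda>x. LINT y|M. w y *\<^sub>R f (x - \<tau> y)) \<in> borel_measurable lborel"
      by (rule M.borel_measurable_lebesgue_integral) measurable
    then show ?thesis by (simp add: average_def[abs_def])
  qed
  let ?N = "\<integral>\<^sup>+x. ennreal (norm (f x) powr p) \<partial>lborel"
  have "(\<integral>\<^sup>+x. ennreal (norm (average M w \<tau> f x) powr p) \<partial>lborel) \<le>
      (\<integral>\<^sup>+x. (\<integral>\<^sup>+y. ennreal (w y * norm (f (x - \<tau> y)) powr p) \<partial>M) \<partial>lborel)"
    unfolding average_def by (intro nn_integral_mono nn_Jensen_powr w p) measurable
  also have "\<dots> = (\<integral>\<^sup>+y. (\<integral>\<^sup>+x. ennreal (w y * norm (f (x - \<tau> y)) powr p) \<partial>lborel) \<partial>M)"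
    by (rule P.Fubini') measurable
  also have "\<dots> = (\<integral>\<^sup>+y. ennreal (w y) * ?N \<partial>M)"
  proof (rule nn_integral_cong)
    fix y
    have "(\<integral>\<^sup>+x. ennreal (w y * norm (f (x - \<tau> y)) powr p) \<partial>lborel) =
      ennreal (w y) * (\<integral>\<^sup>+x. ennreal (norm (f (- \<tau> y + 1 *\<^sub>R x)) powr p) \<partial>lborel)"
      using w(2)[of y] by (simp add: ennreal_mult' nn_integral_cmult)
    also have "(\<integral>\<^sup>+x. ennreal (norm (f (- \<tau> y + 1 *\<^sub>R x)) powr p) \<partial>lborel) = ?N"
      by (rule nn_integral_lborel_affine) auto
    finally show "(\<integral>\<^sup>+x. ennreal (w y * norm (f (x - \<tau> y)) powr p) \<partial>lborel) = ennreal (w y) * ?N" .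
  qed
  also have "\<dots> = (\<integral>\<^sup>+y. ennreal (w y) \<partial>M) * ?N" by (rule nn_integral_multc) measurable
  also have "(\<integral>\<^sup>+y. ennreal (w y) \<partial>M) = 1"
    using nn_integral_eq_integral[OF w(1)] w by simp
  also have "1 * ?N = ennreal (LINT x|lborel. norm (f x) powr p)"
    using nn_integral_eq_integral[OF memL_integrable[OF f]] by simp
  finally have le: "(\<integral>\<^sup>+x. ennreal (norm (average M w \<tau> f x) powr p) \<partial>lborel) \<le> ennreal (LINT x|lborel. norm (f x) powr p)" .
  then have int: "integrable lborel (\<lambda>x. norm (average M w \<tau> f x) powr p)"
    by (intro integrableI_bounded) (auto intro: le_less_trans)
  then show "memL lborel p (average M w \<tau> f)" by (simp add: memL_def)
  have "(LINT x|lborel. norm (average M w \<tau> f x) powr p) \<le> (LINT x|lborel. norm (f x) powr p)"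
    using le nn_integral_eq_integral[OF int] by (simp add: ennreal_le_iff)
  then show "nrm lborel p (average M w \<tau> f) \<le> nrm lborel p f"
    unfolding nrm_def using p by (intro powr_mono2) auto
qed

subsection \<open>Mollification\<close>

lemma memL_dominated_null:
  fixes u :: "nat \<Rightarrow> 'a \<Rightarrow> 'b::euclidean_space"
  assumes "\<And>n. u n \<in> borel_measurable M" "integrable M W" "AE x in M. (\<lambda>n. u n x) \<longlonglongrightarrow> 0"
    "\<And>n. AE x in M. norm (u n x) powr p \<le> W x" "p > 0"
  shows "(\<lambda>n. nrm M p (u n)) \<longlonglongrightarrow> 0"
proof -
  note [measurable] = assms(1)
  have "(\<lambda>n. LINT x|M. norm (u n x) powr p) \<longlonglongrightarrow> (LINT x|M. 0)"
  proof (rule integral_dominated_convergence[OF _ _ assms(2)])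
    show "AE x in M. (\<lambda>n. norm (u n x) powr p) \<longlonglongrightarrow> 0"
      using assms(3)
    proof eventually_elim
      case (elim x)
      then have "(\<lambda>n. norm (u n x)) \<longlonglongrightarrow> 0" by (rule tendsto_norm_zero)
      then show ?case using tendsto_zero_powrI[OF _ tendsto_const[of p]] assms(5) by fastforce
    qed
    show "AE x in M. norm (norm (u n x) powr p) \<le> W x" for n using assms(4)[of n] by simp
  qed auto
  then have "(\<lambda>n. LINT x|M. norm (u n x) powr p) \<longlonglongrightarrow> 0" by simp
  then show ?thesis
    unfolding nrm_def using assms(5)
    by (intro tendsto_zero_powrI[OF _ tendsto_const[of "1 / p"]]) auto
qed

lemma LIMSEQ_0_imp_ex_le: "x \<longlonglongrightarrow> (0::real) \<Longrightarrow> \<delta> > 0 \<Longrightarrow> \<exists>n. x n \<le> \<delta>"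
  using order_tendstoD(2)[of x 0 sequentially \<delta>] by (auto simp: eventually_sequentially intro: less_imp_le)

text \<open>First \<open>f\<close> is truncated in size and support. The truncation is an almost
  everywhere limit of continuous functions, which are clamped to a common bound and a common ball so
  that dominated convergence applies.\<close>

lemma continuous_dense_memL:
  fixes f :: "'a::euclidean_space \<Rightarrow> 'b::euclidean_space"
  assumes f: "memL lborel p f" and p: "p \<ge> 1" and \<delta>: "\<delta> > 0"
  shows "\<exists>c. continuous_on UNIV c \<and> bounded {x. c x \<noteq> 0} \<and> nrm lborel p (\<lambda>x. f x - c x) \<le> \<delta>"
proof -
  have fm [measurable]: "f \<in> borel_measurable borel" using memL_measurable[OF f] by simp
  define F where "F n x = (if norm (f x) \<le> real n \<and> norm x \<le> real n then f x else 0)" for n x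
  have Fm [measurable]: "F n \<in> borel_measurable borel" for n unfolding F_def by measurable
  have "(\<lambda>n. nrm lborel p (\<lambda>x. f x - F n x)) \<longlonglongrightarrow> 0"
  proof (rule memL_dominated_null[OF _ memL_integrable[OF f]])
    show "AE x in lborel. (\<lambda>n. f x - F n x) \<longlonglongrightarrow> 0"
    proof (rule AE_I2)
      fix x
      obtain N where N: "norm (f x) + norm x \<le> real N" using real_arch_simple by blast
      have "f x - F n x = 0" if "n \<ge> N" for n
      proof -
        have "norm (f x) \<le> real n" "norm x \<le> real n"
          using N that norm_ge_zero[of x] norm_ge_zero[of "f x"] of_nat_mono[OF that, where 'a=real] by linarith+
        then show ?thesis by (simp add: F_def)
      qed
      then have "\<forall>\<^sub>F n in sequentially. f x - F n x = 0" by (auto simp: eventually_sequentially)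
      then show "(\<lambda>n. f x - F n x) \<longlonglongrightarrow> 0" by (rule tendsto_eventually)
    qed
    show "AE x in lborel. norm (f x - F n x) powr p \<le> norm (f x) powr p" for n
      using p by (auto simp: F_def)
  qed (use p in auto)
  from LIMSEQ_0_imp_ex_le[OF this half_gt_zero[OF \<delta>]]
  obtain n where n: "nrm lborel p (\<lambda>x. f x - F n x) \<le> \<delta> / 2" by blast
  have "F n \<in> borel_measurable lebesgue" using Fm by (simp add: measurable_completion)
  then have "F n measurable_on UNIV" by (rule lebesgue_measurable_imp_measurable_on) simp
  then obtain N g where N: "negligible N" and g: "\<And>k. continuous_on UNIV (g k)"
    and lim: "\<And>x. x \<notin> N \<Longrightarrow> (\<lambda>k. g k x) \<longlonglongrightarrow> F n x"
    unfolding measurable_on_def by auto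
  \<comment> \<open>Radial projection onto the ball of radius n + 1, multiplied by a cut-off that is
    1 for |x| <= n and 0 for |x| >= n + 1. Both leave \<open>F n\<close> unchanged, so convergence
    is not disturbed; \<open>Suc n\<close> keeps the denominator positive for n = 0.\<close>
  define c where "c k x = max 0 (min 1 (real n + 1 - norm x)) *\<^sub>R ((real (Suc n) / max (real (Suc n)) (norm (g k x))) *\<^sub>R g k x)" for k x
  have cc: "continuous_on UNIV (c k)" for k
    unfolding c_def by (intro continuous_intros g) (auto simp: max_def)
  have [measurable]: "c k \<in> borel_measurable borel" for k by (rule borel_measurable_continuous_onI[OF cc])
  have cb: "norm (c k x) \<le> real (Suc n)" for k x
  proof -
    have "norm ((real (Suc n) / max (real (Suc n)) (norm (g k x))) *\<^sub>R g k x) \<le> real (Suc n)"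
      by (auto simp: max_def divide_simps)
    moreover have "\<bar>max 0 (min 1 (real n + 1 - norm x))\<bar> \<le> 1" by auto
    ultimately show ?thesis unfolding c_def norm_scaleR[of "max 0 (min 1 (real n + 1 - norm x))"]
      using mult_mono[of "\<bar>max 0 (min 1 (real n + 1 - norm x))\<bar>" 1] by fastforce
  qed
  have c0: "c k x = 0" if "x \<notin> ball 0 (real n + 1)" for k x using that by (simp add: c_def)
  have F0: "F n x = 0" if "x \<notin> ball 0 (real n + 1)" for x using that by (auto simp: F_def)
  have "(\<lambda>k. nrm lborel p (\<lambda>x. F n x - c k x)) \<longlonglongrightarrow> 0"
  proof (rule memL_dominated_null[where W="\<lambda>x. (2 * real (Suc n)) powr p * indicator (ball 0 (real n + 1)) x"])
    show "integrable lborel (\<lambda>x. (2 * real (Suc n)) powr p * indicator (ball (0::'a) (real n + 1)) x)"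
      using emeasure_lborel_ball_finite[of "0::'a" "real n + 1"] by (intro integrable_mult_right integrable_real_indicator) auto
    have "AE x in lebesgue. x \<notin> N"
      by (rule AE_not_in) (use N in \<open>simp add: negligible_iff_null_sets\<close>)
    then have "AE x in lborel. x \<notin> N" by (simp add: AE_completion_iff)
    then show "AE x in lborel. (\<lambda>k. F n x - c k x) \<longlonglongrightarrow> 0"
    proof eventually_elim
      case (elim x)
      have Fx: "norm (F n x) \<le> real (Suc n)" by (auto simp: F_def)
      have 1: "(\<lambda>k. c k x) \<longlonglongrightarrow> max 0 (min 1 (real n + 1 - norm x)) *\<^sub>R ((real (Suc n) / max (real (Suc n)) (norm (F n x))) *\<^sub>R F n x)"
        unfolding c_def by (intro tendsto_intros lim[OF elim]) (auto simp: max_def)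
      have 2: "max 0 (min 1 (real n + 1 - norm x)) *\<^sub>R ((real (Suc n) / max (real (Suc n)) (norm (F n x))) *\<^sub>R F n x) = F n x"
        using Fx by (auto simp: max_absorb1 F_def)
      show ?case using tendsto_diff[OF tendsto_const[of "F n x"] 1] unfolding 2 by simp
    qed
    show "AE x in lborel. norm (F n x - c k x) powr p \<le> (2 * real (Suc n)) powr p * indicator (ball 0 (real n + 1)) x" for k
    proof (rule AE_I2)
      fix x
      have "norm (F n x) \<le> real (Suc n)" by (auto simp: F_def)
      then have "norm (F n x - c k x) \<le> real (Suc n) + real (Suc n)"
        by (intro order_trans[OF norm_triangle_ineq4] add_mono cb)
      then have "norm (F n x - c k x) \<le> 2 * real (Suc n)" by simp
      then show "norm (F n x - c k x) powr p \<le> (2 * real (Suc n)) powr p * indicator (ball 0 (real n + 1)) x"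
        using c0[of x k] F0[of x] p by (cases "x \<in> ball 0 (real n + 1)") (auto intro: powr_mono2)
    qed
  qed (use p in auto)
  from LIMSEQ_0_imp_ex_le[OF this half_gt_zero[OF \<delta>]]
  obtain k where k: "nrm lborel p (\<lambda>x. F n x - c k x) \<le> \<delta> / 2" by blast
  have em: "emeasure lborel (ball (0::'a) (real n + 1)) < \<infinity>" by (rule emeasure_lborel_ball_finite)
  have mF: "memL lborel p (F n)"
    by (rule memL_bounded_support[OF _ _ em, of _ "real (Suc n)"]) (use F0 p in \<open>auto simp: F_def\<close>)
  have mc: "memL lborel p (c k)"
    by (rule memL_bounded_support[OF _ _ em cb]) (use c0 p in \<open>auto\<close>)
  have "nrm lborel p (\<lambda>x. (f x - F n x) + (F n x - c k x)) \<le> nrm lborel p (\<lambda>x. f x - F n x) + nrm lborel p (\<lambda>x. F n x - c k x)"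
    by (intro Minkowski(2) p Minkowski_diff(1) f mF mc)
  with n k have "nrm lborel p (\<lambda>x. f x - c k x) \<le> \<delta>" by simp
  moreover have "bounded {x. c k x \<noteq> 0}"
    by (rule bounded_subset[OF bounded_ball[of 0 "real n + 1"]]) (use c0 in blast)
  ultimately show ?thesis using cc by blast
qed

text \<open>The radius \<open>r0\<close> works for every normalised nonnegative kernel. With a
  continuous \<open>c\<close> close to \<open>f\<close>, the error is A(f - c) + (A c - c) - (f -
  c): averaging does not increase the norm, and A c - c is small by uniform continuity.\<close>

lemma mollification_converges:
  fixes f :: "'a::euclidean_space \<Rightarrow> 'b::euclidean_space"
  assumes f: "memL lborel p f" and supp: "\<And>x. x \<notin> ball 0 K \<Longrightarrow> f x = 0" and p: "p > 1" and \<delta>: "\<delta> > 0"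
  shows "\<exists>r0>0. \<forall>r \<rho>. r \<le> r0 \<longrightarrow> \<rho> \<in> test_functions (ball 0 r) \<longrightarrow> (\<forall>x. \<rho> x \<ge> 0) \<longrightarrow> (LINT x|lborel. \<rho> x) = 1 \<longrightarrow>
    nrm lborel p (\<lambda>x. average lborel \<rho> (\<lambda>y. y) f x - f x) \<le> \<delta>"
proof -
  obtain c where c: "continuous_on UNIV c" "bounded {x. c x \<noteq> 0}" and fc: "nrm lborel p (\<lambda>x. f x - c x) \<le> \<delta> / 3"
    using continuous_dense_memL[OF f, of "\<delta> / 3"] p \<delta> by auto
  have [measurable]: "c \<in> borel_measurable borel" by (rule borel_measurable_continuous_onI[OF c(1)])
  have [measurable]: "f \<in> borel_measurable borel" using memL_measurable[OF f] by simp
  obtain R where "R > 0" and "{x. c x \<noteq> 0} \<subseteq> ball 0 R"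
    using bounded_subset_ballD[OF c(2)] by blast
  then have R: "R > 0" "\<And>x. norm x \<ge> R \<Longrightarrow> c x = 0" by force+
  let ?V = "measure lborel (ball (0::'a) (R + 1))"
  \<comment> \<open>A c - c vanishes outside the ball of radius R + 1 and is at most
    \<open>d\<close> in it, so that its norm is at most d times the power of the volume, hence at
    most \<delta> / 3.\<close>
  define d where "d = \<delta> / (3 * (?V powr (1 / p) + 1))"
  have V: "?V powr (1 / p) + 1 > 0" using powr_ge_zero[of ?V "1 / p"] by linarith
  have d: "d > 0" using \<delta> V by (simp add: d_def)
  have "uniformly_continuous_on (cball 0 (R + 2)) c"
    by (intro compact_uniformly_continuous continuous_on_subset[OF c(1)]) auto
  then obtain e where e: "e > 0" "\<And>x y. x \<in> cball 0 (R + 2) \<Longrightarrow> y \<in> cball 0 (R + 2) \<Longrightarrow> dist y x < e \<Longrightarrow> dist (c y) (c x) < d"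
    using d unfolding uniformly_continuous_on_def by meson
  have close: "norm (c (x - y) - c x) \<le> d" if "norm y < min e 1" for x y
  proof (cases "norm x \<le> R + 1")
    case True
    have "norm (x - y) \<le> R + 2" using norm_triangle_ineq4[of x y] that True by simp
    then show ?thesis using e(2)[of x "x - y"] that True by (simp add: dist_norm norm_minus_commute less_imp_le)
  next
    case False
    then have "norm (x - y) \<ge> R" using norm_triangle_ineq2[of x y] that by simp
    then show ?thesis using R(2)[of x] R(2)[of "x - y"] False d by simp
  qed
  have ic: "integrable lborel c" by (rule integrable_lborel_bounded_support[OF c])
  have ifn: "integrable lborel f"
    using memL_finite_support(1)[of 1 p lborel f "ball 0 K"] f supp p emeasure_lborel_ball_finite[of "0::'a" K]
    by (auto simp: memL_def integrable_norm_iff)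
  obtain B where B: "\<And>x. norm (c x) \<le> B"
  proof -
    have "compact (c ` cball 0 R)" by (intro compact_continuous_image continuous_on_subset[OF c(1)]) auto
    from iffD1[OF bounded_pos compact_imp_bounded[OF this]]
    obtain B where "B > 0" "\<And>y. y \<in> c ` cball 0 R \<Longrightarrow> norm y \<le> B" by blast
    then have "norm (c x) \<le> B" for x using R(2)[of x] by (cases "norm x \<le> R") auto
    then show ?thesis by (rule that)
  qed
  have mc: "memL lborel p c"
    by (rule memL_bounded_support[OF _ _ emeasure_lborel_ball_finite[of 0 R] B]) (use R p in \<open>auto\<close>)
  note mfc = Minkowski_diff(1)[OF less_imp_le[OF p] f mc]
  show ?thesis
  proof (intro exI[of _ "min e 1"] conjI allI impI)
    show "min e 1 > 0" using e by simp
    fix r and \<rho> :: "'a \<Rightarrow> real"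
    assume r: "r \<le> min e 1" and \<rho>: "\<rho> \<in> test_functions (ball 0 r)" "\<forall>x. \<rho> x \<ge> 0" "(LINT x|lborel. \<rho> x) = 1"
    note [measurable] = test_functions_measurable[OF \<rho>(1)]
    obtain B' where B': "\<And>x. norm (\<rho> x) \<le> B'" using test_functions_bounded[OF \<rho>(1)] by blast
    have \<rho>i: "integrable lborel \<rho>" by (rule test_functions_integrable[OF \<rho>(1)])
    have int: "integrable lborel (\<lambda>y. \<rho> y *\<^sub>R g (x - y))" if "integrable lborel g" for g :: "'a \<Rightarrow> 'b" and x
    proof -
      have [measurable]: "g \<in> borel_measurable borel" using borel_measurable_integrable[OF that] by simp
      have "integrable lborel (\<lambda>y. g (x + (-1) *\<^sub>R y))" using that by (subst integrable_lborel_affine) auto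
      then have "integrable lborel (\<lambda>y. B' *\<^sub>R g (x - y))" by simp
      then show ?thesis
        by (rule Bochner_Integration.integrable_bound) (use B' in \<open>auto intro!: AE_I2 mult_right_mono order_trans[OF _ abs_ge_self]\<close>)
    qed
    let ?A = "average lborel \<rho> (\<lambda>y. y)"
    have lin: "?A f x - ?A c x = ?A (\<lambda>x. f x - c x) x" for x
      unfolding average_def by (simp add: scaleR_diff_right int[OF ifn] int[OF ic])
    have y: "\<rho> y = 0" if "norm y \<ge> min e 1" for y
      using test_functionsD(5)[OF \<rho>(1), of y] that r by simp
    have Ac: "norm (?A c x - c x) \<le> d" for x
    proof -
      have "?A c x - c x = (LINT y|lborel. \<rho> y *\<^sub>R c (x - y)) - (LINT y|lborel. \<rho> y *\<^sub>R c x)"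
        using \<rho>(3) \<rho>i by (simp add: average_def)
      also have "\<dots> = (LINT y|lborel. \<rho> y *\<^sub>R (c (x - y) - c x))"
        using int[OF ic, of x] \<rho>i by (simp add: scaleR_diff_right)
      also have "norm \<dots> \<le> (LINT y|lborel. \<rho> y * d)"
      proof (rule norm_integral_le)
        show "integrable lborel (\<lambda>y. \<rho> y * d)" using \<rho>i by simp
        have "norm (\<rho> y *\<^sub>R (c (x - y) - c x)) \<le> \<rho> y * d" for y
        proof (cases "norm y < min e 1")
          case True
          then show ?thesis using \<rho>(2) close[of y x] by (auto intro!: mult_left_mono)
        next
          case False
          then have "\<rho> y = 0" by (intro y) linarith
          then show ?thesis by simp
        qed
        then show "AE y in lborel. norm (\<rho> y *\<^sub>R (c (x - y) - c x)) \<le> \<rho> y * d" by simp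
      qed
      finally show ?thesis using \<rho>(3) by simp
    qed
    have Ac0: "?A c x - c x = 0" if "x \<notin> ball 0 (R + 1)" for x
    proof -
      have "\<rho> y *\<^sub>R c (x - y) = 0" for y
      proof (cases "norm y < min e 1")
        case True
        then have "norm (x - y) \<ge> R" using norm_triangle_ineq2[of x y] that by simp
        then show ?thesis using R(2) by simp
      next
        case False
        then have "\<rho> y = 0" by (intro y) linarith
        then show ?thesis by simp
      qed
      then have "?A c x = 0" by (simp only: average_def integral_zero)
      then show ?thesis using R(2)[of x] that by simp
    qed
    have mAc: "memL lborel p (?A c)" and mAfc: "memL lborel p (?A (\<lambda>x. f x - c x))"
      and nAfc: "nrm lborel p (?A (\<lambda>x. f x - c x)) \<le> nrm lborel p (\<lambda>x. f x - c x)"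
      using \<rho> \<rho>i by (intro average_memL lborel.sigma_finite_measure_axioms p mc f mfc; simp)+
    have 1: "nrm lborel p (\<lambda>x. ?A c x - c x) \<le> \<delta> / 3"
    proof -
      have "(LINT x|lborel. norm (?A c x - c x) powr p) \<le> (LINT x|lborel. d powr p * indicator (ball (0::'a) (R + 1)) x)"
      proof (rule integral_mono')
        show "integrable lborel (\<lambda>x. d powr p * indicator (ball (0::'a) (R + 1)) x)"
          using emeasure_lborel_ball_finite[of "0::'a" "R + 1"] by (intro integrable_mult_right integrable_real_indicator) auto
        show "norm (?A c x - c x) powr p \<le> d powr p * indicator (ball 0 (R + 1)) x" for x
          using Ac[of x] Ac0[of x] p by (cases "x \<in> ball 0 (R + 1)") (auto intro: powr_mono2)
      qed auto
      also have "\<dots> = (d * ?V powr (1 / p)) powr p"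
        using p d by (simp add: powr_mult powr_powr)
      finally have "nrm lborel p (\<lambda>x. ?A c x - c x) \<le> d * ?V powr (1 / p)"
        using p d by (intro nrm_le) auto
      also have "\<dots> \<le> d * (?V powr (1 / p) + 1)" using d by (intro mult_left_mono) auto
      also have "\<dots> = \<delta> / 3"
      proof -
        have "\<delta> / (3 * W) * W = \<delta> / 3" if "W > 0" for W :: real using that by simp
        then show ?thesis unfolding d_def using V by blast
      qed
      finally show ?thesis .
    qed
    have "nrm lborel p (\<lambda>x. (?A (\<lambda>x. f x - c x) x + (?A c x - c x)) - (f x - c x)) \<le>
      nrm lborel p (\<lambda>x. ?A (\<lambda>x. f x - c x) x) + nrm lborel p (\<lambda>x. ?A c x - c x) + nrm lborel p (\<lambda>x. f x - c x)"
    proof -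
      have p1: "p \<ge> 1" using p by simp
      note d1 = Minkowski_diff(1)[OF p1 mAc mc]
      show ?thesis
        using Minkowski_diff(2)[OF p1 Minkowski(1)[OF p1 mAfc d1] mfc] Minkowski(2)[OF p1 mAfc d1] by linarith
    qed
    also have "(\<lambda>x. (?A (\<lambda>x. f x - c x) x + (?A c x - c x)) - (f x - c x)) = (\<lambda>x. ?A f x - f x)"
      by (rule ext) (simp add: lin[symmetric])
    finally show "nrm lborel p (\<lambda>x. ?A f x - f x) \<le> \<delta>"
      using 1 nAfc fc by linarith
  qed
qed

subsection \<open>The stream function of a shifted solenoidal field\<close>

text \<open>Rotation by a right angle. It turns gradients into solenoidal fields, and the integral
  of v . perp (grad \<phi>) is the scalar curl (the first derivative of the second component minus
  the second derivative of the first) tested with \<phi>.\<close>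

definition perp :: "real^2 \<Rightarrow> real^2" where
  "perp w = vector [w $ 2, - w $ 1]"

lemma perp_nth [simp]: "perp w $ 1 = w $ 2" "perp w $ 2 = - w $ 1"
  by (simp_all add: perp_def)

lemma perp_linear: "linear perp"
  by (rule linearI) (simp_all add: vec_eq_iff forall_2)

lemma perp_bounded_linear: "bounded_linear perp"
  using perp_linear by (simp add: linear_conv_bounded_linear)

lemma perp_perp [simp]: "perp (perp w) = - w"
  by (simp add: vec_eq_iff forall_2)

lemma norm_perp [simp]: "norm (perp w) = norm w"
  by (simp add: norm_vec_def L2_set_def sum_2 add.commute)

lemma inner_2: "x \<bullet> y = x $ 1 * y $ 1 + x $ 2 * y $ 2" for x y :: "real^2"
  by (simp add: inner_vec_def sum_2)

lemma frechet_derivative_linear_compose: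
  assumes "f differentiable (at x)" "bounded_linear l"
  shows "frechet_derivative (\<lambda>x. l (f x)) (at x) v = l (frechet_derivative f (at x) v)"
proof -
  have "((\<lambda>x. l (f x)) has_derivative (\<lambda>v. l (frechet_derivative f (at x) v))) (at x)"
    using assms by (intro bounded_linear.has_derivative[OF assms(2)]) (simp add: frechet_derivative_works)
  from frechet_derivative_at[OF this] show ?thesis by metis
qed

text \<open>In two dimensions a trace-free matrix becomes symmetric after rotation; this is the
  pointwise reason why the rotation of a solenoidal field is curl-free.\<close>

lemma trace_free_perp:
  fixes D :: "real^2 \<Rightarrow> real^2"
  assumes "linear D" "D (axis 1 1) $ 1 + D (axis 2 1) $ 2 = 0"
  shows "y \<bullet> perp (D v) = v \<bullet> perp (D y)"
proof -
  have D: "D w = (w $ 1) *\<^sub>R D (axis 1 1) + (w $ 2) *\<^sub>R D (axis 2 1)" for w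
  proof -
    have "w = (w $ 1) *\<^sub>R axis 1 1 + (w $ 2) *\<^sub>R axis 2 1"
      by (simp add: vec_eq_iff forall_2 axis_def)
    then show ?thesis
      using linear_add[OF assms(1)] linear_scale[OF assms(1)] by metis
  qed
  have b: "D (axis 2 1) $ 2 = - D (axis 1 1) $ 1" using assms(2) by linarith
  show ?thesis
    unfolding D[of v] D[of y] by (simp add: inner_2 b algebra_simps)
qed

text \<open>The line integral of the rotated field along the segment from x - y to x, that is, the
  increment of a stream function. Unlike a stream function it needs \<sigma> to be solenoidal only
  near that segment, and its L^p norm is at most |y| times that of \<sigma>.\<close>

definition stream :: "real^2 \<Rightarrow> (real^2 \<Rightarrow> real^2) \<Rightarrow> real^2 \<Rightarrow> real" where
  "stream y \<sigma> = average lborel (indicator {0..1::real}) (\<lambda>t. t *\<^sub>R y) (\<lambda>z. y \<bullet> perp (\<sigma> z))"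

lemma stream_smooth:
  assumes \<sigma>: "\<sigma> \<in> test_functions UNIV"
  shows "class_C m (stream y \<sigma>)"
    and "frechet_derivative (stream y \<sigma>) (at x) v =
      (LINT t|lborel. indicator {0..1} t * (y \<bullet> perp (frechet_derivative \<sigma> (at (x - t *\<^sub>R y)) v)))"
proof -
  have l: "bounded_linear (\<lambda>w. y \<bullet> perp w)"
    by (rule bounded_linear_compose[OF bounded_linear_inner_right perp_bounded_linear])
  note f = test_functions_compose_linear[OF \<sigma> l]
  have w: "integrable lborel (indicator {0..1::real} :: real \<Rightarrow> real)" by simp
  have eq: "stream y \<sigma> = (\<lambda>z. LINT t|lborel. indicator {0..1} t * (y \<bullet> perp (\<sigma> (z - t *\<^sub>R y))))"
    by (simp add: stream_def average_def[abs_def])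
  show "class_C m (stream y \<sigma>)"
    unfolding eq by (rule class_C_integral_translates[OF f w]) measurable
  show "frechet_derivative (stream y \<sigma>) (at x) v =
      (LINT t|lborel. indicator {0..1} t * (y \<bullet> perp (frechet_derivative \<sigma> (at (x - t *\<^sub>R y)) v)))"
    unfolding eq
    by (subst frechet_derivative_integral_translates[OF f w])
      (simp_all add: frechet_derivative_linear_compose[OF test_functionsD(7)[OF \<sigma>] l])
qed

text \<open>Vanishing divergence along the segment allows the directions \<open>v\<close> and
  \<open>y\<close> to be exchanged in the integrand, which then is a derivative with respect to
  \<open>t\<close>; the fundamental theorem of calculus leaves the two endpoints.\<close>

lemma grad_stream:
  assumes \<sigma>: "\<sigma> \<in> test_functions UNIV"
    and div: "\<And>t. 0 \<le> t \<Longrightarrow> t \<le> 1 \<Longrightarrow> frechet_derivative \<sigma> (at (x - t *\<^sub>R y)) (axis 1 1) $ 1 +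
      frechet_derivative \<sigma> (at (x - t *\<^sub>R y)) (axis 2 1) $ 2 = 0"
  shows "grad (stream y \<sigma>) x = perp (\<sigma> x - \<sigma> (x - y))"
proof (rule inner_eqI)
  fix v
  let ?D = "\<lambda>t. frechet_derivative \<sigma> (at (x - t *\<^sub>R y))"
  have "stream y \<sigma> differentiable (at x)" using stream_smooth(1)[OF \<sigma>, of "Suc 0"] by auto
  then have "v \<bullet> grad (stream y \<sigma>) x = (LINT t|lborel. indicator {0..1} t * (y \<bullet> perp (?D t v)))"
    by (simp add: grad_eq_sum(2) stream_smooth(2)[OF \<sigma>])
  also have "\<dots> = (LINT t|lborel. indicator {0..1} t *\<^sub>R (v \<bullet> perp (?D t y)))"
  proof (rule Bochner_Integration.integral_cong[OF refl])
    fix t :: real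
    show "indicator {0..1} t * (y \<bullet> perp (?D t v)) = indicator {0..1} t *\<^sub>R (v \<bullet> perp (?D t y))"
      using trace_free_perp[OF bounded_linear.linear[OF test_functionsD(9)[OF \<sigma>]] div[of t], of y v]
      by (auto simp: indicator_def)
  qed
  also have "\<dots> = - (v \<bullet> perp (\<sigma> (x - 1 *\<^sub>R y))) - - (v \<bullet> perp (\<sigma> (x - 0 *\<^sub>R y)))"
  proof (rule integral_FTC_atLeastAtMost)
    fix t :: real assume "0 \<le> t" "t \<le> 1"
    have l: "bounded_linear (\<lambda>w. - (v \<bullet> perp w))"
      by (intro bounded_linear_minus bounded_linear_compose[OF bounded_linear_inner_right perp_bounded_linear])
    have "((\<lambda>t. x - t *\<^sub>R y) has_derivative (\<lambda>h. - (h *\<^sub>R y))) (at t)"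
      by (auto intro!: derivative_eq_intros)
    from diff_chain_at[OF this test_functionsD(8)[OF \<sigma>]]
    have "((\<lambda>t. \<sigma> (x - t *\<^sub>R y)) has_derivative (\<lambda>h. ?D t (- (h *\<^sub>R y)))) (at t)"
      by (simp add: o_def)
    from bounded_linear.has_derivative[OF l this]
    have "((\<lambda>t. - (v \<bullet> perp (\<sigma> (x - t *\<^sub>R y)))) has_derivative (\<lambda>h. - (v \<bullet> perp (?D t (- (h *\<^sub>R y)))))) (at t)" .
    also have "(\<lambda>h. - (v \<bullet> perp (?D t (- (h *\<^sub>R y))))) = (\<lambda>h. h *\<^sub>R (v \<bullet> perp (?D t y)))"
    proof
      fix h
      have "?D t (- (h *\<^sub>R y)) = - (h *\<^sub>R ?D t y)"
        using linear_neg[OF bounded_linear.linear[OF test_functionsD(9)[OF \<sigma>]]]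
          linear_scale[OF bounded_linear.linear[OF test_functionsD(9)[OF \<sigma>]]] by metis
      then show "- (v \<bullet> perp (?D t (- (h *\<^sub>R y)))) = h *\<^sub>R (v \<bullet> perp (?D t y))"
        using linear_neg[OF perp_linear] linear_scale[OF perp_linear] by simp
    qed
    finally show "((\<lambda>t. - (v \<bullet> perp (\<sigma> (x - t *\<^sub>R y)))) has_vector_derivative v \<bullet> perp (?D t y)) (at t within {0..1})"
      unfolding has_vector_derivative_def by (rule has_derivative_at_withinI)
  next
    have c: "continuous_on UNIV (\<lambda>z. frechet_derivative \<sigma> (at z) y)"
      by (rule test_functionsD(6)[OF test_functions_derivative[OF \<sigma>]])
    have "continuous_on {0..1} (\<lambda>t. ?D t y)"
      by (rule continuous_on_compose2[OF c]) (auto intro!: continuous_intros)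
    then show "continuous_on {0..1} (\<lambda>t. v \<bullet> perp (?D t y))"
      by (intro continuous_intros continuous_on_compose2[OF linear_continuous_on[OF perp_bounded_linear, of UNIV]]) auto
  qed simp
  also have "\<dots> = v \<bullet> perp (\<sigma> x - \<sigma> (x - y))"
    by (simp add: linear_diff[OF perp_linear] inner_diff_right)
  finally show "v \<bullet> grad (stream y \<sigma>) x = v \<bullet> perp (\<sigma> x - \<sigma> (x - y))" .
qed

lemma
  fixes f :: "'a::euclidean_space \<Rightarrow> 'b::euclidean_space"
  assumes "memL lborel p f"
  shows memL_translate: "memL lborel p (\<lambda>x. f (x - y))"
    and nrm_translate: "nrm lborel p (\<lambda>x. f (x - y)) = nrm lborel p f"
proof -
  have [measurable]: "f \<in> borel_measurable borel" using memL_measurable[OF assms] by simp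
  have [measurable]: "(\<lambda>x. norm (f x) powr p) \<in> borel_measurable borel" by measurable
  have "integrable lborel (\<lambda>x. norm (f (- y + 1 *\<^sub>R x)) powr p)"
    using integrable_lborel_affine[of "\<lambda>x. norm (f x) powr p" 1 "- y"] memL_integrable[OF assms] by simp
  then show "memL lborel p (\<lambda>x. f (x - y))" by (simp add: memL_def)
  show "nrm lborel p (\<lambda>x. f (x - y)) = nrm lborel p f"
    using integral_lborel_affine[of "\<lambda>x. norm (f x) powr p" 1 "- y"] by (simp add: nrm_def)
qed

lemma average_eq_convolution:
  fixes f :: "'a::euclidean_space \<Rightarrow> 'b::euclidean_space"
  assumes [measurable]: "\<rho> \<in> borel_measurable borel" "f \<in> borel_measurable borel"
  shows "average lborel \<rho> (\<lambda>y. y) f x = (LINT z|lborel. \<rho> (x - z) *\<^sub>R f z)"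
  using integral_lborel_affine[of "\<lambda>z. \<rho> (x - z) *\<^sub>R f z" "-1" x] by (simp add: average_def)

lemma integrable_scaleR_bounded:
  fixes f :: "'a \<Rightarrow> 'b::euclidean_space"
  assumes "integrable M f" "w \<in> borel_measurable M" "\<And>x. \<bar>w x\<bar> \<le> B"
  shows "integrable M (\<lambda>x. w x *\<^sub>R f x)"
proof -
  note [measurable] = borel_measurable_integrable[OF assms(1)] assms(2)
  have "integrable M (\<lambda>x. B *\<^sub>R f x)" using assms(1) by simp
  then show ?thesis
    by (rule Bochner_Integration.integrable_bound)
      (use assms(3) in \<open>auto intro!: AE_I2 mult_right_mono order_trans[OF _ abs_ge_self]\<close>)
qed

lemma test_functions_reflect:
  fixes \<rho> :: "'a::euclidean_space \<Rightarrow> real"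
  assumes \<rho>: "\<rho> \<in> test_functions (ball 0 r)" and x: "ball x r \<subseteq> \<omega>"
  shows "(\<lambda>z. \<rho> (x - z)) \<in> test_functions \<omega>"
proof (rule test_functionsI)
  show "class_C m (\<lambda>z. \<rho> (x - z))" for m
    using class_C_compose_affine[OF bounded_linear_minus[OF bounded_linear_ident] test_functionsD(1)[OF \<rho>], of m x] by simp
  let ?K = "(\<lambda>y. x - y) ` closure {y. \<rho> y \<noteq> 0}"
  show "compact ?K" by (intro compact_continuous_image test_functionsD(2)[OF \<rho>] continuous_intros)
  show "?K \<subseteq> \<omega>"
  proof
    fix z assume "z \<in> ?K"
    then obtain y where "y \<in> ball 0 r" "z = x - y" using test_functionsD(3)[OF \<rho>] by blast
    then have "z \<in> ball x r" by (simp add: dist_norm)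
    then show "z \<in> \<omega>" using x by blast
  qed
  show "\<rho> (x - z) = 0" if "z \<notin> ?K" for z
  proof -
    have "z = x - (x - z)" by simp
    then have "x - z \<notin> closure {y. \<rho> y \<noteq> 0}" using that by blast
    then show ?thesis by (rule zero_outside_support)
  qed
qed

text \<open>The divergence of \<sigma> at \<open>x\<close> is, up to sign, the integral of
  \<open>s\<close> against the gradient of \<rho>(x - z) as a function of z. This is an admissible
  test function as soon as the ball of radius \<open>r\<close> about \<open>x\<close> lies in
  \<omega>, so \<sigma> is solenoidal only away from the boundary.\<close>

lemma mollified_solenoidal:
  fixes s :: "real^2 \<Rightarrow> real^2"
  assumes s: "integrable lborel s" "s \<in> borel_measurable borel" and supp: "\<And>x. x \<notin> ball 0 K \<Longrightarrow> s x = 0"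
    and div: "\<And>\<phi>. \<phi> \<in> test_functions \<omega> \<Longrightarrow> (LINT x|lborel. s x \<bullet> grad \<phi> x) = 0"
    and \<rho>: "\<rho> \<in> test_functions (ball 0 r)"
  defines "\<sigma> \<equiv> average lborel \<rho> (\<lambda>y. y) s"
  shows "\<sigma> \<in> test_functions UNIV"
    and "ball x r \<subseteq> \<omega> \<Longrightarrow> frechet_derivative \<sigma> (at x) (axis 1 1) $ 1 + frechet_derivative \<sigma> (at x) (axis 2 1) $ 2 = 0"
proof -
  note \<rho>U = test_functions_UNIV[OF \<rho>]
  note [measurable] = test_functions_measurable[OF \<rho>] s(2)
  obtain B where B: "\<And>x. norm (\<rho> x) \<le> B" using test_functions_bounded[OF \<rho>] by blast
  have comp_int: "integrable lborel (\<lambda>z. s z $ i)" for i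
    using integrable_bounded_linear[OF bounded_linear_vec_nth s(1)] .
  have int: "integrable lborel (\<lambda>z. \<rho> (x - z) *\<^sub>R s z)" for x
    by (rule integrable_scaleR_bounded[OF s(1)]) (use B in auto)
  have comp: "(\<lambda>x. \<sigma> x $ i) = (\<lambda>x. LINT z|lborel. s z $ i * \<rho> (x - z))" for i
    using integral_bounded_linear[OF bounded_linear_vec_nth int]
    by (auto simp: \<sigma>_def average_eq_convolution mult.commute)
  have Ccomp: "class_C m (\<lambda>x. \<sigma> x $ i)" for m i
    unfolding comp by (rule class_C_integral_translates[OF \<rho>U comp_int]) measurable
  have sum: "(\<lambda>x. \<Sum>i\<in>UNIV. (\<sigma> x $ i) *\<^sub>R axis i (1::real)) = \<sigma>"
    by (auto simp: vec_eq_iff forall_2 sum_2 axis_def fun_eq_iff)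
  have "class_C m (\<lambda>x. \<Sum>i\<in>UNIV. (\<sigma> x $ i) *\<^sub>R axis i (1::real))" for m
    by (intro class_C_sum class_C_compose_linear[OF bounded_linear_scaleR_left Ccomp])
  then have C: "class_C m \<sigma>" for m unfolding sum .
  have "bounded {x. \<sigma> x \<noteq> 0}"
  proof (rule bounded_subset[OF bounded_ball[of 0 "K + r"]], rule subsetI)
    fix x assume "x \<in> {x. \<sigma> x \<noteq> 0}"
    then have nz: "(LINT y|lborel. \<rho> y *\<^sub>R s (x - y)) \<noteq> 0" by (simp add: \<sigma>_def average_def)
    have "\<exists>y. \<rho> y *\<^sub>R s (x - y) \<noteq> 0"
    proof (rule ccontr)
      assume "\<not> ?thesis"
      then have "(\<lambda>y. \<rho> y *\<^sub>R s (x - y)) = (\<lambda>y. 0)" by (intro ext) blast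
      with nz show False by (simp only: integral_zero)
    qed
    then obtain y where y: "\<rho> y *\<^sub>R s (x - y) \<noteq> 0" by blast
    then have "norm y < r" "norm (x - y) < K"
      using test_functionsD(5)[OF \<rho>, of y] supp[of "x - y"] by auto
    then show "x \<in> ball 0 (K + r)" using norm_triangle_ineq[of "x - y" y] by simp
  qed
  then show \<sigma>: "\<sigma> \<in> test_functions UNIV" using C by (intro test_functions_UNIV_I)
  show "frechet_derivative \<sigma> (at x) (axis 1 1) $ 1 + frechet_derivative \<sigma> (at x) (axis 2 1) $ 2 = 0" if x: "ball x r \<subseteq> \<omega>"
  proof -
    have fd: "frechet_derivative \<sigma> (at x) v $ i = (LINT z|lborel. s z $ i * frechet_derivative \<rho> (at (x - z)) v)" for v i
    proof -
      have "frechet_derivative \<sigma> (at x) v $ i = frechet_derivative (\<lambda>x. \<sigma> x $ i) (at x) v"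
        by (rule frechet_derivative_linear_compose[symmetric, OF test_functionsD(7)[OF \<sigma>] bounded_linear_vec_nth])
      also have "\<dots> = (LINT z|lborel. s z $ i * frechet_derivative \<rho> (at (x - z)) v)"
        unfolding comp by (rule frechet_derivative_integral_translates[OF \<rho>U comp_int]) measurable
      finally show ?thesis .
    qed
    define \<phi> where "\<phi> z = \<rho> (x - z)" for z
    have \<phi>: "\<phi> \<in> test_functions \<omega>" unfolding \<phi>_def by (rule test_functions_reflect[OF \<rho> x])
    have d\<phi>: "frechet_derivative \<phi> (at z) v = - frechet_derivative \<rho> (at (x - z)) v" for z v
    proof -
      have "((\<lambda>z. x - z) has_derivative (\<lambda>v. - v)) (at z)" by (auto intro!: derivative_eq_intros)
      from diff_chain_at[OF this test_functionsD(8)[OF \<rho>]]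
      have "(\<phi> has_derivative (\<lambda>v. frechet_derivative \<rho> (at (x - z)) (- v))) (at z)"
        by (simp add: o_def \<phi>_def[abs_def])
      from frechet_derivative_at[OF this] show ?thesis
        using linear_neg[OF bounded_linear.linear[OF test_functionsD(9)[OF \<rho>]]] by metis
    qed
    have gr: "grad \<phi> z $ j = - frechet_derivative \<rho> (at (x - z)) (axis j 1)" for z j
      using grad_eq_sum(2)[OF test_functionsD(7)[OF \<phi>], of "axis j 1" z] by (simp add: d\<phi> inner_axis')
    have i2: "integrable lborel (\<lambda>z. s z $ i * frechet_derivative \<rho> (at (x - z)) v)" for i v
    proof -
      note D = test_functions_derivative[OF \<rho>, of v]
      note [measurable] = test_functions_measurable[OF D]
      obtain B' where "\<And>x. norm (frechet_derivative \<rho> (at x) v) \<le> B'" using test_functions_bounded[OF D] by blast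
      then have "integrable lborel (\<lambda>z. frechet_derivative \<rho> (at (x - z)) v *\<^sub>R s z $ i)"
        by (intro integrable_scaleR_bounded[OF comp_int, of _ B']) auto
      then show ?thesis by (simp add: mult.commute)
    qed
    have "0 = (LINT z|lborel. s z \<bullet> grad \<phi> z)" using div[OF \<phi>] by simp
    also have "\<dots> = (LINT z|lborel. - (s z $ 1 * frechet_derivative \<rho> (at (x - z)) (axis 1 1) + s z $ 2 * frechet_derivative \<rho> (at (x - z)) (axis 2 1)))"
      by (simp add: inner_2 gr)
    also have "\<dots> = - (frechet_derivative \<sigma> (at x) (axis 1 1) $ 1 + frechet_derivative \<sigma> (at x) (axis 2 1) $ 2)"
      unfolding fd Bochner_Integration.integral_minus Bochner_Integration.integral_add[OF i2 i2] ..
    finally show ?thesis by simp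
  qed
qed

subsection \<open>The div-curl lemma\<close>

lemma weighted_Holder:
  fixes f g :: "'a \<Rightarrow> 'b::euclidean_space"
  assumes pq: "p > 1" "q > 1" "1 / p + 1 / q = 1" and f: "memL M p f" and g: "memL M q g"
    and \<eta>: "\<eta> \<in> borel_measurable M" "\<And>x. \<bar>\<eta> x\<bar> \<le> B"
  shows "integrable M (\<lambda>x. \<eta> x * (f x \<bullet> g x))"
    and "\<bar>LINT x|M. \<eta> x * (f x \<bullet> g x)\<bar> \<le> B * nrm M p f * nrm M q g"
proof -
  note [measurable] = \<eta>(1) memL_measurable[OF f] memL_measurable[OF g]
  have B: "B \<ge> 0" using \<eta>(2) by (rule order_trans[OF abs_ge_zero])
  note H = Holder_norm[OF pq f g]
  have int: "integrable M (\<lambda>x. B * (norm (f x) * norm (g x)))" using H(1) by simp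
  have le: "norm (\<eta> x * (f x \<bullet> g x)) \<le> B * (norm (f x) * norm (g x))" for x
    using mult_mono[OF \<eta>(2)[of x] Cauchy_Schwarz_ineq2[of "f x" "g x"]] B by (simp add: abs_mult)
  show "integrable M (\<lambda>x. \<eta> x * (f x \<bullet> g x))"
    by (rule Bochner_Integration.integrable_bound[OF int])
      (use le in \<open>auto intro!: AE_I2 order_trans[OF _ abs_ge_self]\<close>)
  have "norm (LINT x|M. \<eta> x * (f x \<bullet> g x)) \<le> (LINT x|M. B * (norm (f x) * norm (g x)))"
    by (rule norm_integral_le[OF int]) (use le in auto)
  also have "\<dots> \<le> B * (nrm M p f * nrm M q g)"
    using H(2) B by (simp add: mult_left_mono)
  finally show "\<bar>LINT x|M. \<eta> x * (f x \<bullet> g x)\<bar> \<le> B * nrm M p f * nrm M q g" by (simp add: mult.assoc)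
qed

lemma nrm_le_mult:
  fixes f :: "'a \<Rightarrow> 'b::euclidean_space" and g :: "'a \<Rightarrow> 'c::euclidean_space"
  assumes "memL M p g" "f \<in> borel_measurable M" "\<And>x. norm (f x) \<le> c * norm (g x)" "p > 0" "c \<ge> 0"
  shows "memL M p f" "nrm M p f \<le> c * nrm M p g"
  using memL_mono[OF memL_scaleR(1)[OF assms(1,4), of c] assms(2) _ assms(4)] memL_scaleR(2)[OF assms(1,4), of c] assms(3,5)
  by auto

lemma measurable_perp [measurable]: "perp \<in> borel_measurable borel"
  by (rule borel_measurable_continuous_onI[OF linear_continuous_on[OF perp_bounded_linear]])

text \<open>Where \<eta> is nonzero, the difference \<sigma>(x) - \<sigma>(x - y) is a rotated
  gradient of the stream function \<psi>. Moving \<eta> under the gradient produces two terms: one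
  with \<psi> itself, which is small because |y| is, and one that tests the curl of \<open>v\<close>
  with \<eta> \<psi>.\<close>

lemma smooth_shift_estimate:
  fixes \<sigma> v :: "real^2 \<Rightarrow> real^2"
  assumes \<eta>: "\<eta> \<in> test_functions \<omega>" and B: "\<And>x. \<bar>\<eta> x\<bar> \<le> B" "\<And>x. norm (grad \<eta> x) \<le> B"
    and \<sigma>: "\<sigma> \<in> test_functions UNIV"
    and div: "\<And>x t. \<eta> x \<noteq> 0 \<Longrightarrow> 0 \<le> t \<Longrightarrow> t \<le> 1 \<Longrightarrow> frechet_derivative \<sigma> (at (x - t *\<^sub>R y)) (axis 1 1) $ 1 +
      frechet_derivative \<sigma> (at (x - t *\<^sub>R y)) (axis 2 1) $ 2 = 0"
    and v: "memL lborel 4 v" and "\<epsilon> \<ge> 0"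
    and curl: "\<And>\<phi>. \<phi> \<in> test_functions \<omega> \<Longrightarrow>
      \<bar>LINT x|lborel. v x \<bullet> perp (grad \<phi> x)\<bar> \<le> \<epsilon> * (nrm lborel (4/3) \<phi> + nrm lborel (4/3) (grad \<phi>))"
    and y: "norm y \<le> 1"
  shows "\<bar>LINT x|lborel. \<eta> x * ((\<sigma> x - \<sigma> (x - y)) \<bullet> v x)\<bar> \<le>
    B * nrm lborel (4/3) \<sigma> * (4 * \<epsilon> + norm y * nrm lborel 4 v)"
proof -
  note [measurable] = test_functions_measurable[OF \<eta>] test_functions_measurable[OF \<sigma>]
    test_functions_measurable[OF test_functions_grad[OF \<eta>]]
  have vm [measurable]: "v \<in> borel_measurable borel" using memL_measurable[OF v] by simp
  have B0: "B \<ge> 0" using B(1) by (rule order_trans[OF abs_ge_zero])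
  let ?N = "nrm lborel (4/3) \<sigma>" and ?V = "nrm lborel 4 v" and ?d = "\<lambda>x. \<sigma> x - \<sigma> (x - y)"
  have \<sigma>L: "memL lborel (4/3) \<sigma>" by (rule memL_test_functions[OF \<sigma>]) simp
  have dL: "memL lborel (4/3) ?d" and dN: "nrm lborel (4/3) ?d \<le> 2 * ?N"
    using Minkowski_diff[OF _ \<sigma>L memL_translate[OF \<sigma>L]] nrm_translate[OF \<sigma>L] by auto
  define \<psi> where "\<psi> = stream y \<sigma>"
  have \<psi>C: "class_C m \<psi>" for m unfolding \<psi>_def by (rule stream_smooth(1)[OF \<sigma>])
  have [measurable]: "\<psi> \<in> borel_measurable borel"
    by (rule borel_measurable_continuous_onI[OF class_C_imp_continuous[OF \<psi>C[of 0]]])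
  have \<psi>L: "memL lborel (4/3) \<psi>" and \<psi>N: "nrm lborel (4/3) \<psi> \<le> norm y * ?N"
  proof -
    have f: "memL lborel (4/3) (\<lambda>z. y \<bullet> perp (\<sigma> z))" "nrm lborel (4/3) (\<lambda>z. y \<bullet> perp (\<sigma> z)) \<le> norm y * ?N"
      using nrm_le_mult[OF \<sigma>L, of "\<lambda>z. y \<bullet> perp (\<sigma> z)" "norm y"] Cauchy_Schwarz_ineq2[of y "perp (\<sigma> z)" for z] by auto
    have "memL lborel (4/3) \<psi> \<and> nrm lborel (4/3) \<psi> \<le> nrm lborel (4/3) (\<lambda>z. y \<bullet> perp (\<sigma> z))"
      unfolding \<psi>_def stream_def
      by (intro conjI average_memL f lborel.sigma_finite_measure_axioms) (simp_all add: sigma_finite_lborel)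
    with f show "memL lborel (4/3) \<psi>" "nrm lborel (4/3) \<psi> \<le> norm y * ?N" by auto
  qed
  define \<phi> where "\<phi> x = \<eta> x * \<psi> x" for x
  have \<phi>: "\<phi> \<in> test_functions \<omega>" unfolding \<phi>_def by (rule test_functions_mult[OF \<eta> \<psi>C])
  note [measurable] = test_functions_measurable[OF \<phi>] test_functions_measurable[OF test_functions_grad[OF \<phi>]]
  have g\<phi>: "grad \<phi> x = \<eta> x *\<^sub>R grad \<psi> x + \<psi> x *\<^sub>R grad \<eta> x" for x
    unfolding \<phi>_def by (rule grad_mult[OF test_functionsD(1)[OF \<eta>] \<psi>C])
  have g\<psi>: "\<eta> x *\<^sub>R grad \<psi> x = \<eta> x *\<^sub>R perp (?d x)" for x
    using grad_stream[OF \<sigma> div, of x] by (cases "\<eta> x = 0") (auto simp: \<psi>_def)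
  \<comment> \<open>Here \<open>perp (perp w) = - w\<close> recovers the shift difference from the
    rotated gradient of \<psi>, and the product rule for \<eta> \<psi> produces the correction
    term.\<close>
  have pt: "\<eta> x * (?d x \<bullet> v x) = \<psi> x * (perp (grad \<eta> x) \<bullet> v x) - v x \<bullet> perp (grad \<phi> x)" for x
    unfolding g\<phi> g\<psi>
    by (simp add: linear_add[OF perp_linear] linear_scale[OF perp_linear] inner_simps inner_commute algebra_simps)
  have \<phi>L: "memL lborel (4/3) \<phi>" and \<phi>N: "nrm lborel (4/3) \<phi> \<le> B * nrm lborel (4/3) \<psi>"
    using nrm_le_mult[OF \<psi>L, of \<phi> B] B(1) B0 by (auto simp: \<phi>_def abs_mult mult_right_mono)
  have g\<phi>N: "nrm lborel (4/3) (grad \<phi>) \<le> B * (2 * ?N) + B * nrm lborel (4/3) \<psi>"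
  proof -
    have 1: "memL lborel (4/3) (\<lambda>x. \<eta> x *\<^sub>R perp (?d x))" "nrm lborel (4/3) (\<lambda>x. \<eta> x *\<^sub>R perp (?d x)) \<le> B * nrm lborel (4/3) ?d"
      using nrm_le_mult[OF dL, of "\<lambda>x. \<eta> x *\<^sub>R perp (?d x)" B] B(1) B0 by (auto simp: mult_right_mono)
    have 2: "memL lborel (4/3) (\<lambda>x. \<psi> x *\<^sub>R grad \<eta> x)" "nrm lborel (4/3) (\<lambda>x. \<psi> x *\<^sub>R grad \<eta> x) \<le> B * nrm lborel (4/3) \<psi>"
    proof -
      have "norm (\<psi> x *\<^sub>R grad \<eta> x) \<le> B * norm (\<psi> x)" for x
        using mult_left_mono[OF B(2)[of x] abs_ge_zero[of "\<psi> x"]] by (simp add: mult.commute)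
      note le = this
      show "memL lborel (4/3) (\<lambda>x. \<psi> x *\<^sub>R grad \<eta> x)"
        by (rule nrm_le_mult(1)[OF \<psi>L _ le _ B0]) auto
      show "nrm lborel (4/3) (\<lambda>x. \<psi> x *\<^sub>R grad \<eta> x) \<le> B * nrm lborel (4/3) \<psi>"
        by (rule nrm_le_mult(2)[OF \<psi>L _ le _ B0]) auto
    qed
    have "grad \<phi> = (\<lambda>x. \<eta> x *\<^sub>R perp (?d x) + \<psi> x *\<^sub>R grad \<eta> x)"
      by (rule ext) (simp only: g\<phi> g\<psi>)
    then have "nrm lborel (4/3) (grad \<phi>) \<le> B * nrm lborel (4/3) ?d + B * nrm lborel (4/3) \<psi>"
      using Minkowski(2)[OF _ 1(1) 2(1)] 1(2) 2(2) by simp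
    also have "\<dots> \<le> B * (2 * ?N) + B * nrm lborel (4/3) \<psi>"
      using dN B0 by (intro add_right_mono mult_left_mono)
    finally show ?thesis .
  qed
  let ?b = "\<lambda>x. \<psi> x * (perp (grad \<eta> x) \<bullet> v x)"
  have Hb: "integrable lborel (\<lambda>x. B * (norm (\<psi> x) * norm (v x)))"
    "(LINT x|lborel. norm (\<psi> x) * norm (v x)) \<le> nrm lborel (4/3) \<psi> * ?V"
    using Holder_norm[OF conj_4_43(1-3) \<psi>L v] by auto
  have ble: "norm (?b x) \<le> B * (norm (\<psi> x) * norm (v x))" for x
  proof -
    have "\<bar>perp (grad \<eta> x) \<bullet> v x\<bar> \<le> B * norm (v x)"
      by (rule order_trans[OF Cauchy_Schwarz_ineq2[of "perp (grad \<eta> x)" "v x", unfolded norm_perp] mult_right_mono[OF B(2)[of x] norm_ge_zero[of "v x"]]])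
    then have "\<bar>\<psi> x\<bar> * \<bar>perp (grad \<eta> x) \<bullet> v x\<bar> \<le> \<bar>\<psi> x\<bar> * (B * norm (v x))" by (rule mult_left_mono) simp
    then show ?thesis by (simp add: abs_mult mult_ac)
  qed
  have bi: "integrable lborel ?b"
    by (rule Bochner_Integration.integrable_bound[OF Hb(1)])
      (use ble in \<open>auto intro!: AE_I2 order_trans[OF _ abs_ge_self]\<close>)
  have bb: "\<bar>LINT x|lborel. ?b x\<bar> \<le> B * (nrm lborel (4/3) \<psi> * ?V)"
  proof -
    have "norm (LINT x|lborel. ?b x) \<le> (LINT x|lborel. B * (norm (\<psi> x) * norm (v x)))"
      by (rule norm_integral_le[OF Hb(1)]) (use ble in auto)
    then show ?thesis using mult_left_mono[OF Hb(2) B0] by simp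
  qed
  have ci: "integrable lborel (\<lambda>x. v x \<bullet> perp (grad \<phi> x))"
    by (rule Holder_inner(1)[OF conj_4_43(2,1,4) v memL_test_functions[OF test_functions_compose_linear[OF test_functions_grad[OF \<phi>] perp_bounded_linear]]]) simp
  have "\<bar>LINT x|lborel. \<eta> x * (?d x \<bullet> v x)\<bar> = \<bar>(LINT x|lborel. ?b x) - (LINT x|lborel. v x \<bullet> perp (grad \<phi> x))\<bar>"
    unfolding pt using bi ci by simp
  also have "\<dots> \<le> B * (nrm lborel (4/3) \<psi> * ?V) + \<epsilon> * (nrm lborel (4/3) \<phi> + nrm lborel (4/3) (grad \<phi>))"
    using bb curl[OF \<phi>] by linarith
  \<comment> \<open>Origin of the factor 4: as |y| <= 1, the norm of \<psi> is at most that of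
    \<sigma>, so \<phi> contributes 1 and its gradient 2 + 1, each times B and the norm of
    \<sigma>.\<close>
  also have "\<dots> \<le> B * ((norm y * ?N) * ?V) + \<epsilon> * (B * ?N + (B * (2 * ?N) + B * ?N))"
  proof (intro add_mono mult_left_mono mult_right_mono \<psi>N)
    have yN: "nrm lborel (4/3) \<psi> \<le> ?N"
      using \<psi>N mult_right_mono[OF y, of ?N] by simp
    show "nrm lborel (4/3) \<phi> \<le> B * ?N" using \<phi>N mult_left_mono[OF yN B0] by linarith
    show "nrm lborel (4/3) (grad \<phi>) \<le> B * (2 * ?N) + B * ?N" using g\<phi>N mult_left_mono[OF yN B0] by linarith
  qed (use B0 \<open>\<epsilon> \<ge> 0\<close> in auto)
  finally show ?thesis by (simp add: algebra_simps)
qed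

text \<open>The smooth estimate is applied to a mollification of \<open>s\<close>, which is
  solenoidal near the relevant segments. The bound does not involve the mollification radius, so the
  error made by mollifying can be sent to 0.\<close>

lemma shift_estimate:
  fixes s v :: "real^2 \<Rightarrow> real^2"
  assumes \<eta>: "\<eta> \<in> test_functions \<omega>" and B: "\<And>x. \<bar>\<eta> x\<bar> \<le> B" "\<And>x. norm (grad \<eta> x) \<le> B"
    and room: "\<And>x. \<eta> x \<noteq> 0 \<Longrightarrow> ball x (2 * r0) \<subseteq> \<omega>" "r0 > 0" and K: "\<omega> \<subseteq> ball 0 K"
    and s: "memL lborel (4/3) s" "\<And>x. x \<notin> \<omega> \<Longrightarrow> s x = 0"
    and div: "\<And>\<phi>. \<phi> \<in> test_functions \<omega> \<Longrightarrow> (LINT x|lborel. s x \<bullet> grad \<phi> x) = 0"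
    and v: "memL lborel 4 v" and "\<epsilon> \<ge> 0"
    and curl: "\<And>\<phi>. \<phi> \<in> test_functions \<omega> \<Longrightarrow>
      \<bar>LINT x|lborel. v x \<bullet> perp (grad \<phi> x)\<bar> \<le> \<epsilon> * (nrm lborel (4/3) \<phi> + nrm lborel (4/3) (grad \<phi>))"
    and y: "norm y \<le> 1" "norm y < r0"
  shows "\<bar>LINT x|lborel. \<eta> x * ((s x - s (x - y)) \<bullet> v x)\<bar> \<le>
    B * nrm lborel (4/3) s * (4 * \<epsilon> + norm y * nrm lborel 4 v)"
proof (rule field_le_epsilon)
  fix e :: real assume "e > 0"
  note [measurable] = test_functions_measurable[OF \<eta>]
  have sm [measurable]: "s \<in> borel_measurable borel" using memL_measurable[OF s(1)] by simp
  have B0: "B \<ge> 0" using B(1) by (rule order_trans[OF abs_ge_zero])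
  have sK: "s x = 0" if "x \<notin> ball 0 K" for x using that s(2) K by blast
  have si: "integrable lborel s"
    using memL_finite_support(1)[of 1 "4/3" lborel s "ball 0 K"] s sK emeasure_lborel_ball_finite[of "0::real^2" K]
    by (auto simp: memL_def integrable_norm_iff)
  let ?V = "nrm lborel 4 v" and ?N = "nrm lborel (4/3) s"
  \<comment> \<open>Replacing \<open>s\<close> by \<sigma> in both terms of the difference costs at
    most 2 \<delta> B times the norm of \<open>v\<close>, which is at most \<open>e\<close>; adding
    1 avoids dividing by 0.\<close>
  define \<delta> where "\<delta> = e / (2 * B * ?V + 1)"
  have pos: "2 * B * ?V + 1 > 0" using B0 by (simp add: add_nonneg_pos)
  have \<delta>: "\<delta> > 0" using \<open>e > 0\<close> pos by (simp add: \<delta>_def)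
  obtain r1 where r1: "r1 > 0" and close: "\<And>r \<rho>. r \<le> r1 \<Longrightarrow> \<rho> \<in> test_functions (ball 0 r) \<Longrightarrow> (\<And>x. \<rho> x \<ge> 0) \<Longrightarrow> (LINT x|lborel. \<rho> x) = 1 \<Longrightarrow>
    nrm lborel (4/3) (\<lambda>x. average lborel \<rho> (\<lambda>y. y) s x - s x) \<le> \<delta>"
    using mollification_converges[OF s(1) sK _ \<delta>, of K] by auto
  define r where "r = min r0 r1"
  have r: "r > 0" "r \<le> r0" "r \<le> r1" using room r1 by (auto simp: r_def)
  obtain \<rho> :: "real^2 \<Rightarrow> real" where \<rho>: "\<rho> \<in> test_functions (ball 0 r)" "\<And>x. \<rho> x \<ge> 0" "(LINT x|lborel. \<rho> x) = 1"
    using bump_exists[OF r(1)] by blast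
  define \<sigma> where "\<sigma> = average lborel \<rho> (\<lambda>y. y) s"
  note moll = mollified_solenoidal[OF si sm sK div \<rho>(1), folded \<sigma>_def]
  have \<sigma>: "memL lborel (4/3) \<sigma>" "nrm lborel (4/3) \<sigma> \<le> ?N"
    unfolding \<sigma>_def
    by (rule average_memL; use \<rho> test_functions_integrable[OF \<rho>(1)] s(1) sigma_finite_lborel in simp)+
  have \<sigma>c: "nrm lborel (4/3) (\<lambda>x. \<sigma> x - s x) \<le> \<delta>"
    unfolding \<sigma>_def by (rule close[OF r(3) \<rho>])
  have dv: "frechet_derivative \<sigma> (at (x - t *\<^sub>R y)) (axis 1 1) $ 1 + frechet_derivative \<sigma> (at (x - t *\<^sub>R y)) (axis 2 1) $ 2 = 0"
    if "\<eta> x \<noteq> 0" "0 \<le> t" "t \<le> 1" for x t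
  proof (rule moll(2))
    \<comment> \<open>The segment stays within distance r0 of \<open>x\<close>, and the
      mollification radius is at most r0; together this is the room 2 r0 demanded around the support
      of \<eta>.\<close>
    have "norm (t *\<^sub>R y) < r0" using that y mult_left_le_one_le[of "norm y" t] by simp
    then have "ball (x - t *\<^sub>R y) r \<subseteq> ball x (2 * r0)"
      using r by (intro ball_subset_ball_iff[THEN iffD2]) (simp add: dist_norm)
    then show "ball (x - t *\<^sub>R y) r \<subseteq> \<omega>" using room(1)[OF that(1)] by blast
  qed
  have 1: "\<bar>LINT x|lborel. \<eta> x * ((\<sigma> x - \<sigma> (x - y)) \<bullet> v x)\<bar> \<le> B * ?N * (4 * \<epsilon> + norm y * ?V)"
  proof -
    have "\<bar>LINT x|lborel. \<eta> x * ((\<sigma> x - \<sigma> (x - y)) \<bullet> v x)\<bar> \<le> B * nrm lborel (4/3) \<sigma> * (4 * \<epsilon> + norm y * ?V)"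
      by (rule smooth_shift_estimate[OF \<eta> B moll(1) dv v \<open>\<epsilon> \<ge> 0\<close> curl y(1)])
    also have "\<dots> \<le> B * ?N * (4 * \<epsilon> + norm y * ?V)"
      using \<sigma>(2) B0 \<open>\<epsilon> \<ge> 0\<close> by (intro mult_right_mono mult_left_mono) auto
    finally show ?thesis .
  qed
  let ?w = "\<lambda>x. (\<sigma> x - s x) - (\<sigma> (x - y) - s (x - y))"
  have dL: "memL lborel (4/3) (\<lambda>x. \<sigma> x - s x)" by (rule Minkowski_diff(1)[OF _ \<sigma>(1) s(1)]) simp
  have wL: "memL lborel (4/3) ?w" by (rule Minkowski_diff(1)[OF _ dL memL_translate[OF dL]]) simp
  have "nrm lborel (4/3) ?w \<le> nrm lborel (4/3) (\<lambda>x. \<sigma> x - s x) + nrm lborel (4/3) (\<lambda>x. \<sigma> (x - y) - s (x - y))"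
    by (rule Minkowski_diff(2)[OF _ dL memL_translate[OF dL]]) simp
  then have wN: "nrm lborel (4/3) ?w \<le> 2 * \<delta>"
    using \<sigma>c unfolding nrm_translate[OF dL] by simp
  note W = weighted_Holder[OF conj_4_43(1-3) _ v _ B(1)]
  have \<sigma>dL: "memL lborel (4/3) (\<lambda>x. \<sigma> x - \<sigma> (x - y))"
    using Minkowski_diff(1)[OF _ \<sigma>(1) memL_translate[OF \<sigma>(1)]] by auto
  have "(LINT x|lborel. \<eta> x * ((s x - s (x - y)) \<bullet> v x)) =
    (LINT x|lborel. \<eta> x * ((\<sigma> x - \<sigma> (x - y)) \<bullet> v x) - \<eta> x * (?w x \<bullet> v x))"
    by (intro Bochner_Integration.integral_cong refl) (simp add: inner_simps algebra_simps)
  also have "\<dots> = (LINT x|lborel. \<eta> x * ((\<sigma> x - \<sigma> (x - y)) \<bullet> v x)) - (LINT x|lborel. \<eta> x * (?w x \<bullet> v x))"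
    by (intro Bochner_Integration.integral_diff W(1) \<sigma>dL wL) auto
  finally have 2: "\<bar>LINT x|lborel. \<eta> x * ((s x - s (x - y)) \<bullet> v x)\<bar> \<le>
     \<bar>LINT x|lborel. \<eta> x * ((\<sigma> x - \<sigma> (x - y)) \<bullet> v x)\<bar> + \<bar>LINT x|lborel. \<eta> x * (?w x \<bullet> v x)\<bar>"
    by linarith
  have "\<bar>LINT x|lborel. \<eta> x * (?w x \<bullet> v x)\<bar> \<le> B * nrm lborel (4/3) ?w * ?V"
    by (intro W(2) wL) auto
  also have "\<dots> \<le> B * (2 * \<delta>) * ?V"
    using wN B0 by (intro mult_right_mono mult_left_mono) auto
  also have "\<dots> \<le> e"
  proof -
    have "B * (2 * \<delta>) * ?V = \<delta> * (2 * B * ?V)" by (simp add: mult_ac)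
    also have "\<dots> \<le> \<delta> * (2 * B * ?V + 1)" using \<delta> by (intro mult_left_mono) auto
    also have "\<dots> = e"
    proof -
      have "e / c * c = e" if "c > 0" for c :: real using that by simp
      then show ?thesis unfolding \<delta>_def using pos by blast
    qed
    finally show ?thesis .
  qed
  finally show "\<bar>LINT x|lborel. \<eta> x * ((s x - s (x - y)) \<bullet> v x)\<bar> \<le> B * ?N * (4 * \<epsilon> + norm y * ?V) + e"
    using 1 2 by linarith
qed

text \<open>Since \<rho> has integral 1, \<open>s\<close> minus its mollification is the
  \<rho>-average of the shift differences s(x) - s(x - y), to each of which
  \<open>shift_estimate\<close> applies; the integrals are exchanged by Fubini's theorem.\<close>

lemma averaged_shift_estimate:
  fixes s v :: "real^2 \<Rightarrow> real^2"
  assumes \<eta>: "\<eta> \<in> test_functions \<omega>" and B: "\<And>x. \<bar>\<eta> x\<bar> \<le> B" "\<And>x. norm (grad \<eta> x) \<le> B"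
    and room: "\<And>x. \<eta> x \<noteq> 0 \<Longrightarrow> ball x (2 * r0) \<subseteq> \<omega>" "r0 > 0" and K: "\<omega> \<subseteq> ball 0 K"
    and s: "memL lborel (4/3) s" "\<And>x. x \<notin> \<omega> \<Longrightarrow> s x = 0"
    and div: "\<And>\<phi>. \<phi> \<in> test_functions \<omega> \<Longrightarrow> (LINT x|lborel. s x \<bullet> grad \<phi> x) = 0"
    and v: "memL lborel 4 v" and "\<epsilon> \<ge> 0"
    and curl: "\<And>\<phi>. \<phi> \<in> test_functions \<omega> \<Longrightarrow>
      \<bar>LINT x|lborel. v x \<bullet> perp (grad \<phi> x)\<bar> \<le> \<epsilon> * (nrm lborel (4/3) \<phi> + nrm lborel (4/3) (grad \<phi>))"
    and h: "h \<le> 1" "h \<le> r0"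
    and \<rho>: "\<rho> \<in> test_functions (ball 0 h)" "\<And>x. \<rho> x \<ge> 0" "(LINT x|lborel. \<rho> x) = 1"
  shows "\<bar>(LINT x|lborel. \<eta> x * (s x \<bullet> v x)) - (LINT x|lborel. \<eta> x * (average lborel \<rho> (\<lambda>y. y) s x \<bullet> v x))\<bar>
    \<le> B * nrm lborel (4/3) s * (4 * \<epsilon> + h * nrm lborel 4 v)"
proof -
  note [measurable] = test_functions_measurable[OF \<eta>] test_functions_measurable[OF \<rho>(1)]
  have sm [measurable]: "s \<in> borel_measurable borel" using memL_measurable[OF s(1)] by simp
  have vm [measurable]: "v \<in> borel_measurable borel" using memL_measurable[OF v] by simp
  have B0: "B \<ge> 0" using B(1) by (rule order_trans[OF abs_ge_zero])
  have \<rho>i: "integrable lborel \<rho>" by (rule test_functions_integrable[OF \<rho>(1)])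
  have si: "integrable lborel s"
    using memL_finite_support(1)[of 1 "4/3" lborel s "ball 0 K"] s K emeasure_lborel_ball_finite[of "0::real^2" K]
    by (auto simp: memL_def integrable_norm_iff subset_iff)
  obtain B' where B': "\<And>x. norm (\<rho> x) \<le> B'" using test_functions_bounded[OF \<rho>(1)] by blast
  let ?A = "average lborel \<rho> (\<lambda>y. y) s" and ?N = "nrm lborel (4/3) s" and ?V = "nrm lborel 4 v"
  have AL: "memL lborel (4/3) ?A"
    by (rule average_memL(1); use \<rho> \<rho>i s(1) sigma_finite_lborel in simp)
  define g where "g y x = \<rho> y * (\<eta> x * ((s x - s (x - y)) \<bullet> v x))" for y x
  have gm [measurable]: "(\<lambda>(y, x). g y x) \<in> borel_measurable (lborel \<Otimes>\<^sub>M lborel)"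
    unfolding g_def by measurable
  have dL: "memL lborel (4/3) (\<lambda>x. s x - s (x - y))" and dN: "nrm lborel (4/3) (\<lambda>x. s x - s (x - y)) \<le> 2 * ?N" for y
    using Minkowski_diff[OF _ s(1) memL_translate[OF s(1)]] nrm_translate[OF s(1)] by auto
  note W = weighted_Holder[OF conj_4_43(1-3) dL v _ B(1)]
  have gx: "integrable lborel (g y)" for y
    unfolding g_def by (intro integrable_mult_right W(1)) simp
  have gnorm: "(LINT x|lborel. norm (g y x)) \<le> \<rho> y * (B * (2 * ?N * ?V))" for y
  proof -
    note Hn = Holder_norm[OF conj_4_43(1-3) dL[of y] v]
    have "(LINT x|lborel. norm (g y x)) \<le> (LINT x|lborel. \<rho> y * (B * (norm (s x - s (x - y)) * norm (v x))))"
    proof (rule integral_mono)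
      show "norm (g y x) \<le> \<rho> y * (B * (norm (s x - s (x - y)) * norm (v x)))" for x
      proof -
        have "\<bar>\<eta> x\<bar> * \<bar>(s x - s (x - y)) \<bullet> v x\<bar> \<le> B * (norm (s x - s (x - y)) * norm (v x))"
          by (intro mult_mono B(1) Cauchy_Schwarz_ineq2 B0) simp
        from mult_left_mono[OF this \<rho>(2)[of y]] show ?thesis
          using \<rho>(2)[of y] by (simp add: g_def abs_mult)
      qed
    qed (use gx Hn(1) in auto)
    also have "\<dots> = \<rho> y * (B * (LINT x|lborel. norm (s x - s (x - y)) * norm (v x)))" by simp
    also have "\<dots> \<le> \<rho> y * (B * (2 * ?N * ?V))"
      using Hn(2) mult_right_mono[OF dN[of y] nrm_nonneg[of lborel 4 v]] B0 \<rho>(2)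
      by (intro mult_left_mono) auto
    finally show ?thesis .
  qed
  have gi: "integrable (lborel \<Otimes>\<^sub>M lborel) (\<lambda>(y, x). g y x)"
  proof (rule lborel_pair.Fubini_integrable[OF gm])
    show "integrable lborel (\<lambda>y. LINT x|lborel. norm (case (y, x) of (y, x) \<Rightarrow> g y x))"
    proof (rule Bochner_Integration.integrable_bound)
      show "integrable lborel (\<lambda>y. \<rho> y * (B * (2 * ?N * ?V)))" using \<rho>i by simp
      show "AE y in lborel. norm (LINT x|lborel. norm (case (y, x) of (y, x) \<Rightarrow> g y x)) \<le> norm (\<rho> y * (B * (2 * ?N * ?V)))"
        using gnorm by (auto intro!: AE_I2 order_trans[OF _ abs_ge_self])
    qed measurable
    show "AE y in lborel. integrable lborel (\<lambda>x. case (y, x) of (y, x) \<Rightarrow> g y x)" using gx by simp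
  qed
  have inner: "(LINT y|lborel. g y x) = \<eta> x * ((s x - ?A x) \<bullet> v x)" for x
  proof -
    have i1: "integrable lborel (\<lambda>y. \<rho> y *\<^sub>R s (x - y))"
    proof (rule integrable_scaleR_bounded[of _ _ _ B'])
      show "integrable lborel (\<lambda>y. s (x - y))"
        using integrable_lborel_affine[OF sm, of "-1" x] si by simp
    qed (use B' in auto)
    have i2: "integrable lborel (\<lambda>y. \<rho> y *\<^sub>R s x)" using \<rho>i by simp
    have "s x - ?A x = (LINT y|lborel. \<rho> y *\<^sub>R s x) - (LINT y|lborel. \<rho> y *\<^sub>R s (x - y))"
      using \<rho>(3) \<rho>i by (simp add: average_def)
    also have "\<dots> = (LINT y|lborel. \<rho> y *\<^sub>R (s x - s (x - y)))"
      using i1 i2 by (simp add: scaleR_diff_right)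
    finally have e: "s x - ?A x = (LINT y|lborel. \<rho> y *\<^sub>R (s x - s (x - y)))" .
    have i3: "integrable lborel (\<lambda>y. \<rho> y *\<^sub>R (s x - s (x - y)))"
      using i1 i2 by (simp add: scaleR_diff_right)
    have "(LINT y|lborel. g y x) = (LINT y|lborel. \<eta> x * ((\<rho> y *\<^sub>R (s x - s (x - y))) \<bullet> v x))"
      unfolding g_def by (intro Bochner_Integration.integral_cong refl) (simp add: mult_ac)
    also have "\<dots> = \<eta> x * ((s x - ?A x) \<bullet> v x)"
      unfolding e Bochner_Integration.integral_mult_right_zero
      by (rule arg_cong[OF integral_inner_left]) (rule i3)
    finally show ?thesis .
  qed
  have outer: "\<bar>LINT x|lborel. g y x\<bar> \<le> \<rho> y * (B * ?N * (4 * \<epsilon> + h * ?V))" for y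
  proof (cases "norm y < h")
    case True
    have "\<bar>LINT x|lborel. \<eta> x * ((s x - s (x - y)) \<bullet> v x)\<bar> \<le> B * ?N * (4 * \<epsilon> + norm y * ?V)"
      by (rule shift_estimate[OF \<eta> B room K s div v \<open>\<epsilon> \<ge> 0\<close> curl]) (use True h in auto)
    also have "\<dots> \<le> B * ?N * (4 * \<epsilon> + h * ?V)"
      using True B0 by (intro mult_left_mono add_left_mono mult_right_mono) auto
    finally show ?thesis using \<rho>(2)[of y] by (simp add: g_def abs_mult mult_left_mono)
  next
    case False
    then show ?thesis using test_functionsD(5)[OF \<rho>(1), of y] by (simp add: g_def)
  qed
  note W2 = weighted_Holder(1)[OF conj_4_43(1-3) _ v _ B(1)]
  have "(LINT x|lborel. \<eta> x * (s x \<bullet> v x)) - (LINT x|lborel. \<eta> x * (?A x \<bullet> v x)) =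
      (LINT x|lborel. \<eta> x * (s x \<bullet> v x) - \<eta> x * (?A x \<bullet> v x))"
    by (rule Bochner_Integration.integral_diff[symmetric]; rule W2; simp add: s AL)
  also have "\<dots> = (LINT x|lborel. (LINT y|lborel. g y x))"
    unfolding inner by (simp add: inner_diff_left right_diff_distrib)
  also have "\<dots> = (LINT y|lborel. (LINT x|lborel. g y x))"
    by (rule lborel_pair.Fubini_integral[OF gi])
  finally have "\<bar>(LINT x|lborel. \<eta> x * (s x \<bullet> v x)) - (LINT x|lborel. \<eta> x * (?A x \<bullet> v x))\<bar> =
    norm (LINT y|lborel. (LINT x|lborel. g y x))" by simp
  also have "\<dots> \<le> (LINT y|lborel. \<rho> y * (B * ?N * (4 * \<epsilon> + h * ?V)))"
    by (rule norm_integral_le) (use \<rho>i outer in auto)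
  also have "\<dots> = B * ?N * (4 * \<epsilon> + h * ?V)" using \<rho>(3) by simp
  finally show ?thesis .
qed

text \<open>For a fixed kernel, \<rho>(x - z) is a test function in z, so weak convergence gives
  convergence of the mollifications at every point. They are uniformly bounded through the L^1
  bound, and on the support of \<eta> dominated convergence makes the convergence strong.\<close>

lemma mollified_weak_null:
  fixes s :: "nat \<Rightarrow> 'a::euclidean_space \<Rightarrow> 'b::euclidean_space"
  assumes s: "\<And>k. memL lborel p (s k)" "\<And>k x. x \<notin> ball 0 K \<Longrightarrow> s k x = 0" "\<And>k. nrm lborel p (s k) \<le> M" and p: "p > 1"
    and weak: "\<And>\<rho>. \<rho> \<in> test_functions UNIV \<Longrightarrow> (\<lambda>k. LINT x|lborel. \<rho> x *\<^sub>R s k x) \<longlonglongrightarrow> 0"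
    and \<rho>: "\<rho> \<in> test_functions (ball 0 h)"
    and \<eta>: "\<eta> \<in> test_functions \<omega>"
  shows "(\<lambda>k. nrm lborel p (\<lambda>x. \<eta> x *\<^sub>R average lborel \<rho> (\<lambda>y. y) (s k) x)) \<longlonglongrightarrow> 0"
proof -
  have sm [measurable]: "s k \<in> borel_measurable borel" for k using memL_measurable[OF s(1)] by simp
  note [measurable] = test_functions_measurable[OF \<eta>] test_functions_measurable[OF \<rho>]
  have em: "emeasure lborel (ball (0::'a) K) < \<infinity>" by (rule emeasure_lborel_ball_finite)
  define C where "C = measure lborel (ball (0::'a) K) powr (1 / 1 - 1 / p) * M"
  have s1: "memL lborel 1 (s k)" "nrm lborel 1 (s k) \<le> C" for k
  proof -
    show "memL lborel 1 (s k)" by (rule memL_finite_support(1)[OF _ p s(1) _ em]) (use s in auto)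
    have "nrm lborel 1 (s k) \<le> measure lborel (ball (0::'a) K) powr (1 / 1 - 1 / p) * nrm lborel p (s k)"
      by (rule memL_finite_support(2)[OF _ p s(1) _ em]) (use s in auto)
    also have "\<dots> \<le> C" unfolding C_def by (intro mult_left_mono s(3)) simp
    finally show "nrm lborel 1 (s k) \<le> C" .
  qed
  have si: "integrable lborel (\<lambda>x. norm (s k x))" for k using s1(1)[of k] by (simp add: memL_def)
  have sC: "(LINT x|lborel. norm (s k x)) \<le> C" for k using s1(2)[of k] by (simp add: nrm_def)
  obtain B where B: "B > 0" "\<And>x. norm (\<rho> x) \<le> B" using test_functions_bounded[OF \<rho>] by blast
  let ?A = "\<lambda>k x. average lborel \<rho> (\<lambda>y. y) (s k) x"
  have A: "?A k x = (LINT z|lborel. \<rho> (x - z) *\<^sub>R s k z)" for k x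
    by (rule average_eq_convolution) auto
  have lim: "(\<lambda>k. ?A k x) \<longlonglongrightarrow> 0" for x
    unfolding A by (rule weak[OF test_functions_reflect[OF \<rho>]]) simp
  have Ab: "norm (?A k x) \<le> B * C" for k x
  proof -
    have "norm (?A k x) \<le> (LINT z|lborel. B * norm (s k z))"
      unfolding A
    proof (rule norm_integral_le)
      show "integrable lborel (\<lambda>z. B * norm (s k z))" using si by simp
      show "AE z in lborel. norm (\<rho> (x - z) *\<^sub>R s k z) \<le> B * norm (s k z)"
        using B(2) by (auto intro!: AE_I2 mult_right_mono)
    qed
    also have "\<dots> \<le> B * C" using sC[of k] B(1) by (simp add: mult_left_mono)
    finally show ?thesis .
  qed
  have [measurable]: "?A k \<in> borel_measurable borel" for k
  proof -
    have "(\<lambda>x. LINT z|lborel. \<rho> (x - z) *\<^sub>R s k z) \<in> borel_measurable lborel"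
      by (rule lborel.borel_measurable_lebesgue_integral) measurable
    then show ?thesis unfolding A[abs_def] by simp
  qed
  show ?thesis
  proof (rule memL_dominated_null)
    show "integrable lborel (\<lambda>x. (B * C) powr p * norm (\<eta> x) powr p)"
      using memL_integrable[OF memL_test_functions[OF \<eta>, of p]] p by simp
    show "AE x in lborel. (\<lambda>k. \<eta> x *\<^sub>R ?A k x) \<longlonglongrightarrow> 0"
      using tendsto_scaleR[OF tendsto_const lim] by (intro AE_I2) (metis scaleR_zero_right)
    show "AE x in lborel. norm (\<eta> x *\<^sub>R ?A k x) powr p \<le> (B * C) powr p * norm (\<eta> x) powr p" for k
    proof (rule AE_I2)
      fix x
      have "norm (\<eta> x *\<^sub>R ?A k x) \<le> (B * C) * norm (\<eta> x)"
        using mult_left_mono[OF Ab[of k x] abs_ge_zero[of "\<eta> x"]] by (simp add: mult.commute)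
      then have "norm (\<eta> x *\<^sub>R ?A k x) powr p \<le> ((B * C) * norm (\<eta> x)) powr p"
        using p by (intro powr_mono2) auto
      then show "norm (\<eta> x *\<^sub>R ?A k x) powr p \<le> (B * C) powr p * norm (\<eta> x) powr p"
        by (simp add: powr_mult)
    qed
  qed (use p in auto)
qed

text \<open>Split s_k into its divergence correction R_k, of norm O(\<epsilon>_k), and the
  solenoidal rest s'_k; split s'_k further into s'_k minus its mollification, controlled by the
  shift estimate up to O(\<epsilon>_k + h), and the mollification. The mollified s_k tends to 0
  strongly for each fixed radius h.\<close>

lemma div_curl_lemma:
  fixes s v :: "nat \<Rightarrow> real^2 \<Rightarrow> real^2"
  assumes \<omega>: "open \<omega>" "\<omega> \<subseteq> ball 0 K" "K > 0" and \<eta>: "\<eta> \<in> test_functions \<omega>"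
    and s: "\<And>k. memL lborel (4/3) (s k)" "\<And>k x. x \<notin> \<omega> \<Longrightarrow> s k x = 0" "\<And>k. nrm lborel (4/3) (s k) \<le> M"
    and v: "\<And>k. memL lborel 4 (v k)" "\<And>k. nrm lborel 4 (v k) \<le> M"
    and weak: "\<And>\<rho>. \<rho> \<in> test_functions UNIV \<Longrightarrow> (\<lambda>k. LINT x|lborel. \<rho> x *\<^sub>R s k x) \<longlonglongrightarrow> 0"
    and \<epsilon>: "\<And>k. \<epsilon> k \<ge> 0" "\<epsilon> \<longlonglongrightarrow> 0"
    and div: "\<And>k \<phi>. \<phi> \<in> test_functions \<omega> \<Longrightarrow>
      \<bar>LINT x|lborel. s k x \<bullet> grad \<phi> x\<bar> \<le> \<epsilon> k * (nrm lborel 4 \<phi> + nrm lborel 4 (grad \<phi>))"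
    and curl: "\<And>k \<phi>. \<phi> \<in> test_functions \<omega> \<Longrightarrow>
      \<bar>LINT x|lborel. v k x \<bullet> perp (grad \<phi> x)\<bar> \<le> \<epsilon> k * (nrm lborel (4/3) \<phi> + nrm lborel (4/3) (grad \<phi>))"
  shows "(\<lambda>k. LINT x|lborel. \<eta> x * (s k x \<bullet> v k x)) \<longlonglongrightarrow> 0"
proof -
  note [measurable] = test_functions_measurable[OF \<eta>]
  have M0: "M \<ge> 0" using nrm_nonneg s(3) by (rule order_trans)
  define C where "C = 4 * K + 1"
  have C0: "C \<ge> 0" using \<omega>(3) by (simp add: C_def)
  have "\<forall>k. \<exists>R. memL lborel (4/3) R \<and> (\<forall>x. x \<notin> \<omega> \<longrightarrow> R x = 0) \<and> nrm lborel (4/3) R \<le> C * \<epsilon> k \<and>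
    (\<forall>\<phi>\<in>test_functions \<omega>. (LINT x|lborel. R x \<bullet> grad \<phi> x) = (LINT x|lborel. s k x \<bullet> grad \<phi> x))"
    unfolding C_def by (intro allI divergence_correction \<omega> s \<epsilon> div)
  from choice[OF this] obtain R where
    R: "\<And>k. memL lborel (4/3) (R k)" "\<And>k x. x \<notin> \<omega> \<Longrightarrow> R k x = 0" "\<And>k. nrm lborel (4/3) (R k) \<le> C * \<epsilon> k"
    and Rdiv: "\<And>k \<phi>. \<phi> \<in> test_functions \<omega> \<Longrightarrow> (LINT x|lborel. R k x \<bullet> grad \<phi> x) = (LINT x|lborel. s k x \<bullet> grad \<phi> x)"
    by blast
  define s' where "s' k x = s k x - R k x" for k x
  have s'L: "memL lborel (4/3) (s' k)" and s'N: "nrm lborel (4/3) (s' k) \<le> nrm lborel (4/3) (s k) + nrm lborel (4/3) (R k)" for k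
    unfolding s'_def[abs_def] using Minkowski_diff[OF _ s(1) R(1)] by auto
  have s'0: "s' k x = 0" if "x \<notin> \<omega>" for k x using s(2)[OF that] R(2)[OF that] by (simp add: s'_def)
  have s'div: "(LINT x|lborel. s' k x \<bullet> grad \<phi> x) = 0" if \<phi>: "\<phi> \<in> test_functions \<omega>" for k \<phi>
  proof -
    have g: "memL lborel 4 (grad \<phi>)" by (rule memL_test_functions[OF test_functions_grad[OF \<phi>]]) simp
    have "(LINT x|lborel. s' k x \<bullet> grad \<phi> x) = (LINT x|lborel. s k x \<bullet> grad \<phi> x) - (LINT x|lborel. R k x \<bullet> grad \<phi> x)"
      unfolding s'_def inner_diff_left
      by (rule Bochner_Integration.integral_diff) (rule Holder_inner(1)[OF conj_4_43(1-3) _ g]; rule s R)+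
    then show ?thesis using Rdiv[OF \<phi>] by simp
  qed
  obtain E where E: "\<And>k. \<epsilon> k \<le> E"
    using convergent_imp_Bseq[OF convergentI[OF \<epsilon>(2)]] by (auto simp: Bseq_def abs_le_iff)
  define M' where "M' = M + C * E"
  have s'M: "nrm lborel (4/3) (s' k) \<le> M'" for k
    using s'N[of k] s(3)[of k] R(3)[of k] mult_left_mono[OF E[of k] C0] unfolding M'_def by linarith
  have M'0: "M' \<ge> 0" using nrm_nonneg s'M by (rule order_trans)
  obtain B1 where B1: "\<And>x. norm (\<eta> x) \<le> B1" using test_functions_bounded[OF \<eta>] by blast
  obtain B2 where B2: "\<And>x. norm (grad \<eta> x) \<le> B2" using test_functions_bounded[OF test_functions_grad[OF \<eta>]] by blast
  define B where "B = max B1 B2"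
  have B: "\<And>x. \<bar>\<eta> x\<bar> \<le> B" "\<And>x. norm (grad \<eta> x) \<le> B"
    using B1 B2 by (auto simp: B_def le_max_iff_disj)
  have B0: "B \<ge> 0" using B(1) by (rule order_trans[OF abs_ge_zero])
  obtain r where r: "r > 0" "(\<Union>x\<in>closure {x. \<eta> x \<noteq> 0}. ball x r) \<subseteq> \<omega>"
    by (rule compact_subset_open_imp_ball_epsilon_subset[OF test_functionsD(2)[OF \<eta>] \<omega>(1) test_functionsD(3)[OF \<eta>]])
  define r0 where "r0 = r / 2"
  have r0: "r0 > 0" using r by (simp add: r0_def)
  have room: "ball x (2 * r0) \<subseteq> \<omega>" if "\<eta> x \<noteq> 0" for x
  proof -
    have "x \<in> closure {x. \<eta> x \<noteq> 0}" using that zero_outside_support[of x \<eta>] by blast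
    then show ?thesis using r(2) unfolding r0_def by auto
  qed
  note W = weighted_Holder[OF conj_4_43(1-3) _ v(1) _ B(1)]
  show ?thesis
  proof (rule LIMSEQ_I)
    fix e :: real assume "e > 0"
    \<comment> \<open>The radius depends on \<open>e\<close> and the uniform bounds only, not on
      \<open>k\<close>; the part of the error that does not tend to 0 with \<open>k\<close> is then
      at most e / 2.\<close>
    define h where "h = min (min 1 r0) (e / (2 * (B * M' * M + 1)))"
    have pos: "B * M' * M + 1 > 0" using B0 M'0 M0 by (simp add: add_nonneg_pos)
    have h: "h > 0" "h \<le> 1" "h \<le> r0" "h \<le> e / (2 * (B * M' * M + 1))"
      using r0 \<open>e > 0\<close> pos by (auto simp: h_def)
    have hB: "B * M' * (h * M) \<le> e / 2"
    proof -
      have "B * M' * (h * M) = (B * M' * M) * h" by (simp add: mult_ac)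
      also have "\<dots> \<le> (B * M' * M + 1) * h" using h(1) by (intro mult_right_mono) auto
      also have "\<dots> \<le> (B * M' * M + 1) * (e / (2 * (B * M' * M + 1)))"
        using pos by (intro mult_left_mono h(4)) auto
      also have "\<dots> = e / 2"
      proof -
        have "c * (e / (2 * c)) = e / 2" if "c > 0" for c :: real using that by simp
        then show ?thesis using pos by blast
      qed
      finally show ?thesis .
    qed
    obtain \<rho> :: "real^2 \<Rightarrow> real" where \<rho>: "\<rho> \<in> test_functions (ball 0 h)" "\<And>x. \<rho> x \<ge> 0" "(LINT x|lborel. \<rho> x) = 1"
      using bump_exists[OF h(1)] by blast
    note \<rho>i = test_functions_integrable[OF \<rho>(1)]
    let ?A = "average lborel \<rho> (\<lambda>y. y)"
    have AL: "memL lborel (4/3) (?A f)" and AN: "nrm lborel (4/3) (?A f) \<le> nrm lborel (4/3) f" if "memL lborel (4/3) f" for f :: "real^2 \<Rightarrow> real^2"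
      by (rule average_memL; use \<rho> \<rho>i that sigma_finite_lborel in simp)+
    have Adiff: "?A (s' k) x = ?A (s k) x - ?A (R k) x" for k x
    proof -
      obtain B' where B': "\<And>x. norm (\<rho> x) \<le> B'" using test_functions_bounded[OF \<rho>(1)] by blast
      note [measurable] = test_functions_measurable[OF \<rho>(1)]
      have i: "integrable lborel (\<lambda>y. \<rho> y *\<^sub>R f (x - y))" if f: "memL lborel (4/3) f" "\<And>x. x \<notin> \<omega> \<Longrightarrow> f x = 0" for f :: "real^2 \<Rightarrow> real^2"
      proof -
        have [measurable]: "f \<in> borel_measurable borel" using memL_measurable[OF f(1)] by simp
        have "integrable lborel f"
          using memL_finite_support(1)[of 1 "4/3" lborel f "ball 0 K"] f \<omega>(2) emeasure_lborel_ball_finite[of "0::real^2" K]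
          by (auto simp: memL_def integrable_norm_iff subset_iff)
        then have "integrable lborel (\<lambda>y. f (x - y))"
          using integrable_lborel_affine[of f "-1" x] by simp
        then show ?thesis by (rule integrable_scaleR_bounded[of _ _ _ B']) (use B' in auto)
      qed
      show ?thesis
        unfolding average_def s'_def scaleR_diff_right
        by (rule Bochner_Integration.integral_diff[OF i[OF s(1,2)] i[OF R(1,2)]])
    qed
    define n where "n k = nrm lborel (4/3) (\<lambda>x. \<eta> x *\<^sub>R ?A (s k) x)" for k
    have n: "n \<longlonglongrightarrow> 0"
      unfolding n_def
    proof (rule mollified_weak_null[OF s(1) _ s(3) _ weak \<rho>(1) \<eta>])
      show "s k x = 0" if "x \<notin> ball 0 K" for k x using that s(2) \<omega>(2) by blast
    qed simp
    \<comment> \<open>The errors that vanish as \<open>k\<close> grows: the curl of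
      \<open>v\<close>, the correction \<open>R\<close> and its mollification (whence the factor 2),
      and the mollified s_k.\<close>
    define U where "U k = B * M' * (4 * \<epsilon> k) + 2 * (B * (C * \<epsilon> k) * M) + n k * M" for k
    have "U \<longlonglongrightarrow> B * M' * (4 * 0) + 2 * (B * (C * 0) * M) + 0 * M"
      unfolding U_def by (intro tendsto_intros \<epsilon> n)
    then have "\<forall>\<^sub>F k in sequentially. U k < e / 2"
      using \<open>e > 0\<close> by (intro order_tendstoD(2)) auto
    then obtain k0 where k0: "\<And>k. k \<ge> k0 \<Longrightarrow> U k < e / 2" by (auto simp: eventually_sequentially)
    have "\<bar>LINT x|lborel. \<eta> x * (s k x \<bullet> v k x)\<bar> \<le> U k + B * M' * (h * M)" for k
    proof -
      have nv: "nrm lborel 4 (v k) \<le> M" by (rule v)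
      let ?I = "\<lambda>f. LINT x|lborel. \<eta> x * (f x \<bullet> v k x)"
      have 1: "\<bar>?I (s' k) - ?I (?A (s' k))\<bar> \<le> B * M' * (4 * \<epsilon> k + h * M)"
      proof -
        have "\<bar>?I (s' k) - ?I (?A (s' k))\<bar> \<le> B * nrm lborel (4/3) (s' k) * (4 * \<epsilon> k + h * nrm lborel 4 (v k))"
          by (rule averaged_shift_estimate[OF \<eta> B room r0 \<omega>(2) s'L s'0 s'div v(1) \<epsilon>(1) curl h(2,3) \<rho>])
        also have "\<dots> \<le> B * M' * (4 * \<epsilon> k + h * M)"
          using B0 M'0 \<epsilon>(1)[of k] h(1) s'M[of k] nv
          by (intro mult_mono add_mono mult_left_mono order_refl) auto
        finally show ?thesis .
      qed
      have RN: "B * nrm lborel (4/3) (R k) * nrm lborel 4 (v k) \<le> B * (C * \<epsilon> k) * M"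
        using B0 C0 \<epsilon>(1)[of k] by (intro mult_mono mult_left_mono R(3) nv) auto
      have 2: "\<bar>?I (R k)\<bar> \<le> B * (C * \<epsilon> k) * M"
        by (rule order_trans[OF W(2)[OF R(1)] RN]) simp
      have 3: "\<bar>?I (?A (R k))\<bar> \<le> B * (C * \<epsilon> k) * M"
      proof -
        have "\<bar>?I (?A (R k))\<bar> \<le> B * nrm lborel (4/3) (?A (R k)) * nrm lborel 4 (v k)"
          by (rule W(2)[OF AL[OF R(1)]]) simp
        also have "\<dots> \<le> B * nrm lborel (4/3) (R k) * nrm lborel 4 (v k)"
          using B0 AN[OF R(1)] by (intro mult_right_mono mult_left_mono) auto
        finally show ?thesis using RN by linarith
      qed
      have 4: "\<bar>?I (?A (s k))\<bar> \<le> n k * M"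
      proof -
        have m: "memL lborel (4/3) (\<lambda>x. \<eta> x *\<^sub>R ?A (s k) x)"
        proof (rule nrm_le_mult(1)[OF AL[OF s(1)] _ _ _ B0])
          have [measurable]: "?A (s k) \<in> borel_measurable borel" using memL_measurable[OF AL[OF s(1)]] by simp
          show "(\<lambda>x. \<eta> x *\<^sub>R ?A (s k) x) \<in> borel_measurable lborel" by measurable
          show "norm (\<eta> x *\<^sub>R ?A (s k) x) \<le> B * norm (?A (s k) x)" for x
            using B(1)[of x] by (simp add: mult_right_mono)
        qed simp
        have "\<bar>LINT x|lborel. (\<eta> x *\<^sub>R ?A (s k) x) \<bullet> v k x\<bar> \<le> n k * nrm lborel 4 (v k)"
          unfolding n_def by (rule Holder_inner(2)[OF conj_4_43(1-3) m v(1)])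
        also have "\<dots> \<le> n k * M" using nv by (intro mult_left_mono) (auto simp: n_def)
        finally show ?thesis by simp
      qed
      have 5: "?I (s k) = ?I (s' k) + ?I (R k)"
      proof -
        have "?I (s k) = (LINT x|lborel. \<eta> x * (s' k x \<bullet> v k x) + \<eta> x * (R k x \<bullet> v k x))"
          by (intro Bochner_Integration.integral_cong refl) (simp add: s'_def inner_diff_left algebra_simps)
        also have "\<dots> = ?I (s' k) + ?I (R k)"
          by (rule Bochner_Integration.integral_add; rule W(1)) (simp_all add: s'L R)
        finally show ?thesis .
      qed
      have 6: "?I (?A (s' k)) = ?I (?A (s k)) - ?I (?A (R k))"
      proof -
        have "?I (?A (s' k)) = (LINT x|lborel. \<eta> x * (?A (s k) x \<bullet> v k x) - \<eta> x * (?A (R k) x \<bullet> v k x))"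
          by (intro Bochner_Integration.integral_cong refl) (simp add: Adiff inner_diff_left algebra_simps)
        also have "\<dots> = ?I (?A (s k)) - ?I (?A (R k))"
          by (rule Bochner_Integration.integral_diff; rule W(1)) (simp_all add: AL s R)
        finally show ?thesis .
      qed
      have "B * M' * (4 * \<epsilon> k + h * M) = B * M' * (4 * \<epsilon> k) + B * M' * (h * M)" by (simp add: distrib_left)
      then show ?thesis using 1 2 3 4 5 6 unfolding U_def by linarith
    qed
    note bound = this
    have "\<bar>LINT x|lborel. \<eta> x * (s k x \<bullet> v k x)\<bar> < e" if "k \<ge> k0" for k
      using bound[of k] k0[OF that] hB by linarith
    then show "\<exists>no. \<forall>k\<ge>no. norm ((LINT x|lborel. \<eta> x * (s k x \<bullet> v k x)) - 0) < e" by auto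
  qed
qed

subsection \<open>The stress\<close>

text \<open>The cofactor matrix, which is the gradient of the determinant; see
  \<open>det_add_2\<close> for the exact expansion.\<close>

definition cof :: "real^2^2 \<Rightarrow> real^2^2" where
  "cof X = vector [vector [X $ 2 $ 2, - X $ 2 $ 1], vector [- X $ 1 $ 2, X $ 1 $ 1]]"

lemma cof_nth [simp]: "cof X $ 1 $ 1 = X $ 2 $ 2" "cof X $ 1 $ 2 = - X $ 2 $ 1"
  "cof X $ 2 $ 1 = - X $ 1 $ 2" "cof X $ 2 $ 2 = X $ 1 $ 1"
  by (simp_all add: cof_def)

lemma inner_22: "X \<bullet> Y = X $ 1 $ 1 * Y $ 1 $ 1 + X $ 1 $ 2 * Y $ 1 $ 2 + X $ 2 $ 1 * Y $ 2 $ 1 + X $ 2 $ 2 * Y $ 2 $ 2"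
  for X Y :: "real^2^2"
  by (simp add: inner_vec_def sum_2)

lemma norm_cof [simp]: "norm (cof X) = norm X"
  by (simp add: norm_eq_sqrt_inner inner_22 add_ac)

lemma det_add_2: "det (X + Y) = det X + cof X \<bullet> Y + det Y" for X Y :: "real^2^2"
  by (simp add: det_2 inner_22 algebra_simps)

lemma cof_add_inner: "cof (X + Y) \<bullet> Y = cof X \<bullet> Y + 2 * det Y" for X Y :: "real^2^2"
  by (simp add: det_2 inner_22 algebra_simps)

lemma abs_det_le: "\<bar>det X\<bar> \<le> (norm X)\<^sup>2 / 2" for X :: "real^2^2"
proof -
  have "\<bar>x * w - y * z\<bar> \<le> (x * x + y * y + z * z + w * w) / 2" for x y z w :: real
  proof (rule abs_leI)
    show "x * w - y * z \<le> (x * x + y * y + z * z + w * w) / 2"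
      using zero_le_power2[of "x - w"] zero_le_power2[of "y + z"] by (simp add: power2_eq_square field_simps)
    show "- (x * w - y * z) \<le> (x * x + y * y + z * z + w * w) / 2"
      using zero_le_power2[of "x + w"] zero_le_power2[of "y - z"] by (simp add: power2_eq_square field_simps)
  qed
  then show ?thesis by (simp add: det_2 power2_norm_eq_inner inner_22)
qed

lemma continuous_on_cof [continuous_intros]: "continuous_on S f \<Longrightarrow> continuous_on S (\<lambda>x. cof (f x))"
proof -
  have "linear cof" by (rule linearI) (simp_all add: vec_eq_iff forall_2)
  then have "continuous_on UNIV cof" by (simp add: linear_continuous_on linear_conv_bounded_linear)
  then show "continuous_on S f \<Longrightarrow> continuous_on S (\<lambda>x. cof (f x))"
    by (rule continuous_on_compose2) auto
qed

lemma continuous_on_det_2 [continuous_intros]: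
  fixes f :: "'a::topological_space \<Rightarrow> real^2^2"
  shows "continuous_on S f \<Longrightarrow> continuous_on S (\<lambda>x. det (f x))"
  by (simp add: det_2 continuous_intros)

definition stress :: "real \<Rightarrow> (real \<Rightarrow> real) \<Rightarrow> real^2^2 \<Rightarrow> real^2^2" where
  "stress a \<gamma> X = X + (a * (norm X)\<^sup>2) *\<^sub>R X + \<gamma> (det X) *\<^sub>R cof X"

lemma grad_W2:
  assumes "\<And>t. (g has_real_derivative \<gamma> t) (at t)"
  shows "grad (W2 a g) X = stress a \<gamma> X"
proof (rule grad_eqI)
  have n: "((\<lambda>X. (norm X)\<^sup>2) has_derivative (\<lambda>h. h \<bullet> (2 *\<^sub>R X))) (at X)"
    unfolding power2_norm_eq_inner by (auto intro!: derivative_eq_intros simp: inner_commute)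
  have n4: "((\<lambda>X. (norm X) ^ 4) has_derivative (\<lambda>h. h \<bullet> ((4 * (norm X)\<^sup>2) *\<^sub>R X))) (at X)"
  proof -
    have "((\<lambda>X. ((norm X)\<^sup>2)\<^sup>2) has_derivative (\<lambda>h. h \<bullet> ((4 * (norm X)\<^sup>2) *\<^sub>R X))) (at X)"
      by (rule derivative_eq_intros n refl)+ (auto simp: fun_eq_iff)
    then show ?thesis by (simp flip: power_mult)
  qed
  have nth: "((\<lambda>X::real^2^2. X $ i $ j) has_derivative (\<lambda>h. h $ i $ j)) (at X)" for i j
    by (intro bounded_linear_imp_has_derivative bounded_linear_compose[OF bounded_linear_vec_nth bounded_linear_vec_nth])
  have "((\<lambda>X::real^2^2. det X) has_derivative (\<lambda>h. h \<bullet> cof X)) (at X)"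
    unfolding det_2 by (rule derivative_eq_intros nth refl)+ (auto simp: fun_eq_iff inner_22)
  from diff_chain_at[OF this assms[THEN has_field_derivative_imp_has_derivative]]
  have gd: "((\<lambda>X. g (det X)) has_derivative (\<lambda>h. h \<bullet> (\<gamma> (det X) *\<^sub>R cof X))) (at X)"
    by (simp add: o_def)
  show "GDERIV (W2 a g) X :> stress a \<gamma> X"
    unfolding gderiv_def W2_def[abs_def] stress_def
    by (rule derivative_eq_intros n n4 gd refl)+ (auto simp: fun_eq_iff inner_add_right)
qed

text \<open>The term \<open>\<gamma> (det F) * det G\<close> is a null Lagrangian when \<open>F\<close> is constant and \<open>G\<close> a gradient.\<close>

definition gap :: "real \<Rightarrow> (real \<Rightarrow> real) \<Rightarrow> real^2^2 \<Rightarrow> real^2^2 \<Rightarrow> real" where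
  "gap a \<gamma> F G = (stress a \<gamma> (F + G) - stress a \<gamma> F) \<bullet> G - \<gamma> (det F) * det G"

text \<open>With H = F + G, the product (|H|^2 H - |F|^2 F) . (H - F) is half of (|H|^2 + |F|^2) |H
  - F|^2 + (|H|^2 - |F|^2)^2. The determinant terms are regrouped by means of cof F . G = det H -
  det F - det G, which isolates the product that monotonicity makes nonnegative.\<close>

lemma gap_eq:
  "gap a \<gamma> F G = (norm G)\<^sup>2 +
    a / 2 * (((norm (F + G))\<^sup>2 + (norm F)\<^sup>2) * (norm G)\<^sup>2 + ((norm (F + G))\<^sup>2 - (norm F)\<^sup>2)\<^sup>2) +
    (\<gamma> (det (F + G)) - \<gamma> (det F)) * (det (F + G) - det F) + \<gamma> (det (F + G)) * det G"
proof -
  let ?f = "F \<bullet> F" and ?c = "F \<bullet> G" and ?n = "G \<bullet> G"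
  have h: "(F + G) \<bullet> (F + G) = ?f + 2 * ?c + ?n"
    by (simp add: inner_simps inner_commute)
  have c: "cof F \<bullet> G = det (F + G) - det F - det G" by (simp add: det_add_2)
  have "gap a \<gamma> F G = ?n + a * (((F + G) \<bullet> (F + G)) * (?c + ?n) - ?f * ?c) +
      \<gamma> (det (F + G)) * (cof F \<bullet> G + 2 * det G) - \<gamma> (det F) * (cof F \<bullet> G) - \<gamma> (det F) * det G"
    unfolding gap_def stress_def power2_norm_eq_inner
    by (simp add: inner_diff_left inner_add_left cof_add_inner[unfolded inner_add_left] algebra_simps)
  then show ?thesis
    unfolding power2_norm_eq_inner h c by (simp add: power2_eq_square field_simps)
qed

section \<open>Positivity and coercivity of the gap\<close>

context
  fixes a b d :: real and \<gamma> :: "real \<Rightarrow> real"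
  assumes a: "a > 0" and bd: "b \<le> 2" "d \<le> 3 * a" "b \<ge> 0" "d \<ge> 0"
    and growth: "\<And>t. \<bar>\<gamma> t\<bar> \<le> b + d * \<bar>t\<bar>"
    and mono: "\<And>s t. 0 \<le> (\<gamma> s - \<gamma> t) * (s - t)"
    and cont: "continuous_on UNIV \<gamma>"
begin

text \<open>Here the thresholds on \<open>b\<close> and \<open>d\<close> enter: (2 + 3 a r^2 / 2)
  m^2 / 2 equals m^2 + (3/4) a r^2 m^2, and the summand m^2 is precisely the quadratic term
  available in \<open>gap_eq\<close>.\<close>

lemma gamma_mult_bound:
  assumes "\<bar>t\<bar> \<le> r\<^sup>2 / 2" "\<bar>u\<bar> \<le> m\<^sup>2 / 2"
  shows "- m\<^sup>2 - 3 / 4 * a * r\<^sup>2 * m\<^sup>2 \<le> \<gamma> t * u"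
proof -
  have "\<bar>\<gamma> t\<bar> \<le> 2 + 3 * a * (r\<^sup>2 / 2)"
    using growth[of t] mult_mono[OF bd(2) assms(1)] a bd(1) by simp
  then have "\<bar>\<gamma> t * u\<bar> \<le> (2 + 3 * a * (r\<^sup>2 / 2)) * (m\<^sup>2 / 2)"
    unfolding abs_mult using assms(2) by (intro mult_mono) auto
  also have "\<dots> = m\<^sup>2 + 3 / 4 * a * r\<^sup>2 * m\<^sup>2" by (simp add: algebra_simps)
  finally show ?thesis by linarith
qed

text \<open>The monotone product is dropped and the quadratic terms cancel. The right-hand side is
  the quartic part of \<open>gap_eq\<close> minus (3/4) a |F + G|^2 |G|^2.\<close>

lemma gap_lower:
  "gap a \<gamma> F G \<ge> a / 4 * ((2 * (norm F)\<^sup>2 - (norm (F + G))\<^sup>2) * (norm G)\<^sup>2 + 2 * ((norm (F + G))\<^sup>2 - (norm F)\<^sup>2)\<^sup>2)"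
  using gamma_mult_bound[OF abs_det_le[of "F + G"] abs_det_le[of G]] mono[of "det (F + G)" "det F"]
  unfolding gap_eq by (simp add: algebra_simps)

text \<open>Under the last assumption the coefficient of n^2 is not positive, so the worst case is
  equality n = h + f in the triangle inequality. There the expression is a perfect square.\<close>

lemma quartic_lower:
  fixes f h n :: real
  assumes "f \<ge> 0" "h \<ge> 0" "0 \<le> n" "n \<le> h + f" "2 * f\<^sup>2 \<le> h\<^sup>2"
  shows "((h + f) * (h - 2 * f))\<^sup>2 \<le> (2 * f\<^sup>2 - h\<^sup>2) * n\<^sup>2 + 2 * (h\<^sup>2 - f\<^sup>2)\<^sup>2"
proof -
  have "n\<^sup>2 \<le> (h + f)\<^sup>2" using assms by (intro power_mono) auto
  then have "(2 * f\<^sup>2 - h\<^sup>2) * (h + f)\<^sup>2 \<le> (2 * f\<^sup>2 - h\<^sup>2) * n\<^sup>2"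
    using assms(5) by (intro mult_left_mono_neg) auto
  moreover have "((h + f) * (h - 2 * f))\<^sup>2 = (2 * f\<^sup>2 - h\<^sup>2) * (h + f)\<^sup>2 + 2 * (h\<^sup>2 - f\<^sup>2)\<^sup>2"
    by (simp add: power2_eq_square algebra_simps)
  ultimately show ?thesis by linarith
qed

text \<open>If h^2 < 2 f^2 the first term is positive. Otherwise the square from
  \<open>quartic_lower\<close> vanishes only for h = 2 f, where n < h + f = 3 f leaves a strict
  gain.\<close>

lemma quartic_pos:
  fixes f h n :: real
  assumes "f \<ge> 0" "h \<ge> 0" "0 < n" "n \<le> h + f" and ne: "\<not> (h = 2 * f \<and> n = 3 * f)"
  shows "0 < (2 * f\<^sup>2 - h\<^sup>2) * n\<^sup>2 + 2 * (h\<^sup>2 - f\<^sup>2)\<^sup>2"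
proof (cases "h\<^sup>2 < 2 * f\<^sup>2")
  case True
  then show ?thesis using assms(3) by (intro add_pos_nonneg mult_pos_pos) auto
next
  case False
  have hf: "h + f > 0" using assms by linarith
  show ?thesis
  proof (cases "h = 2 * f")
    case True
    have "n < 3 * f" using ne True assms(4) by simp
    then have "n\<^sup>2 < (3 * f)\<^sup>2" using assms(3) by (intro power_strict_mono) auto
    moreover have "f > 0" using hf True by simp
    ultimately have "f\<^sup>2 * n\<^sup>2 < f\<^sup>2 * (3 * f)\<^sup>2" by (intro mult_strict_left_mono) auto
    then show ?thesis unfolding True by (simp add: power2_eq_square algebra_simps)
  next
    case neq: False
    have "0 < ((h + f) * (h - 2 * f))\<^sup>2" using hf neq by simp
    also have "\<dots> \<le> (2 * f\<^sup>2 - h\<^sup>2) * n\<^sup>2 + 2 * (h\<^sup>2 - f\<^sup>2)\<^sup>2"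
      using assms False by (intro quartic_lower) auto
    finally show ?thesis .
  qed
qed

text \<open>The quartic part of the lower bound degenerates only at \<open>G = - 3 F\<close>; there, monotonicity of
  \<open>\<gamma>\<close> bounds \<open>\<gamma> (det (F + G)) * det G\<close> by the smaller quantity \<open>\<gamma> (det F) * det G\<close>.\<close>

lemma gap_pos:
  assumes "G \<noteq> 0"
  shows "gap a \<gamma> F G > 0"
proof (cases "norm (F + G) = 2 * norm F \<and> norm G = 3 * norm F")
  case False
  have "norm G \<le> norm (F + G) + norm F" using norm_triangle_ineq4[of "F + G" F] by simp
  then have "0 < (2 * (norm F)\<^sup>2 - (norm (F + G))\<^sup>2) * (norm G)\<^sup>2 + 2 * ((norm (F + G))\<^sup>2 - (norm F)\<^sup>2)\<^sup>2"
    using assms False by (intro quartic_pos) auto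
  then have "0 < a / 4 * ((2 * (norm F)\<^sup>2 - (norm (F + G))\<^sup>2) * (norm G)\<^sup>2 + 2 * ((norm (F + G))\<^sup>2 - (norm F)\<^sup>2)\<^sup>2)"
    using a by simp
  then show ?thesis using gap_lower[of F G] by linarith
next
  case True
  let ?f = "norm F"
  have f: "?f > 0" using assms True by auto
  have n: "norm (F + G) = 2 * ?f" "norm G = 3 * ?f" using True by auto
  have "(norm (F + G))\<^sup>2 = ?f\<^sup>2 + 2 * (F \<bullet> G) + (norm G)\<^sup>2"
    by (simp add: power2_norm_eq_inner inner_simps inner_commute)
  then have FG: "F \<bullet> G = - 3 * ?f\<^sup>2" unfolding n by (simp add: power_mult_distrib)
  \<comment> \<open>Equality holds in the triangle inequality for the norms of G, F + G and F, so
    the vectors are aligned and \<open>G\<close> is determined.\<close>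
  have "(norm (G + 3 *\<^sub>R F))\<^sup>2 = (norm G)\<^sup>2 + 6 * (F \<bullet> G) + 9 * ?f\<^sup>2"
    by (simp add: power2_norm_eq_inner inner_simps inner_commute)
  also have "\<dots> = 0" unfolding FG n by (simp add: power_mult_distrib)
  finally have G: "G = - 3 *\<^sub>R F" by (simp add: eq_neg_iff_add_eq_0)
  have d1: "det (F + G) = 4 * det F" and d2: "det G = 9 * det F"
    unfolding G by (simp_all add: det_2 algebra_simps)
  let ?p = "det F" and ?g0 = "\<gamma> (det F)" and ?g1 = "\<gamma> (4 * det F)"
  have m: "0 \<le> (?g1 - ?g0) * (3 * ?p)" using mono[of "4 * ?p" ?p] by simp
  have "- ?f\<^sup>2 - 3 / 4 * a * ?f\<^sup>2 * ?f\<^sup>2 \<le> ?g0 * ?p"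
    by (rule gamma_mult_bound[OF abs_det_le abs_det_le])
  \<comment> \<open>The term with det G = 9 det F is split into a multiple of the monotone product
    and 9 times \<open>?g0 * ?p\<close>. After the lower bound for the latter, the quadratic terms
    cancel and (81/4) a |F|^4 remains.\<close>
  moreover have "gap a \<gamma> F G = 9 * ?f\<^sup>2 + 27 * (a * ?f\<^sup>2 * ?f\<^sup>2) + 4 * ((?g1 - ?g0) * (3 * ?p)) + 9 * (?g0 * ?p)"
    unfolding gap_eq d1 d2 n by (simp add: power2_eq_square algebra_simps)
  moreover have "a * ?f\<^sup>2 * ?f\<^sup>2 > 0" using a f by simp
  ultimately show ?thesis using m by linarith
qed

lemma gap_0: "gap a \<gamma> F 0 = 0"
  by (simp add: gap_def det_2)

lemma gap_nonneg: "gap a \<gamma> F G \<ge> 0"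
  using gap_pos[of G F] gap_0[of F] by (cases "G = 0") auto

text \<open>For |F| <= |F + G| / 4 the perfect square of \<open>quartic_lower\<close> is at least (h
  * h / 2)^2 with h = |F + G|; the factor a / 4 of \<open>gap_lower\<close> makes this a / 16 times
  h^4.\<close>

lemma gap_coercive:
  assumes "4 * norm F \<le> norm (F + G)"
  shows "a / 16 * norm (F + G) ^ 4 \<le> gap a \<gamma> F G"
proof -
  let ?f = "norm F" and ?h = "norm (F + G)"
  have n: "norm G \<le> ?h + ?f" using norm_triangle_ineq4[of "F + G" F] by simp
  have "2 * ?f\<^sup>2 \<le> ?h\<^sup>2"
  proof -
    have "16 * ?f\<^sup>2 \<le> ?h\<^sup>2" using power_mono[OF assms, of 2] by (simp add: power_mult_distrib)
    moreover have "0 \<le> ?f\<^sup>2" by simp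
    ultimately show ?thesis by linarith
  qed
  then have q: "((?h + ?f) * (?h - 2 * ?f))\<^sup>2 \<le> (2 * ?f\<^sup>2 - ?h\<^sup>2) * (norm G)\<^sup>2 + 2 * (?h\<^sup>2 - ?f\<^sup>2)\<^sup>2"
    using n by (intro quartic_lower) auto
  have "?h * (?h / 2) \<le> (?h + ?f) * (?h - 2 * ?f)"
    using assms by (intro mult_mono) auto
  then have "(?h * (?h / 2))\<^sup>2 \<le> ((?h + ?f) * (?h - 2 * ?f))\<^sup>2" by (intro power_mono) auto
  then have "?h ^ 4 / 4 \<le> ((?h + ?f) * (?h - 2 * ?f))\<^sup>2"
    by (simp add: power2_eq_square power4_eq_xxxx)
  then have "a / 4 * (?h ^ 4 / 4) \<le> a / 4 * ((2 * ?f\<^sup>2 - ?h\<^sup>2) * (norm G)\<^sup>2 + 2 * (?h\<^sup>2 - ?f\<^sup>2)\<^sup>2)"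
    using q a by (intro mult_left_mono) auto
  then show ?thesis using gap_lower[of F G] by simp
qed

lemma continuous_on_stress [continuous_intros]:
  "continuous_on S X \<Longrightarrow> continuous_on S (\<lambda>x. stress a \<gamma> (X x))"
  unfolding stress_def
  by (intro continuous_intros continuous_on_compose2[OF cont]) auto

lemma continuous_on_gap [continuous_intros]:
  "continuous_on S X \<Longrightarrow> continuous_on S Y \<Longrightarrow> continuous_on S (\<lambda>x. gap a \<gamma> (X x) (Y x))"
  unfolding gap_def
  by (intro continuous_intros continuous_on_compose2[OF cont]) auto

lemma norm_stress_le: "norm (stress a \<gamma> X) \<le> norm X + a * norm X ^ 3 + (b + d * (norm X)\<^sup>2) * norm X"
proof -
  have "\<bar>\<gamma> (det X)\<bar> \<le> b + d * (norm X)\<^sup>2"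
    using growth[of "det X"] mult_left_mono[OF abs_det_le[of X] bd(4)] mult_nonneg_nonneg[OF bd(4), of "(norm X)\<^sup>2"] by simp
  then have "norm (\<gamma> (det X) *\<^sub>R cof X) \<le> (b + d * (norm X)\<^sup>2) * norm X" by (simp add: mult_right_mono)
  moreover have "norm ((a * (norm X)\<^sup>2) *\<^sub>R X) = a * norm X ^ 3"
    using a by (simp add: abs_mult power2_eq_square power3_eq_cube)
  ultimately show ?thesis
    unfolding stress_def using norm_triangle_ineq[of "X + (a * (norm X)\<^sup>2) *\<^sub>R X" "\<gamma> (det X) *\<^sub>R cof X"]
      norm_triangle_ineq[of X "(a * (norm X)\<^sup>2) *\<^sub>R X"] by linarith
qed

text \<open>For large F + G the cubic growth of the stress is beaten by the quartic gap. On the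
  remaining set where the difference is at least \<delta>, which is compact and avoids G = 0, the
  gap has a positive minimum. Near G = 0 both sides vanish, possibly at different rates, and
  \<delta> absorbs this.\<close>

lemma stress_diff_le_gap:
  assumes "\<delta> > 0"
  shows "\<exists>C\<ge>0. \<forall>G. norm (stress a \<gamma> (F + G) - stress a \<gamma> F) \<le> \<delta> + C * gap a \<gamma> F G"
proof -
  let ?N = "\<lambda>G. norm (stress a \<gamma> (F + G) - stress a \<gamma> F)"
  define R where "R = max 1 (4 * norm F)"
  define C1 where "C1 = (1 + a + b + d + norm (stress a \<gamma> F)) * (16 / a)"
  have C1: "C1 \<ge> 0" using a bd by (simp add: C1_def)
  have big: "?N G \<le> C1 * gap a \<gamma> F G" if "norm (F + G) > R" for G
  proof -
    let ?h = "norm (F + G)"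
    have h: "1 \<le> ?h" "4 * norm F \<le> ?h" using that by (auto simp: R_def)
    have p: "?h \<le> ?h ^ 4" "?h ^ 3 \<le> ?h ^ 4" "1 \<le> ?h ^ 4"
      using power_increasing[OF _ h(1), of 1 4] power_increasing[OF _ h(1), of 3 4] one_le_power[OF h(1), of 4] by auto
    have "?N G \<le> norm (stress a \<gamma> (F + G)) + norm (stress a \<gamma> F)" by (rule norm_triangle_ineq4)
    also have "\<dots> \<le> ?h + a * ?h ^ 3 + (b * ?h + d * ?h ^ 3) + norm (stress a \<gamma> F)"
      using norm_stress_le[of "F + G"] by (simp add: power2_eq_square power3_eq_cube algebra_simps)
    also have "\<dots> \<le> ?h ^ 4 + a * ?h ^ 4 + (b * ?h ^ 4 + d * ?h ^ 4) + norm (stress a \<gamma> F) * ?h ^ 4"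
      using p a bd mult_left_mono[OF p(3), of "norm (stress a \<gamma> F)"] by (intro add_mono mult_left_mono) auto
    also have "\<dots> = C1 * (a / 16 * ?h ^ 4)" using a by (simp add: C1_def field_simps)
    also have "\<dots> \<le> C1 * gap a \<gamma> F G" by (intro mult_left_mono gap_coercive h C1)
    finally show ?thesis .
  qed
  define S where "S = {G. norm (F + G) \<le> R \<and> \<delta> \<le> ?N G}"
  have "\<exists>C2\<ge>0. \<forall>G\<in>S. ?N G \<le> C2 * gap a \<gamma> F G"
  proof (cases "S = {}")
    case False
    have "closed S" unfolding S_def
      by (intro closed_Collect_conj closed_Collect_le continuous_intros)
    moreover have "bounded S"
    proof (rule boundedI)
      fix G assume "G \<in> S"
      then show "norm G \<le> R + norm F" using norm_triangle_ineq4[of "F + G" F] by (simp add: S_def)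
    qed
    ultimately have S: "compact S" by (simp add: compact_eq_bounded_closed)
    obtain G0 where G0: "G0 \<in> S" "\<And>G. G \<in> S \<Longrightarrow> gap a \<gamma> F G0 \<le> gap a \<gamma> F G"
      using continuous_attains_inf[OF S False continuous_on_gap[OF continuous_on_const continuous_on_id], of F] by auto
    have "continuous_on S ?N" by (intro continuous_intros)
    then obtain G1 where G1: "G1 \<in> S" "\<And>G. G \<in> S \<Longrightarrow> ?N G \<le> ?N G1"
      using continuous_attains_sup[OF S False, of ?N] by auto
    have "G0 \<noteq> 0" using G0(1) assms by (auto simp: S_def)
    then have e0: "gap a \<gamma> F G0 > 0" by (rule gap_pos)
    show ?thesis
    proof (intro exI[of _ "?N G1 / gap a \<gamma> F G0"] conjI ballI)
      fix G assume G: "G \<in> S"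
      have "?N G \<le> ?N G1 / gap a \<gamma> F G0 * gap a \<gamma> F G0" using G1(2)[OF G] e0 by simp
      also have "\<dots> \<le> ?N G1 / gap a \<gamma> F G0 * gap a \<gamma> F G" using e0 by (intro mult_left_mono G0(2) G) auto
      finally show "?N G \<le> ?N G1 / gap a \<gamma> F G0 * gap a \<gamma> F G" .
    qed (use e0 in auto)
  qed auto
  then obtain C2 where C2: "C2 \<ge> 0" "\<And>G. G \<in> S \<Longrightarrow> ?N G \<le> C2 * gap a \<gamma> F G" by blast
  show ?thesis
  proof (intro exI[of _ "C1 + C2"] conjI allI)
    fix G
    have g: "0 \<le> C1 * gap a \<gamma> F G" "0 \<le> C2 * gap a \<gamma> F G" using C1 C2(1) gap_nonneg by auto
    consider "norm (F + G) > R" | "G \<in> S" | "?N G < \<delta>" unfolding S_def mem_Collect_eq by linarith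
    then have "?N G \<le> \<delta> + (C1 * gap a \<gamma> F G + C2 * gap a \<gamma> F G)"
      using big[of G] C2(2)[of G] g assms by cases linarith+
    then show "?N G \<le> \<delta> + (C1 + C2) * gap a \<gamma> F G" by (simp add: distrib_right)
  qed (use C1 C2 in auto)
qed

end

lemma integral_lebesgue_on_eq_lborel:
  fixes f :: "'a::euclidean_space \<Rightarrow> 'b::{banach, second_countable_topology}"
  assumes "f \<in> borel_measurable borel" "\<And>x. x \<notin> \<omega> \<Longrightarrow> f x = 0" "open \<omega>"
  shows "(LINT x|lebesgue_on \<omega>. f x) = (LINT x|lborel. f x)"
    and "integrable (lebesgue_on \<omega>) f \<longleftrightarrow> integrable lborel f"
proof -
  have m: "\<omega> \<inter> space lebesgue \<in> sets lebesgue" using assms(3) by simp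
  have eq: "(\<lambda>x. indicator \<omega> x *\<^sub>R f x) = f" using assms(2) by (auto simp: fun_eq_iff indicator_def)
  show "(LINT x|lebesgue_on \<omega>. f x) = (LINT x|lborel. f x)"
    unfolding integral_restrict_space[OF m] eq by (rule integral_completion) (use assms in simp)
  show "integrable (lebesgue_on \<omega>) f \<longleftrightarrow> integrable lborel f"
    unfolding integrable_restrict_space[OF m] eq by (rule integrable_completion) (use assms in simp)
qed

subsection \<open>Strict quasimonotonicity\<close>

lemma jacobian_nth:
  fixes \<phi> :: "real^2 \<Rightarrow> real^2"
  assumes "\<phi> \<in> test_functions \<omega>"
  shows "jacobian \<phi> (at x) $ i $ j = frechet_derivative (\<lambda>x. \<phi> x $ i) (at x) (axis j 1)"
  using frechet_derivative_linear_compose[OF test_functionsD(7)[OF assms] bounded_linear_vec_nth, of i x "axis j 1"]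
  by (simp add: jacobian_def matrix_def)

lemma jacobian_test_functions:
  fixes \<phi> :: "real^2 \<Rightarrow> real^2"
  assumes "\<phi> \<in> test_functions \<omega>"
  shows "continuous_on UNIV (\<lambda>x. jacobian \<phi> (at x))"
    and "x \<notin> closure {x. \<phi> x \<noteq> 0} \<Longrightarrow> jacobian \<phi> (at x) = 0"
proof -
  have eq: "(\<lambda>x. jacobian \<phi> (at x)) = (\<lambda>x. \<chi> i j. frechet_derivative \<phi> (at x) (axis j 1) $ i)"
    by (simp add: jacobian_def matrix_def)
  show "continuous_on UNIV (\<lambda>x. jacobian \<phi> (at x))"
    unfolding eq
    by (intro continuous_on_vec_lambda continuous_on_component test_functionsD(6)[OF test_functions_derivative[OF assms]])
  show "jacobian \<phi> (at x) = 0" if "x \<notin> closure {x. \<phi> x \<noteq> 0}"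
    using frechet_derivative_zero_outside[OF that] by (simp add: jacobian_def matrix_def vec_eq_iff)
qed

text \<open>The determinant is a difference of two products of mixed partial derivatives of the
  components, whose integrals agree by \<open>integral_mixed_partials\<close>.\<close>

lemma integral_det_jacobian:
  fixes \<phi> :: "real^2 \<Rightarrow> real^2"
  assumes "\<phi> \<in> test_functions \<omega>"
  shows "(LINT x|lborel. det (jacobian \<phi> (at x))) = 0"
proof -
  have c: "(\<lambda>x. \<phi> x $ i) \<in> test_functions \<omega>" for i
    by (rule test_functions_compose_linear[OF assms bounded_linear_vec_nth])
  let ?D = "\<lambda>i j x. frechet_derivative (\<lambda>x. \<phi> x $ i) (at x) (axis j 1)"
  have i: "integrable lborel (\<lambda>x. ?D i j x * ?D k l x)" for i j k l
    by (rule test_functions_integrable[OF test_functions_mult[OF test_functions_derivative[OF c] test_functionsD(1)[OF test_functions_derivative[OF c]]]])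
  have "(LINT x|lborel. det (jacobian \<phi> (at x))) = (LINT x|lborel. ?D 1 1 x * ?D 2 2 x - ?D 1 2 x * ?D 2 1 x)"
    by (simp add: det_2 jacobian_nth[OF assms])
  also have "\<dots> = (LINT x|lborel. ?D 1 1 x * ?D 2 2 x) - (LINT x|lborel. ?D 1 2 x * ?D 2 1 x)"
    by (rule Bochner_Integration.integral_diff; rule i)
  also have "\<dots> = 0" using integral_mixed_partials[OF c c, of 1 "axis 1 1" 2 "axis 2 1"] by simp
  finally show ?thesis .
qed

lemma strictly_quasimonotone_stress:
  assumes a: "a > 0" and bd: "b \<le> 2" "d \<le> 3 * a" "b \<ge> 0" "d \<ge> 0"
    and growth: "\<And>t. \<bar>\<gamma> t\<bar> \<le> b + d * \<bar>t\<bar>"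
    and mono: "\<And>s t. 0 \<le> (\<gamma> s - \<gamma> t) * (s - t)"
    and cont: "continuous_on UNIV \<gamma>"
  shows "strictly_quasimonotone (stress a \<gamma>)"
proof -
  note assms = a bd growth mono cont
  note cs = continuous_on_stress[OF assms] and cg = continuous_on_gap[OF assms]
  have cT: "continuous_on UNIV (stress a \<gamma>)" using cs[OF continuous_on_id] by simp
  show ?thesis
    unfolding strictly_quasimonotone_def
  proof (intro conjI exI[of _ "\<lambda>(F, G). gap a \<gamma> F G"] allI ballI impI)
    show "stress a \<gamma> \<in> borel_measurable borel" by (rule borel_measurable_continuous_onI[OF cT])
    show "locally_bounded (stress a \<gamma>)"
      unfolding locally_bounded_def
    proof (intro allI exI conjI)
      fix X :: "real^2^2"
      show "open (ball X 1)" "X \<in> ball X 1" by auto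
      have "compact (stress a \<gamma> ` cball X 1)"
        by (intro compact_continuous_image continuous_on_subset[OF cT]) auto
      then show "bounded (stress a \<gamma> ` ball X 1)"
        by (rule bounded_subset[OF compact_imp_bounded]) (use ball_subset_cball in blast)
    qed
    show "continuous_on UNIV (\<lambda>(F, G). gap a \<gamma> F G)"
      unfolding split_beta by (intro cg continuous_intros)
    show "0 \<le> (case Z of (F, G) \<Rightarrow> gap a \<gamma> F G)" for Z
      using gap_nonneg[OF assms] by (simp add: split_beta)
    show "((case (F, G) of (F, G) \<Rightarrow> gap a \<gamma> F G) = 0) = (G = 0)" for F G
      using gap_pos[OF assms, of G F] gap_0[OF assms, of F] by (cases "G = 0") auto
  next
    fix \<omega> :: "(real^2) set" and F :: "real^2^2" and \<phi> :: "real^2 \<Rightarrow> real^2"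
    assume \<phi>: "\<phi> \<in> test_functions \<omega>" and "bounded_lipschitz_set \<omega>"
    then have \<omega>: "open \<omega>" by (simp add: bounded_lipschitz_set_def)
    let ?X = "\<lambda>x. jacobian \<phi> (at x)"
    note X = jacobian_test_functions[OF \<phi>]
    have supp: "f x = 0" if "\<And>x. ?X x = 0 \<Longrightarrow> f x = 0" "x \<notin> closure {x. \<phi> x \<noteq> 0}" for f :: "real^2 \<Rightarrow> real" and x
      by (rule that(1)[OF X(2)[OF that(2)]])
    have int: "integrable lborel f" and eq: "(LINT x|lebesgue_on \<omega>. f x) = (LINT x|lborel. f x)"
      if f: "continuous_on UNIV f" "\<And>x. ?X x = 0 \<Longrightarrow> f x = 0" for f :: "real^2 \<Rightarrow> real"
    proof -
      have "{x. f x \<noteq> 0} \<subseteq> closure {x. \<phi> x \<noteq> 0}" using supp[of f] f(2) by blast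
      then have "bounded {x. f x \<noteq> 0}"
        by (rule bounded_subset[OF compact_imp_bounded[OF test_functionsD(2)[OF \<phi>]]])
      with f(1) show "integrable lborel f" by (rule integrable_lborel_bounded_support)
      have "f x = 0" if "x \<notin> \<omega>" for x using supp[of f] f(2) that test_functionsD(3)[OF \<phi>] by blast
      then show "(LINT x|lebesgue_on \<omega>. f x) = (LINT x|lborel. f x)"
        by (rule integral_lebesgue_on_eq_lborel(1)[OF borel_measurable_continuous_onI[OF f(1)] _ \<omega>])
    qed
    let ?f = "\<lambda>x. (stress a \<gamma> (F + ?X x) - stress a \<gamma> F) \<bullet> ?X x"
    have 1: "continuous_on UNIV ?f" by (intro continuous_intros cs X)
    have 2: "continuous_on UNIV (\<lambda>x. gap a \<gamma> F (?X x))" by (intro continuous_intros cg X)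
    have 3: "continuous_on UNIV (\<lambda>x. det (?X x))" by (intro continuous_intros X)
    have "(LINT x|lborel. gap a \<gamma> F (?X x)) = (LINT x|lborel. ?f x) - (LINT x|lborel. \<gamma> (det F) * det (?X x))"
      unfolding gap_def
      by (rule Bochner_Integration.integral_diff[OF int[OF 1] integrable_mult_right[OF int[OF 3]]])
        (auto simp: det_2)
    then have "(LINT x|lborel. gap a \<gamma> F (?X x)) = (LINT x|lborel. ?f x)"
      by (simp add: integral_det_jacobian[OF \<phi>])
    then show "(LINT x|lebesgue_on \<omega>. (case (F, ?X x) of (F, G) \<Rightarrow> gap a \<gamma> F G)) \<le> (LINT x|lebesgue_on \<omega>. ?f x)"
      using eq[OF 1] eq[OF 2] gap_0[OF assms] by simp
  qed
qed

subsection \<open>Borel representatives\<close>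

text \<open>Moves a field on \<omega> to a Borel function on the whole space, extended by 0, so that
  translations and Fubini's theorem for \<open>lborel\<close> become available. The representative
  is assembled from real-valued ones, coordinate by coordinate.\<close>

lemma borel_representative:
  fixes f :: "'a::euclidean_space \<Rightarrow> 'b::euclidean_space"
  assumes f: "f \<in> borel_measurable (lebesgue_on \<omega>)" and \<omega>: "open \<omega>"
  shows "\<exists>f'. f' \<in> borel_measurable borel \<and> (\<forall>x. x \<notin> \<omega> \<longrightarrow> f' x = 0) \<and> (AE x in lebesgue_on \<omega>. f x = f' x)"
proof -
  have "(\<lambda>x. if x \<in> \<omega> then f x else 0) \<in> borel_measurable lebesgue"
    using f \<omega> by (intro borel_measurable_if_I) auto
  then have "(\<lambda>x. (if x \<in> \<omega> then f x else 0) \<bullet> b) \<in> borel_measurable lebesgue" for b by measurable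
  then have "\<forall>b. \<exists>h\<in>borel_measurable lborel. (AE x in lborel. (if x \<in> \<omega> then f x else 0) \<bullet> b = h x)"
    using completion_ex_borel_measurable_real by blast
  then obtain h where h: "\<And>b. h b \<in> borel_measurable lborel" "\<And>b. AE x in lborel. (if x \<in> \<omega> then f x else 0) \<bullet> b = h b x"
    by metis
  define f' where "f' x = (if x \<in> \<omega> then \<Sum>b\<in>Basis. h b x *\<^sub>R b else 0)" for x
  have "AE x in lborel. \<forall>b\<in>Basis. (if x \<in> \<omega> then f x else 0) \<bullet> b = h b x"
    by (rule AE_ball_countable[THEN iffD2]) (use h(2) countable_finite[OF finite_Basis] in auto)
  then have "AE x in lebesgue. \<forall>b\<in>Basis. (if x \<in> \<omega> then f x else 0) \<bullet> b = h b x"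
    by (simp add: AE_completion_iff)
  then have "AE x in lebesgue. x \<in> \<omega> \<longrightarrow> f x = f' x"
  proof eventually_elim
    case (elim x)
    show ?case
    proof
      assume x: "x \<in> \<omega>"
      have "f x = (\<Sum>b\<in>Basis. (f x \<bullet> b) *\<^sub>R b)" by (simp add: euclidean_representation)
      also have "\<dots> = f' x" using elim x by (simp add: f'_def)
      finally show "f x = f' x" .
    qed
  qed
  moreover have "f' \<in> borel_measurable borel"
  proof -
    note [measurable] = h(1)[simplified]
    have [measurable]: "\<omega> \<in> sets borel" using \<omega> by simp
    show ?thesis unfolding f'_def by measurable
  qed
  ultimately show ?thesis
    using \<omega> by (intro exI[of _ f']) (auto simp: AE_restrict_space_iff f'_def)
qed

lemma memL_lebesgue_on_iff:
  fixes f :: "'a::euclidean_space \<Rightarrow> 'b::euclidean_space"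
  assumes f: "f \<in> borel_measurable borel" "\<And>x. x \<notin> \<omega> \<Longrightarrow> f x = 0" and \<omega>: "open \<omega>" and "p > 0"
  shows "memL (lebesgue_on \<omega>) p f \<longleftrightarrow> memL lborel p f" and "nrm (lebesgue_on \<omega>) p f = nrm lborel p f"
proof -
  note [measurable] = f(1)
  have m: "(\<lambda>x. norm (f x) powr p) \<in> borel_measurable borel" by measurable
  have z: "norm (f x) powr p = 0" if "x \<notin> \<omega>" for x using f(2)[OF that] by simp
  note I = integral_lebesgue_on_eq_lborel[OF m z \<omega>]
  have "f \<in> borel_measurable (lebesgue_on \<omega>)"
    by (rule measurable_restrict_space1, rule measurable_completion) simp
  then show "memL (lebesgue_on \<omega>) p f \<longleftrightarrow> memL lborel p f"
    using I(2) f(1) by (simp add: memL_def)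
  show "nrm (lebesgue_on \<omega>) p f = nrm lborel p f" by (simp add: nrm_def I(1))
qed

lemma memL_cong_AE:
  fixes f g :: "'a \<Rightarrow> 'b::euclidean_space"
  assumes "memL M p f" "AE x in M. f x = g x" "g \<in> borel_measurable M"
  shows "memL M p g" "nrm M p g = nrm M p f"
proof -
  note [measurable] = memL_measurable[OF assms(1)] assms(3)
  have "integrable M (\<lambda>x. norm (g x) powr p)"
    by (rule integrable_cong_AE_imp[OF memL_integrable[OF assms(1)]]) (use assms(2) in auto)
  then show "memL M p g" using assms(3) by (simp add: memL_def)
  show "nrm M p g = nrm M p f"
    by (rule nrm_cong_AE) (use assms(2) in auto)
qed

subsection \<open>Weak convergence\<close>

text \<open>The coefficients have modulus \<open>3\<^sup>-\<^sup>j\<close>; the sign of the \<open>j\<close>-th one is chosen so that the partial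
  sum up to \<open>j\<close> is large at \<open>w j\<close>, and the tail is at most half as large.\<close>

lemma gliding_hump:
  fixes l :: "nat \<Rightarrow> 'x \<Rightarrow> real" and N :: "'x \<Rightarrow> real" and w :: "nat \<Rightarrow> 'x"
  assumes bound: "\<And>j i. \<bar>l j (w i)\<bar> \<le> N (w i)" and norming: "\<And>j. l j (w j) = N (w j)"
    and large: "\<And>j. real j * 3 ^ j \<le> N (w j)"
  shows "\<exists>c. (\<forall>j. \<bar>c j\<bar> \<le> (1/3) ^ j) \<and> (\<forall>j. real j / 2 \<le> \<bar>\<Sum>i. c i * l i (w j)\<bar>)"
proof -
  define step :: "nat \<Rightarrow> ('x \<Rightarrow> real) \<Rightarrow> real" where
    "step j L = (if \<bar>L (w j) + (1/3) ^ j * l j (w j)\<bar> \<ge> (1/3) ^ j * N (w j) then (1/3) ^ j else - ((1/3) ^ j))" for j L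
  define L where "L = rec_nat (\<lambda>z. 0) (\<lambda>j L z. L z + step j L * l j z)"
  define c where "c j = step j (L j)" for j
  have L0: "L 0 = (\<lambda>z. 0)" and LS: "L (Suc j) = (\<lambda>z. L j z + c j * l j z)" for j
    by (simp_all add: L_def c_def)
  have L: "L n z = (\<Sum>i<n. c i * l i z)" for n z
    by (induction n) (simp_all add: L0 LS)
  have N0: "N (w i) \<ge> 0" for i using bound[of 0 i] by (rule order_trans[OF abs_ge_zero])
  have c: "\<bar>c j\<bar> = (1/3) ^ j" for j by (simp add: c_def step_def)
  \<comment> \<open>With x >= 0 the scaled norm and u the previous partial sum at
    \<open>w j\<close>: if |u + x| < x then u < 0, and therefore |u - x| > x. So one of the two
    signs always works.\<close>
  have hump: "(1/3) ^ j * N (w j) \<le> \<bar>L (Suc j) (w j)\<bar>" for j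
  proof (cases "\<bar>L j (w j) + (1/3) ^ j * N (w j)\<bar> \<ge> (1/3) ^ j * N (w j)")
    case True
    then show ?thesis by (simp add: LS c_def step_def norming)
  next
    case False
    moreover have "0 \<le> (1/3) ^ j * N (w j)" using N0[of j] by simp
    ultimately show ?thesis by (simp add: LS c_def step_def norming)
  qed
  have tm: "norm (c i * l i (w j)) \<le> (1/3) ^ i * N (w j)" for i j
    using mult_left_mono[OF bound[of i j], of "(1/3) ^ i"] by (simp add: abs_mult c)
  have sm: "summable (\<lambda>i. (1/3) ^ i * N (w j))" for j
    by (intro summable_mult2 summable_geometric) simp
  have summ: "summable (\<lambda>i. c i * l i (w j))" for j
    by (rule summable_comparison_test'[OF sm]) (use tm in auto)
  have "real j / 2 \<le> \<bar>\<Sum>i. c i * l i (w j)\<bar>" for j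
  proof -
    let ?x = "(1/3) ^ j * N (w j)"
    have split: "(\<Sum>i. c i * l i (w j)) = (\<Sum>i. c (i + Suc j) * l (i + Suc j) (w j)) + L (Suc j) (w j)"
      unfolding L by (rule suminf_split_initial_segment[OF summ])
    have s1: "summable (\<lambda>i. (1/3) ^ i * ((1/3) ^ Suc j * N (w j)))"
      by (intro summable_mult2 summable_geometric) simp
    have t1: "norm (c (i + Suc j) * l (i + Suc j) (w j)) \<le> (1/3) ^ i * ((1/3) ^ Suc j * N (w j))" for i
      using tm[of "i + Suc j" j] by (simp only: power_add mult.assoc)
    have s2: "summable (\<lambda>i. norm (c (i + Suc j) * l (i + Suc j) (w j)))"
      by (rule summable_comparison_test'[OF s1]) (use t1 in auto)
    have "norm (\<Sum>i. c (i + Suc j) * l (i + Suc j) (w j)) \<le> (\<Sum>i. norm (c (i + Suc j) * l (i + Suc j) (w j)))"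
      by (rule summable_norm[OF s2])
    also have "\<dots> \<le> (\<Sum>i. (1/3) ^ i * ((1/3) ^ Suc j * N (w j)))"
      by (rule suminf_le[OF t1 s2 s1])
    also have "\<dots> = (\<Sum>i. (1/3) ^ i) * ((1/3) ^ Suc j * N (w j))"
      by (rule suminf_mult2[symmetric]) (simp add: summable_geometric)
    also have "\<dots> = ?x / 2" by (simp add: suminf_geometric)
    finally have "\<bar>\<Sum>i. c (i + Suc j) * l (i + Suc j) (w j)\<bar> \<le> ?x / 2" by simp
    then have "?x / 2 \<le> \<bar>\<Sum>i. c i * l i (w j)\<bar>"
      using hump[of j] unfolding split by linarith
    moreover have "real j \<le> ?x"
    proof -
      have "real j = (1/3) ^ j * (real j * 3 ^ j)" by (simp add: power_one_over)
      also have "\<dots> \<le> ?x" by (intro mult_left_mono large) simp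
      finally show ?thesis .
    qed
    ultimately show ?thesis by linarith
  qed
  then show ?thesis using c by (intro exI[of _ c]) simp
qed

context
  fixes \<omega> :: "(real^'n) set"
begin

lemma Xpq_dual_fst:
  assumes "memL (lebesgue_on \<omega>) (4/3) Y"
  shows "(\<lambda>(F, P). LINT x|lebesgue_on \<omega>. F x \<bullet> Y x) \<in> Xpq_dual 4 (4/3) \<omega>"
proof -
  note H = Holder_inner[OF conj_4_43(2,1,4) _ assms]
  have "\<bar>LINT x|lebesgue_on \<omega>. F x \<bullet> Y x\<bar> \<le> nrm (lebesgue_on \<omega>) (4/3) Y * (Lp_norm 4 \<omega> F + Lp_norm (4/3) \<omega> P)"
    if "F \<in> Lp 4 \<omega>" for F :: "real^'n \<Rightarrow> real^'n^'n" and P :: "real^'n \<Rightarrow> real^'n^'n"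
  proof -
    have "\<bar>LINT x|lebesgue_on \<omega>. F x \<bullet> Y x\<bar> \<le> nrm (lebesgue_on \<omega>) (4/3) Y * nrm (lebesgue_on \<omega>) 4 F"
      using H(2)[of F] that by (simp add: Lp_eq mult.commute)
    also have "\<dots> \<le> nrm (lebesgue_on \<omega>) (4/3) Y * (Lp_norm 4 \<omega> F + Lp_norm (4/3) \<omega> P)"
      by (intro mult_left_mono) (simp_all add: Lp_norm_eq)
    finally show ?thesis .
  qed
  then have "\<exists>C. \<forall>F\<in>Lp 4 \<omega>. \<forall>P\<in>Lp (4/3) \<omega>. \<bar>LINT x|lebesgue_on \<omega>. F x \<bullet> Y x\<bar> \<le> C * (Lp_norm 4 \<omega> F + Lp_norm (4/3) \<omega> (P :: real^'n \<Rightarrow> real^'n^'n))"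
    by blast
  then show ?thesis
    unfolding Xpq_dual_def Xpq_def
    using H(1) by (simp add: Lp_eq inner_add_left)
qed

lemma Xpq_dual_snd:
  assumes "memL (lebesgue_on \<omega>) 4 Y"
  shows "(\<lambda>(F, P). LINT x|lebesgue_on \<omega>. P x \<bullet> Y x) \<in> Xpq_dual 4 (4/3) \<omega>"
proof -
  note H = Holder_inner[OF conj_4_43(1,2,3) _ assms]
  have "\<bar>LINT x|lebesgue_on \<omega>. P x \<bullet> Y x\<bar> \<le> nrm (lebesgue_on \<omega>) 4 Y * (Lp_norm 4 \<omega> F + Lp_norm (4/3) \<omega> P)"
    if "P \<in> Lp (4/3) \<omega>" for F :: "real^'n \<Rightarrow> real^'n^'n" and P :: "real^'n \<Rightarrow> real^'n^'n"
  proof -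
    have "\<bar>LINT x|lebesgue_on \<omega>. P x \<bullet> Y x\<bar> \<le> nrm (lebesgue_on \<omega>) 4 Y * nrm (lebesgue_on \<omega>) (4/3) P"
      using H(2)[of P] that by (simp add: Lp_eq mult.commute)
    also have "\<dots> \<le> nrm (lebesgue_on \<omega>) 4 Y * (Lp_norm 4 \<omega> F + Lp_norm (4/3) \<omega> P)"
      by (intro mult_left_mono) (simp_all add: Lp_norm_eq)
    finally show ?thesis .
  qed
  then have "\<exists>C. \<forall>F\<in>Lp 4 \<omega>. \<forall>P\<in>Lp (4/3) \<omega>. \<bar>LINT x|lebesgue_on \<omega>. P x \<bullet> Y x\<bar> \<le> C * (Lp_norm 4 \<omega> (F :: real^'n \<Rightarrow> real^'n^'n) + Lp_norm (4/3) \<omega> P)"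
    by blast
  then show ?thesis
    unfolding Xpq_dual_def Xpq_def
    using H(1) by (simp add: Lp_eq inner_add_left)
qed

text \<open>If the norms were unbounded, norming functionals along a rapidly growing subsequence
  could be summed to a bounded functional \<Lambda> that is unbounded on the sequence, although
  \<Lambda>(Z m) converges. Only the first component is treated; the bound on the second will follow
  from the growth of the stress.\<close>

lemma weakly_convergent_bounded:
  fixes Z :: "nat \<Rightarrow> 'n field_pair"
  assumes "Xpq_weakly_converges 4 (4/3) \<omega> Z Z'"
  shows "\<exists>M. \<forall>k. nrm (lebesgue_on \<omega>) 4 (fst (Z k)) \<le> M"
proof (rule ccontr)
  let ?M = "lebesgue_on \<omega>"
  let ?N = "\<lambda>z. nrm ?M 4 (fst z)"
  assume "\<not> (\<exists>M. \<forall>k. ?N (Z k) \<le> M)"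
  then have "\<forall>j. \<exists>k. real j * 3 ^ j \<le> ?N (Z k)" by (meson linear)
  from choice[OF this] obtain k where k: "\<And>j. real j * 3 ^ j \<le> ?N (Z (k j))" by blast
  have "Z m \<in> Xpq 4 (4/3) \<omega>" for m using assms by (simp add: Xpq_weakly_converges_def)
  then have ZL: "memL ?M 4 (fst (Z m))" for m
    by (simp add: Xpq_def Lp_eq mem_Times_iff)
  define w where "w j = Z (k j)" for j
  \<comment> \<open>The normalised duality map: pairing \<open>Y j\<close> with the first component
    of \<open>w j\<close> gives its norm. If that norm is 0, division by 0 gives 0 and
    \<open>Y j\<close> vanishes, which is why \<open>YN\<close> claims an inequality only.\<close>
  define Y where "Y j x = (1 / ?N (w j) ^ 3) *\<^sub>R ((norm (fst (w j) x))\<^sup>2 *\<^sub>R fst (w j) x)" for j x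
  have wL: "memL ?M 4 (fst (w j))" for j unfolding w_def by (rule ZL)
  have YL: "memL ?M (4/3) (Y j)" and YN: "nrm ?M (4/3) (Y j) \<le> 1" for j
  proof -
    note c = norm_cube_memL[OF wL[of j]]
    show "memL ?M (4/3) (Y j)" unfolding Y_def[abs_def] by (rule memL_scaleR(1)[OF c(1)]) simp
    have "nrm ?M (4/3) (Y j) = \<bar>1 / ?N (w j) ^ 3\<bar> * ?N (w j) ^ 3"
      unfolding Y_def[abs_def] c(2)[symmetric] by (rule memL_scaleR(2)[OF c(1)]) simp
    then show "nrm ?M (4/3) (Y j) \<le> 1" by simp
  qed
  define l :: "nat \<Rightarrow> 'n field_pair \<Rightarrow> real" where "l j = (\<lambda>(F, P). LINT x|?M. F x \<bullet> Y j x)" for j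
  have ldual: "l j \<in> Xpq_dual 4 (4/3) \<omega>" for j unfolding l_def by (rule Xpq_dual_fst[OF YL])
  have lb: "\<bar>l j z\<bar> \<le> ?N z" if "memL ?M 4 (fst z)" for j z
  proof -
    have "\<bar>l j z\<bar> \<le> ?N z * nrm ?M (4/3) (Y j)"
      using Holder_inner(2)[OF conj_4_43(2,1,4) that YL[of j]] by (simp add: l_def split_beta)
    also have "\<dots> \<le> ?N z * 1" by (intro mult_left_mono YN) simp
    finally show ?thesis by simp
  qed
  have ln: "l j (w j) = ?N (w j)" for j
  proof -
    have "l j (w j) = (LINT x|?M. (1 / ?N (w j) ^ 3) * norm (fst (w j) x) ^ 4)"
      by (simp add: l_def split_beta Y_def power2_norm_eq_inner[symmetric] flip: power_add)
    also have "\<dots> = (1 / ?N (w j) ^ 3) * ?N (w j) ^ 4" by (simp add: nrm_4)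
    finally show ?thesis by (simp add: power_eq_if)
  qed
  obtain c where c: "\<And>j. \<bar>c j\<bar> \<le> (1/3) ^ j" and big: "\<And>j. real j / 2 \<le> \<bar>\<Sum>i. c i * l i (w j)\<bar>"
    using gliding_hump[of l w ?N, OF lb[OF wL] ln] k unfolding w_def by blast
  define \<Lambda> where "\<Lambda> z = (\<Sum>i. c i * l i z)" for z
  have geo: "summable (\<lambda>i. (1/3::real) ^ i * r)" for r by (intro summable_mult2 summable_geometric) simp
  have tm: "norm (c i * l i z) \<le> (1/3) ^ i * ?N z" if "memL ?M 4 (fst z)" for i z
    using mult_mono[OF c[of i] lb[OF that, of i]] by (simp add: abs_mult)
  have summ: "summable (\<lambda>i. c i * l i z)" if "memL ?M 4 (fst z)" for z
    by (rule summable_comparison_test'[OF geo]) (use tm[OF that] in auto)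
  have \<Lambda>b: "\<bar>\<Lambda> z\<bar> \<le> 3/2 * ?N z" if z: "memL ?M 4 (fst z)" for z
  proof -
    have sn: "summable (\<lambda>i. norm (c i * l i z))"
      by (rule summable_comparison_test'[OF geo]) (use tm[OF z] in auto)
    have "norm (\<Lambda> z) \<le> (\<Sum>i. norm (c i * l i z))" unfolding \<Lambda>_def by (rule summable_norm[OF sn])
    also have "\<dots> \<le> (\<Sum>i. (1/3) ^ i * ?N z)" by (rule suminf_le[OF tm[OF z] sn geo])
    also have "\<dots> = (\<Sum>i. (1/3) ^ i) * ?N z" by (rule suminf_mult2[symmetric]) (simp add: summable_geometric)
    also have "\<dots> = 3/2 * ?N z" by (simp add: suminf_geometric)
    finally show ?thesis by simp
  qed
  have ladd: "l i (\<lambda>x. F x + F' x, \<lambda>x. P x + P' x) = l i (F, P) + l i (F', P')"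
    if "(F, P) \<in> Xpq 4 (4/3) \<omega>" "(F', P') \<in> Xpq 4 (4/3) \<omega>" for i F P F' P'
    using ldual[of i] that unfolding Xpq_dual_def by blast
  have lscale: "l i (\<lambda>x. r *\<^sub>R F x, \<lambda>x. r *\<^sub>R P x) = r * l i (F, P)" if "(F, P) \<in> Xpq 4 (4/3) \<omega>" for i r F P
    using ldual[of i] that unfolding Xpq_dual_def by blast
  have mem: "memL ?M 4 F" if "(F, P) \<in> Xpq 4 (4/3) \<omega>" for F P using that by (simp add: Xpq_def Lp_eq)
  have "\<Lambda> \<in> Xpq_dual 4 (4/3) \<omega>"
    unfolding Xpq_dual_def
  proof (intro CollectI conjI)
    show "\<forall>(F, P)\<in>Xpq 4 (4/3) \<omega>. \<forall>(F', P')\<in>Xpq 4 (4/3) \<omega>.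
        \<Lambda> (\<lambda>x. F x + F' x, \<lambda>x. P x + P' x) = \<Lambda> (F, P) + \<Lambda> (F', P')"
    proof clarify
      fix F P F' P' assume z: "(F, P) \<in> Xpq 4 (4/3) \<omega>" "(F', P') \<in> Xpq 4 (4/3) \<omega>"
      show "\<Lambda> (\<lambda>x. F x + F' x, \<lambda>x. P x + P' x) = \<Lambda> (F, P) + \<Lambda> (F', P')"
        unfolding \<Lambda>_def ladd[OF z] distrib_left
        by (rule suminf_add[symmetric]; rule summ) (use mem z in auto)
    qed
    show "\<forall>(F, P)\<in>Xpq 4 (4/3) \<omega>. \<forall>r. \<Lambda> (\<lambda>x. r *\<^sub>R F x, \<lambda>x. r *\<^sub>R P x) = r * \<Lambda> (F, P)"
    proof clarify
      fix F P r assume z: "(F, P) \<in> Xpq 4 (4/3) \<omega>"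
      show "\<Lambda> (\<lambda>x. r *\<^sub>R F x, \<lambda>x. r *\<^sub>R P x) = r * \<Lambda> (F, P)"
        unfolding \<Lambda>_def lscale[OF z] mult.left_commute[of _ r]
        by (rule suminf_mult; rule summ) (use mem z in auto)
    qed
    show "\<exists>C. \<forall>(F, P)\<in>Xpq 4 (4/3) \<omega>. \<bar>\<Lambda> (F, P)\<bar> \<le> C * (Lp_norm 4 \<omega> F + Lp_norm (4/3) \<omega> P)"
    proof (rule exI[of _ "3/2"], clarify)
      fix F P assume z: "(F, P) \<in> Xpq 4 (4/3) \<omega>"
      have "\<bar>\<Lambda> (F, P)\<bar> \<le> 3/2 * nrm ?M 4 F" using \<Lambda>b[of "(F, P)"] mem[OF z] by simp
      also have "\<dots> \<le> 3/2 * (nrm ?M 4 F + nrm ?M (4/3) P)" by simp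
      finally show "\<bar>\<Lambda> (F, P)\<bar> \<le> 3/2 * (Lp_norm 4 \<omega> F + Lp_norm (4/3) \<omega> P)" by (simp add: Lp_norm_eq)
    qed
  qed
  then have "(\<lambda>m. \<Lambda> (Z m)) \<longlonglongrightarrow> \<Lambda> Z'" using assms by (simp add: Xpq_weakly_converges_def)
  from convergent_imp_Bseq[OF convergentI[OF this]]
  obtain K where K: "\<And>m. norm (\<Lambda> (Z m)) \<le> K" by (auto simp: Bseq_def)
  obtain j where j: "2 * K < real j" using reals_Archimedean2 by blast
  then show False using big[of j] K[of "k j"] by (simp add: \<Lambda>_def w_def)
qed

end

subsection \<open>Testing dual norms with smooth functions\<close>

lemma test_functions_memL:
  fixes \<phi> :: "'a::euclidean_space \<Rightarrow> 'b::euclidean_space"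
  assumes \<phi>: "\<phi> \<in> test_functions \<omega>" and \<omega>: "open \<omega>" and "p > 0"
  shows "memL (lebesgue_on \<omega>) p \<phi>" "nrm (lebesgue_on \<omega>) p \<phi> = nrm lborel p \<phi>"
  using memL_lebesgue_on_iff[OF test_functions_measurable[OF \<phi>] test_functionsD(5)[OF \<phi>] \<omega> \<open>p > 0\<close>]
    memL_test_functions[OF \<phi> \<open>p > 0\<close>] by auto

lemma test_functions_W1_zero:
  fixes \<phi> :: "real^'n \<Rightarrow> real"
  assumes \<phi>: "\<phi> \<in> test_functions \<omega>" and \<omega>: "open \<omega>" and "r > 0"
  shows "(\<phi>, grad \<phi>) \<in> W1_zero r \<omega>"
proof -
  note g = test_functions_grad[OF \<phi>]
  have "(LINT x|lebesgue_on \<omega>. \<phi> x * grad \<psi> x $ j) = - (LINT x|lebesgue_on \<omega>. grad \<phi> x $ j * \<psi> x)"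
    if \<psi>: "\<psi> \<in> test_functions \<omega>" for \<psi> j
  proof -
    have nth: "grad \<theta> x $ j = frechet_derivative \<theta> (at x) (axis j 1)" if "\<theta> \<in> test_functions \<omega>" for \<theta> x
      using grad_eq_sum(2)[OF test_functionsD(7)[OF that], of "axis j 1" x] by (simp add: inner_axis')
    have D: "(\<lambda>x. frechet_derivative \<theta> (at x) v * \<xi> x) \<in> test_functions \<omega>"
      if "\<theta> \<in> test_functions \<omega>" "\<xi> \<in> test_functions \<omega>" for \<theta> \<xi> :: "real^'n \<Rightarrow> real" and v
      by (rule test_functions_mult[OF test_functions_derivative[OF that(1)] test_functionsD(1)[OF that(2)]])
    have eq: "(LINT x|lebesgue_on \<omega>. f x) = (LINT x|lborel. f x)" if "f \<in> test_functions \<omega>" for f :: "real^'n \<Rightarrow> real"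
      by (rule integral_lebesgue_on_eq_lborel(1)[OF test_functions_measurable[OF that] test_functionsD(5)[OF that] \<omega>])
    show ?thesis
      using integral_by_parts_test[OF \<phi> test_functionsD(1)[OF \<psi>], of "axis j 1"] eq[OF D[OF \<psi> \<phi>]] eq[OF D[OF \<phi> \<psi>]]
      by (simp add: nth \<phi> \<psi> mult.commute)
  qed
  then have W: "(\<phi>, grad \<phi>) \<in> W1 r \<omega>"
    using test_functions_memL(1)[OF \<phi> \<omega> \<open>r > 0\<close>] test_functions_memL(1)[OF g \<omega> \<open>r > 0\<close>]
    by (simp add: W1_def Lp_eq)
  have "W1_norm r \<omega> (\<lambda>x. \<phi> x - \<phi> x, \<lambda>x. grad \<phi> x - grad \<phi> x) = 0"
    by (simp add: W1_norm_def Lp_norm_def)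
  then show ?thesis
    unfolding W1_zero_def using W \<phi> by (auto intro!: exI[of _ "\<lambda>m. \<phi>"])
qed

text \<open>Turns convergence of dual norms into an estimate that is homogeneous in \<phi>, by
  rescaling \<phi> into the unit ball; \<open>hom\<close> supplies the homogeneity of the
  functionals, which their type does not. Dividing by some c strictly above the norm of \<phi> also
  covers norm 0.\<close>

lemma W1_dual_converges_test:
  fixes S :: "nat \<Rightarrow> 'n::finite sobolev_pair \<Rightarrow> real"
  assumes conv: "W1_dual_converges r \<omega> S T" and \<omega>: "open \<omega>" and "r > 0"
    and hom: "\<And>m u G c. S m (\<lambda>x. c * u x, \<lambda>x. c *\<^sub>R G x) = c * S m (u, G)"
      "\<And>u G c. T (\<lambda>x. c * u x, \<lambda>x. c *\<^sub>R G x) = c * T (u, G)"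
  shows "\<exists>\<epsilon>. (\<forall>m. \<epsilon> m \<ge> 0) \<and> \<epsilon> \<longlonglongrightarrow> 0 \<and> (\<exists>m0. \<forall>m\<ge>m0. \<forall>\<phi>\<in>test_functions \<omega>.
    \<bar>S m (\<phi>, grad \<phi>) - T (\<phi>, grad \<phi>)\<bar> \<le> \<epsilon> m * (nrm lborel r \<phi> + nrm lborel r (grad \<phi>)))"
proof -
  define N where "N m = W1_dual_norm r \<omega> (\<lambda>w. S m w - T w)" for m
  have N: "N \<longlonglongrightarrow> 0" using conv by (simp add: W1_dual_converges_def N_def[abs_def])
  \<comment> \<open>For finitely many \<open>m\<close> the dual norm may be infinite, and
    \<open>enn2real\<close> would turn it into 0. Hence the estimate is claimed only from
    \<open>m0\<close> on.\<close>
  have "\<forall>\<^sub>F m in sequentially. N m < 1" by (rule order_tendstoD(2)[OF N]) simp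
  then obtain m0 where m0: "\<And>m. m \<ge> m0 \<Longrightarrow> N m < 1" by (auto simp: eventually_sequentially)
  have lim: "(\<lambda>m. enn2real (N m)) \<longlonglongrightarrow> 0"
    using tendsto_enn2real[of N 0 sequentially] N by simp
  have "\<bar>S m (\<phi>, grad \<phi>) - T (\<phi>, grad \<phi>)\<bar> \<le> enn2real (N m) * (nrm lborel r \<phi> + nrm lborel r (grad \<phi>))"
    if m: "m \<ge> m0" and \<phi>: "\<phi> \<in> test_functions \<omega>" for m \<phi>
  proof -
    let ?n = "nrm lborel r \<phi> + nrm lborel r (grad \<phi>)" and ?D = "S m (\<phi>, grad \<phi>) - T (\<phi>, grad \<phi>)"
    have n0: "?n \<ge> 0" by simp
    have fin: "N m = ennreal (enn2real (N m))"
      by (rule ennreal_enn2real[symmetric], rule less_trans[OF m0[OF m]]) simp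
    have le: "\<bar>?D\<bar> \<le> enn2real (N m) * c" if c: "c > ?n" for c
    proof -
      have c0: "c > 0" using c n0 by linarith
      let ?u = "\<lambda>x. (1 / c) * \<phi> x"
      have u: "?u \<in> test_functions \<omega>" by (rule test_functions_compose_linear[OF \<phi> bounded_linear_mult_right])
      have gu: "grad ?u = (\<lambda>x. (1 / c) *\<^sub>R grad \<phi> x)"
        by (rule ext, rule grad_scale[OF test_functionsD(7)[OF \<phi>]])
      have nu: "nrm lborel r ?u = \<bar>1 / c\<bar> * nrm lborel r \<phi>"
        using memL_scaleR(2)[OF memL_test_functions[OF \<phi> \<open>r > 0\<close>] \<open>r > 0\<close>, of "1 / c"] by simp
      have ng: "nrm lborel r (grad ?u) = \<bar>1 / c\<bar> * nrm lborel r (grad \<phi>)"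
        unfolding gu by (rule memL_scaleR(2)[OF memL_test_functions[OF test_functions_grad[OF \<phi>] \<open>r > 0\<close>] \<open>r > 0\<close>])
      have "W1_norm r \<omega> (?u, grad ?u) = nrm lborel r ?u + nrm lborel r (grad ?u)"
        by (simp only: W1_norm_def Lp_norm_eq prod.case test_functions_memL(2)[OF u \<omega> \<open>r > 0\<close>]
            test_functions_memL(2)[OF test_functions_grad[OF u] \<omega> \<open>r > 0\<close>])
      also have "\<dots> = ?n / c" unfolding nu ng using c0 by (simp add: add_divide_distrib)
      also have "\<dots> \<le> 1" using c c0 by simp
      finally have "ennreal \<bar>S m (?u, grad ?u) - T (?u, grad ?u)\<bar> \<le> N m"
        unfolding N_def W1_dual_norm_def
        by (intro SUP_upper2[of "(?u, grad ?u)"]) (use test_functions_W1_zero[OF u \<omega> \<open>r > 0\<close>] in auto)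
      then have le: "\<bar>S m (?u, grad ?u) - T (?u, grad ?u)\<bar> \<le> enn2real (N m)"
        by (subst (asm) fin) simp
      have eq: "S m (?u, grad ?u) - T (?u, grad ?u) = (1 / c) * ?D"
        unfolding gu hom by (simp add: right_diff_distrib)
      have "(1 / c) * \<bar>?D\<bar> \<le> enn2real (N m)"
        using le c0 unfolding eq abs_mult by simp
      then show ?thesis using c0 by (simp add: field_simps)
    qed
    show ?thesis
    proof (rule le_mult_of_less[OF enn2real_nonneg n0])
      fix A c assume A: "A > enn2real (N m)" and c: "c > ?n"
      have "enn2real (N m) * c \<le> A * c" using A less_imp_le[OF le_less_trans[OF n0 c]] by (intro mult_right_mono) auto
      with le[OF c] show "\<bar>?D\<bar> \<le> A * c" by linarith
    qed
  qed
  then show ?thesis using lim by (intro exI[of _ "\<lambda>m. enn2real (N m)"]) auto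
qed

text \<open>In two dimensions each row has a single independent curl component; the index order 2, 1
  gives the sign that matches \<open>perp\<close>.\<close>

lemma distr_curl_eq:
  fixes F :: "real^2 \<Rightarrow> real^2^2"
  assumes F: "memL (lebesgue_on \<omega>) s F" and G: "memL (lebesgue_on \<omega>) r G"
    and rs: "s > 1" "r > 1" "1 / s + 1 / r = 1"
  shows "distr_curl \<omega> F i 2 1 (u, G) = (LINT x|lebesgue_on \<omega>. F x $ i \<bullet> perp (G x))"
    and "distr_div \<omega> F i (u, G) = - (LINT x|lebesgue_on \<omega>. F x $ i \<bullet> G x)"
proof -
  note [measurable] = memL_measurable[OF F] memL_measurable[OF G]
  have nth [measurable]: "(\<lambda>v::real^2. v $ k) \<in> borel_measurable borel" "(\<lambda>v::real^2^2. v $ k) \<in> borel_measurable borel" for k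
    by (intro borel_measurable_continuous_onI continuous_intros)+
  have Fij: "memL (lebesgue_on \<omega>) s (\<lambda>x. F x $ i $ j)" for j
  proof (rule memL_mono(1)[OF F])
    show "AE x in lebesgue_on \<omega>. norm (F x $ i $ j) \<le> norm (F x)"
      by (intro AE_I2 order_trans[OF Finite_Cartesian_Product.norm_nth_le Finite_Cartesian_Product.norm_nth_le])
  qed (use rs in auto)
  have Gk: "memL (lebesgue_on \<omega>) r (\<lambda>x. G x $ k)" for k
  proof (rule memL_mono(1)[OF G])
    show "AE x in lebesgue_on \<omega>. norm (G x $ k) \<le> norm (G x)"
      by (intro AE_I2 Finite_Cartesian_Product.norm_nth_le)
  qed (use rs in auto)
  have int: "integrable (lebesgue_on \<omega>) (\<lambda>x. F x $ i $ j * G x $ k)" for j k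
    using Holder_inner(1)[OF rs Fij Gk] by (simp add: mult.commute)
  show "distr_curl \<omega> F i 2 1 (u, G) = (LINT x|lebesgue_on \<omega>. F x $ i \<bullet> perp (G x))"
    by (simp add: distr_curl_def distr_deriv_def inner_2 int)
  show "distr_div \<omega> F i (u, G) = - (LINT x|lebesgue_on \<omega>. F x $ i \<bullet> G x)"
    by (simp add: distr_div_def distr_deriv_def inner_2 int sum_2)
qed

lemma distr_homogeneous:
  "distr_curl \<omega> F i j k (\<lambda>x. c * u x, \<lambda>x. c *\<^sub>R G x) = c * distr_curl \<omega> F i j k (u, G)"
  "distr_div \<omega> F i (\<lambda>x. c * u x, \<lambda>x. c *\<^sub>R G x) = c * distr_div \<omega> F i (u, G)"
  by (simp_all add: distr_curl_def distr_div_def distr_deriv_def mult.left_commute sum_distrib_left right_diff_distrib)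

subsection \<open>Local div-curl closedness\<close>

text \<open>The reason why the divergence of the cofactor field is a curl of the field itself: row i
  of \<open>cof X\<close> is, up to sign, the rotation of the other row of \<open>X\<close>.\<close>

lemma cof_row: "cof X $ 1 = perp (X $ 2)" "cof X $ 2 = - perp (X $ 1)"
  by (simp_all add: vec_eq_iff forall_2)

lemma inner_rows: "X \<bullet> Y = X $ 1 \<bullet> Y $ 1 + X $ 2 \<bullet> Y $ 2" for X Y :: "real^2^2"
  by (simp add: inner_vec_def sum_2)

lemma perp_inner: "perp x \<bullet> y = - (x \<bullet> perp y)"
  by (simp add: inner_2)

text \<open>One null sequence and one starting index serve all rows and both operators. They are the
  sums over \<open>i\<close> of the individual ones, each of which they dominate because all
  summands are nonnegative.\<close>

lemma div_curl_converges_test: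
  fixes Z :: "nat \<Rightarrow> 2 field_pair"
  assumes conv: "div_curl_converges 4 (4/3) \<omega> Z (\<lambda>x. F, \<lambda>x. P)" and \<omega>: "open \<omega>" "bounded \<omega>"
  shows "\<exists>\<epsilon> m0. (\<forall>m. \<epsilon> m \<ge> 0) \<and> \<epsilon> \<longlonglongrightarrow> 0 \<and> (\<forall>m\<ge>m0. \<forall>i. \<forall>\<phi>\<in>test_functions \<omega>.
    \<bar>LINT x|lebesgue_on \<omega>. (fst (Z m) x - F) $ i \<bullet> perp (grad \<phi> x)\<bar> \<le> \<epsilon> m * (nrm lborel (4/3) \<phi> + nrm lborel (4/3) (grad \<phi>)) \<and>
    \<bar>LINT x|lebesgue_on \<omega>. (snd (Z m) x - P) $ i \<bullet> grad \<phi> x\<bar> \<le> \<epsilon> m * (nrm lborel 4 \<phi> + nrm lborel 4 (grad \<phi>)))"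
proof -
  have weak: "Xpq_weakly_converges 4 (4/3) \<omega> Z (\<lambda>x. F, \<lambda>x. P)"
    using conv by (simp add: div_curl_converges_def)
  have FL: "memL (lebesgue_on \<omega>) 4 (fst (Z m))" and PL: "memL (lebesgue_on \<omega>) (4/3) (snd (Z m))" for m
    using weak by (auto simp: Xpq_weakly_converges_def Xpq_def Lp_eq mem_Times_iff)
  have F0: "memL (lebesgue_on \<omega>) 4 (\<lambda>x. F)" and P0: "memL (lebesgue_on \<omega>) (4/3) (\<lambda>x. P)"
    using weak by (auto simp: Xpq_weakly_converges_def Xpq_def Lp_eq)
  have C: "\<exists>\<epsilon>. (\<forall>m. \<epsilon> m \<ge> 0) \<and> \<epsilon> \<longlonglongrightarrow> 0 \<and> (\<exists>m0. \<forall>m\<ge>m0. \<forall>\<phi>\<in>test_functions \<omega>.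
    \<bar>LINT x|lebesgue_on \<omega>. (fst (Z m) x - F) $ i \<bullet> perp (grad \<phi> x)\<bar> \<le> \<epsilon> m * (nrm lborel (4/3) \<phi> + nrm lborel (4/3) (grad \<phi>)))" for i
  proof -
    have eq: "distr_curl \<omega> (fst (Z m)) i 2 1 (\<phi>, grad \<phi>) - distr_curl \<omega> (\<lambda>x. F) i 2 1 (\<phi>, grad \<phi>) =
      (LINT x|lebesgue_on \<omega>. (fst (Z m) x - F) $ i \<bullet> perp (grad \<phi> x))" if \<phi>: "\<phi> \<in> test_functions \<omega>" for m \<phi>
    proof -
      have g: "memL (lebesgue_on \<omega>) (4/3) (grad \<phi>)"
        by (rule test_functions_memL(1)[OF test_functions_grad[OF \<phi>] \<omega>(1)]) simp
      have d: "memL (lebesgue_on \<omega>) 4 (\<lambda>x. fst (Z m) x - F)"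
        by (rule Minkowski_diff(1)[OF _ FL F0]) simp
      have i: "integrable (lebesgue_on \<omega>) (\<lambda>x. Y x $ i \<bullet> perp (grad \<phi> x))" if Y: "memL (lebesgue_on \<omega>) 4 Y" for Y :: "real^2 \<Rightarrow> real^2^2"
      proof (rule Holder_inner(1)[OF conj_4_43(2,1,4)])
        show "memL (lebesgue_on \<omega>) (4/3) (\<lambda>x. perp (grad \<phi> x))"
          by (rule test_functions_memL(1)[OF test_functions_compose_linear[OF test_functions_grad[OF \<phi>] perp_bounded_linear] \<omega>(1)]) simp
        have [measurable]: "(\<lambda>v::real^2^2. v $ i) \<in> borel_measurable borel"
          by (intro borel_measurable_continuous_onI continuous_intros)
        note [measurable] = memL_measurable[OF Y]
        show "memL (lebesgue_on \<omega>) 4 (\<lambda>x. Y x $ i)"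
          by (rule memL_mono(1)[OF Y]) (auto intro!: AE_I2 Finite_Cartesian_Product.norm_nth_le)
      qed
      show ?thesis
        unfolding distr_curl_eq(1)[OF FL g conj_4_43(2,1,4)] distr_curl_eq(1)[OF F0 g conj_4_43(2,1,4)]
        by (simp add: inner_diff_left i[OF FL] i[OF F0])
    qed
    have "W1_dual_converges (4/3) \<omega> (\<lambda>m. distr_curl \<omega> (fst (Z m)) i 2 1) (distr_curl \<omega> (\<lambda>x. F) i 2 1)"
      using conv by (simp add: div_curl_converges_def)
    from W1_dual_converges_test[OF this \<omega>(1) _ distr_homogeneous(1) distr_homogeneous(1)]
    show ?thesis by (simp add: eq cong: ball_cong)
  qed
  have D: "\<exists>\<epsilon>. (\<forall>m. \<epsilon> m \<ge> 0) \<and> \<epsilon> \<longlonglongrightarrow> 0 \<and> (\<exists>m0. \<forall>m\<ge>m0. \<forall>\<phi>\<in>test_functions \<omega>.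
    \<bar>LINT x|lebesgue_on \<omega>. (snd (Z m) x - P) $ i \<bullet> grad \<phi> x\<bar> \<le> \<epsilon> m * (nrm lborel 4 \<phi> + nrm lborel 4 (grad \<phi>)))" for i
  proof -
    have eq: "\<bar>distr_div \<omega> (snd (Z m)) i (\<phi>, grad \<phi>) - distr_div \<omega> (\<lambda>x. P) i (\<phi>, grad \<phi>)\<bar> =
      \<bar>LINT x|lebesgue_on \<omega>. (snd (Z m) x - P) $ i \<bullet> grad \<phi> x\<bar>" if \<phi>: "\<phi> \<in> test_functions \<omega>" for m \<phi>
    proof -
      have g: "memL (lebesgue_on \<omega>) 4 (grad \<phi>)"
        by (rule test_functions_memL(1)[OF test_functions_grad[OF \<phi>] \<omega>(1)]) simp
      have i: "integrable (lebesgue_on \<omega>) (\<lambda>x. Y x $ i \<bullet> grad \<phi> x)" if Y: "memL (lebesgue_on \<omega>) (4/3) Y" for Y :: "real^2 \<Rightarrow> real^2^2"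
      proof (rule Holder_inner(1)[OF conj_4_43(1-3) _ g])
        have [measurable]: "(\<lambda>v::real^2^2. v $ i) \<in> borel_measurable borel"
          by (intro borel_measurable_continuous_onI continuous_intros)
        note [measurable] = memL_measurable[OF Y]
        show "memL (lebesgue_on \<omega>) (4/3) (\<lambda>x. Y x $ i)"
          by (rule memL_mono(1)[OF Y]) (auto intro!: AE_I2 Finite_Cartesian_Product.norm_nth_le)
      qed
      show ?thesis
        unfolding distr_curl_eq(2)[OF PL g conj_4_43(1-3)] distr_curl_eq(2)[OF P0 g conj_4_43(1-3)]
        by (simp add: inner_diff_left i[OF PL] i[OF P0] abs_minus_commute)
    qed
    have "W1_dual_converges 4 \<omega> (\<lambda>m. distr_div \<omega> (snd (Z m)) i) (distr_div \<omega> (\<lambda>x. P) i)"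
      using conv by (simp add: div_curl_converges_def)
    from W1_dual_converges_test[OF this \<omega>(1) _ distr_homogeneous(2) distr_homogeneous(2)]
    show ?thesis by (simp add: eq cong: ball_cong)
  qed
  define PC where "PC i \<epsilon> m0 \<longleftrightarrow> (\<forall>m. \<epsilon> m \<ge> (0::real)) \<and> \<epsilon> \<longlonglongrightarrow> 0 \<and> (\<forall>m\<ge>m0. \<forall>\<phi>\<in>test_functions \<omega>.
    \<bar>LINT x|lebesgue_on \<omega>. (fst (Z m) x - F) $ i \<bullet> perp (grad \<phi> x)\<bar> \<le> \<epsilon> m * (nrm lborel (4/3) \<phi> + nrm lborel (4/3) (grad \<phi>)))"
    for i \<epsilon> and m0 :: nat
  define PD where "PD i \<epsilon> m0 \<longleftrightarrow> (\<forall>m. \<epsilon> m \<ge> (0::real)) \<and> \<epsilon> \<longlonglongrightarrow> 0 \<and> (\<forall>m\<ge>m0. \<forall>\<phi>\<in>test_functions \<omega>.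
    \<bar>LINT x|lebesgue_on \<omega>. (snd (Z m) x - P) $ i \<bullet> grad \<phi> x\<bar> \<le> \<epsilon> m * (nrm lborel 4 \<phi> + nrm lborel 4 (grad \<phi>)))"
    for i \<epsilon> and m0 :: nat
  have "\<forall>i. \<exists>p. PC i (fst p) (snd p)" "\<forall>i. \<exists>p. PD i (fst p) (snd p)"
    using C D unfolding PC_def PD_def by simp_all
  from choice[OF this(1)] choice[OF this(2)] obtain fc fd where
    f: "\<And>i. PC i (fst (fc i)) (snd (fc i))" "\<And>i. PD i (fst (fd i)) (snd (fd i))" by blast
  define \<epsilon>c where "\<epsilon>c i = fst (fc i)" for i
  define \<epsilon>d where "\<epsilon>d i = fst (fd i)" for i
  define mc where "mc i = snd (fc i)" for i
  define md where "md i = snd (fd i)" for i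
  have c: "\<And>i m. \<epsilon>c i m \<ge> 0" "\<And>i. \<epsilon>c i \<longlonglongrightarrow> 0"
    "\<And>i m \<phi>. m \<ge> mc i \<Longrightarrow> \<phi> \<in> test_functions \<omega> \<Longrightarrow>
      \<bar>LINT x|lebesgue_on \<omega>. (fst (Z m) x - F) $ i \<bullet> perp (grad \<phi> x)\<bar> \<le> \<epsilon>c i m * (nrm lborel (4/3) \<phi> + nrm lborel (4/3) (grad \<phi>))"
    using f(1) unfolding PC_def \<epsilon>c_def mc_def by blast+
  have d: "\<And>i m. \<epsilon>d i m \<ge> 0" "\<And>i. \<epsilon>d i \<longlonglongrightarrow> 0"
    "\<And>i m \<phi>. m \<ge> md i \<Longrightarrow> \<phi> \<in> test_functions \<omega> \<Longrightarrow>
      \<bar>LINT x|lebesgue_on \<omega>. (snd (Z m) x - P) $ i \<bullet> grad \<phi> x\<bar> \<le> \<epsilon>d i m * (nrm lborel 4 \<phi> + nrm lborel 4 (grad \<phi>))"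
    using f(2) unfolding PD_def \<epsilon>d_def md_def by blast+
  define \<epsilon> where "\<epsilon> m = (\<Sum>i\<in>UNIV. \<epsilon>c i m + \<epsilon>d i m)" for m
  define m0 where "m0 = (\<Sum>i\<in>UNIV. mc i + md i)"
  have le: "\<epsilon>c i m \<le> \<epsilon> m" "\<epsilon>d i m \<le> \<epsilon> m" for i m
  proof -
    have "\<epsilon>c i m + \<epsilon>d i m \<le> \<epsilon> m"
      unfolding \<epsilon>_def by (rule member_le_sum) (use c(1) d(1) in \<open>auto intro: add_nonneg_nonneg\<close>)
    then show "\<epsilon>c i m \<le> \<epsilon> m" "\<epsilon>d i m \<le> \<epsilon> m" using c(1)[of i m] d(1)[of i m] by linarith+
  qed
  have m0: "mc i \<le> m0" "md i \<le> m0" for i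
    using member_le_sum[of i UNIV "\<lambda>i. mc i + md i"] unfolding m0_def by auto
  have "\<epsilon> \<longlonglongrightarrow> (\<Sum>i\<in>(UNIV::2 set). 0 + 0)"
    unfolding \<epsilon>_def by (intro tendsto_sum tendsto_add c d)
  then have "\<epsilon> \<longlonglongrightarrow> 0" by simp
  moreover have "\<epsilon> m \<ge> 0" for m using le(1)[of 1 m] c(1)[of 1 m] by linarith
  moreover have "\<bar>LINT x|lebesgue_on \<omega>. (fst (Z m) x - F) $ i \<bullet> perp (grad \<phi> x)\<bar> \<le> \<epsilon> m * (nrm lborel (4/3) \<phi> + nrm lborel (4/3) (grad \<phi>))"
    if "m \<ge> m0" "\<phi> \<in> test_functions \<omega>" for m i \<phi>
    using c(3)[OF order_trans[OF m0(1) that(1)] that(2), of i] mult_right_mono[OF le(1)[of i m], of "nrm lborel (4/3) \<phi> + nrm lborel (4/3) (grad \<phi>)"]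
    by simp
  moreover have "\<bar>LINT x|lebesgue_on \<omega>. (snd (Z m) x - P) $ i \<bullet> grad \<phi> x\<bar> \<le> \<epsilon> m * (nrm lborel 4 \<phi> + nrm lborel 4 (grad \<phi>))"
    if "m \<ge> m0" "\<phi> \<in> test_functions \<omega>" for m i \<phi>
    using d(3)[OF order_trans[OF m0(2) that(1)] that(2), of i] mult_right_mono[OF le(2)[of i m], of "nrm lborel 4 \<phi> + nrm lborel 4 (grad \<phi>)"]
    by simp
  ultimately show ?thesis by (intro exI[of _ \<epsilon>] exI[of _ m0]) blast
qed

lemma weak_limit_test:
  fixes Z :: "nat \<Rightarrow> 2 field_pair" and \<theta> :: "real^2 \<Rightarrow> real"
  assumes weak: "Xpq_weakly_converges 4 (4/3) \<omega> Z (\<lambda>x. F, \<lambda>x. P)" and \<omega>: "open \<omega>" "bounded \<omega>"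
    and \<theta>: "\<theta> \<in> test_functions UNIV"
  shows "(\<lambda>m. LINT x|lebesgue_on \<omega>. \<theta> x *\<^sub>R (fst (Z m) x - F)) \<longlonglongrightarrow> 0"
    and "(\<lambda>m. LINT x|lebesgue_on \<omega>. \<theta> x *\<^sub>R (snd (Z m) x - P)) \<longlonglongrightarrow> 0"
proof -
  let ?M = "lebesgue_on \<omega>"
  have FL: "memL ?M 4 (fst (Z m))" and PL: "memL ?M (4/3) (snd (Z m))" for m
    using weak by (auto simp: Xpq_weakly_converges_def Xpq_def Lp_eq mem_Times_iff)
  have F0: "memL ?M 4 (\<lambda>x. F)" and P0: "memL ?M (4/3) (\<lambda>x. P)"
    using weak by (auto simp: Xpq_weakly_converges_def Xpq_def Lp_eq)
  have \<omega>M: "\<omega> \<in> sets ?M" using sets.top[of ?M] by simp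
  have em: "emeasure ?M \<omega> < \<infinity>"
    using emeasure_bounded_finite[OF \<omega>(2)] \<omega>(1) by (simp add: emeasure_restrict_space)
  obtain B where B: "\<And>x. norm (\<theta> x) \<le> B" using test_functions_bounded[OF \<theta>] by blast
  have \<theta>m [measurable]: "\<theta> \<in> borel_measurable ?M"
    by (rule measurable_restrict_space1, rule measurable_completion) (use test_functions_measurable[OF \<theta>] in simp)
  have \<theta>b: "memL ?M p (\<lambda>x. \<theta> x *\<^sub>R b)" if "p > 0" for p and b :: "real^2^2"
  proof (rule memL_bounded_support[OF _ _ em _ _ that])
    show "norm (\<theta> x *\<^sub>R b) \<le> B * norm b" for x using B[of x] by (simp add: mult_right_mono)
  qed (use \<omega>M in auto)
  have int: "integrable ?M (\<lambda>x. \<theta> x *\<^sub>R Y x)" if Y: "memL ?M p Y" "p > 1" for Y :: "real^2 \<Rightarrow> real^2^2" and p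
  proof (rule integrable_scaleR_bounded[of _ _ _ B])
    show "integrable ?M Y"
      using memL_finite_support(1)[of 1 p ?M Y \<omega>] Y em \<omega>M by (auto simp: memL_def integrable_norm_iff)
  qed (use B in auto)
  have *: "(\<lambda>m. LINT x|?M. \<theta> x *\<^sub>R (Y m x - Y0)) \<longlonglongrightarrow> 0"
    if Y: "\<And>m. memL ?M p (Y m)" "memL ?M p (\<lambda>x. Y0)" "p > 1"
      and lim: "\<And>b. (\<lambda>m. LINT x|?M. Y m x \<bullet> (\<theta> x *\<^sub>R b)) \<longlonglongrightarrow> (LINT x|?M. Y0 \<bullet> (\<theta> x *\<^sub>R b))"
    for Y :: "nat \<Rightarrow> real^2 \<Rightarrow> real^2^2" and Y0 p
  proof -
    have inner: "(LINT x|?M. \<theta> x *\<^sub>R W x) \<bullet> b = (LINT x|?M. W x \<bullet> (\<theta> x *\<^sub>R b))" if "memL ?M p W" for W :: "real^2 \<Rightarrow> real^2^2" and b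
      using integral_inner_left[of b ?M "\<lambda>x. \<theta> x *\<^sub>R W x"] int[OF that Y(3)] by simp
    have "(\<lambda>m. LINT x|?M. \<theta> x *\<^sub>R Y m x) \<longlonglongrightarrow> (LINT x|?M. \<theta> x *\<^sub>R Y0)"
      unfolding tendsto_componentwise_iff[of "\<lambda>m. LINT x|?M. \<theta> x *\<^sub>R Y m x"] inner[OF Y(1)] inner[OF Y(2)]
      by (intro ballI lim)
    then have "(\<lambda>m. (LINT x|?M. \<theta> x *\<^sub>R Y m x) - (LINT x|?M. \<theta> x *\<^sub>R Y0)) \<longlonglongrightarrow> 0"
      by (rule LIM_zero)
    then show ?thesis
      by (simp add: scaleR_diff_right int[OF Y(1,3)] int[OF Y(2,3)])
  qed
  have lim: "(\<lambda>m. \<Lambda> (Z m)) \<longlonglongrightarrow> \<Lambda> (\<lambda>x. F, \<lambda>x. P)" if "\<Lambda> \<in> Xpq_dual 4 (4/3) \<omega>" for \<Lambda>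
    using weak that by (simp add: Xpq_weakly_converges_def)
  have "(\<lambda>m. LINT x|?M. fst (Z m) x \<bullet> (\<theta> x *\<^sub>R b)) \<longlonglongrightarrow> (LINT x|?M. F \<bullet> (\<theta> x *\<^sub>R b))" for b
    using lim[OF Xpq_dual_fst[OF \<theta>b[of "4/3" b]]] by (simp add: split_beta)
  then show "(\<lambda>m. LINT x|?M. \<theta> x *\<^sub>R (fst (Z m) x - F)) \<longlonglongrightarrow> 0"
    by (intro *[OF FL F0]) auto
  have "(\<lambda>m. LINT x|?M. snd (Z m) x \<bullet> (\<theta> x *\<^sub>R b)) \<longlonglongrightarrow> (LINT x|?M. P \<bullet> (\<theta> x *\<^sub>R b))" for b
    using lim[OF Xpq_dual_snd[OF \<theta>b[of 4 b]]] by (simp add: split_beta)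
  then show "(\<lambda>m. LINT x|?M. \<theta> x *\<^sub>R (snd (Z m) x - P)) \<longlonglongrightarrow> 0"
    by (intro *[OF PL P0]) auto
qed

lemma integral_representative:
  fixes g :: "'a::euclidean_space \<Rightarrow> 'b::{banach, second_countable_topology}"
  assumes "open \<omega>" "g \<in> borel_measurable (lebesgue_on \<omega>)" "g' \<in> borel_measurable borel"
    "AE x in lebesgue_on \<omega>. g x = g' x" "\<And>x. x \<notin> \<omega> \<Longrightarrow> g' x = 0"
  shows "(LINT x|lebesgue_on \<omega>. g x) = (LINT x|lborel. g' x)"
proof -
  have "g' \<in> borel_measurable (lebesgue_on \<omega>)"
    by (rule measurable_restrict_space1, rule measurable_completion) (use assms in simp)
  then have "(LINT x|lebesgue_on \<omega>. g x) = (LINT x|lebesgue_on \<omega>. g' x)"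
    by (intro integral_cong_AE assms)
  also have "\<dots> = (LINT x|lborel. g' x)" by (rule integral_lebesgue_on_eq_lborel(1)[OF assms(3,5,1)])
  finally show ?thesis .
qed

lemma measurable_borel_lebesgue_on:
  "f \<in> borel_measurable borel \<Longrightarrow> f \<in> borel_measurable (lebesgue_on \<omega>)"
  by (rule measurable_restrict_space1, rule measurable_completion) simp

lemma measurable_vec_nth_row [measurable]: "(\<lambda>v::real^2^2. v $ i) \<in> borel_measurable borel"
  by (intro borel_measurable_continuous_onI continuous_intros)

lemma measurable_cof [measurable]: "cof \<in> borel_measurable borel"
  by (rule borel_measurable_continuous_onI) (use continuous_on_cof[OF continuous_on_id] in simp)

lemma row_memL:
  fixes Y :: "'a \<Rightarrow> real^2^2"
  assumes "memL M p Y" "p > 0"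
  shows "memL M p (\<lambda>x. Y x $ i)" "nrm M p (\<lambda>x. Y x $ i) \<le> nrm M p Y"
proof -
  note [measurable] = memL_measurable[OF assms(1)]
  have "AE x in M. norm (Y x $ i) \<le> norm (Y x)" by (intro AE_I2 Finite_Cartesian_Product.norm_nth_le)
  then show "memL M p (\<lambda>x. Y x $ i)" "nrm M p (\<lambda>x. Y x $ i) \<le> nrm M p Y"
    using memL_mono[OF assms(1) _ _ assms(2), of "\<lambda>x. Y x $ i"] by auto
qed

text \<open>The exponents match because 3 * (4/3) = 4: cubic growth maps L^4 bounds to L^(4/3)
  bounds.\<close>

lemma stress_nrm_le:
  fixes h :: "'a \<Rightarrow> real^2^2"
  assumes growth: "\<And>X. norm (stress a \<gamma> X) \<le> C * (1 + norm X ^ 3)" and "C \<ge> 0"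
    and h: "memL M 4 h" and Y: "memL M (4/3) Y" and one: "memL M (4/3) (\<lambda>x. 1 :: real)"
    and AE: "AE x in M. Y x = stress a \<gamma> (h x)"
  shows "nrm M (4/3) Y \<le> C * (nrm M (4/3) (\<lambda>x. 1 :: real) + nrm M 4 h ^ 3)"
proof -
  let ?c = "\<lambda>x. (norm (h x))\<^sup>2 *\<^sub>R h x"
  note [measurable] = memL_measurable[OF h] memL_measurable[OF Y]
  note c = norm_cube_memL[OF h]
  have nc: "norm (?c x) = norm (h x) ^ 3" for x by (simp add: power2_eq_square power3_eq_cube)
  have n: "memL M (4/3) (\<lambda>x. norm (?c x))" "nrm M (4/3) (\<lambda>x. norm (?c x)) = nrm M 4 h ^ 3"
  proof -
    show "memL M (4/3) (\<lambda>x. norm (?c x))" by (rule memL_mono(1)[OF c(1)]) auto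
    show "nrm M (4/3) (\<lambda>x. norm (?c x)) = nrm M 4 h ^ 3"
      unfolding c(2)[symmetric] by (simp add: nrm_def)
  qed
  note s = Minkowski[OF _ one n(1)]
  note sc = memL_scaleR[OF s(1), of C]
  have "nrm M (4/3) Y \<le> nrm M (4/3) (\<lambda>x. C *\<^sub>R (1 + norm (?c x)))"
  proof (rule memL_mono(2))
    show "memL M (4/3) (\<lambda>x. C *\<^sub>R (1 + norm (?c x)))" by (rule sc(1)) auto
    show "AE x in M. norm (Y x) \<le> norm (C *\<^sub>R (1 + norm (?c x)))"
      using AE
    proof eventually_elim
      case (elim x)
      have "norm (Y x) \<le> C * (1 + norm (h x) ^ 3)" unfolding elim by (rule growth)
      also have "\<dots> = C * (1 + norm (?c x))" by (simp only: nc)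
      also have "\<dots> \<le> norm (C *\<^sub>R (1 + norm (?c x)))" by (simp only: real_scaleR_def real_norm_def abs_ge_self)
      finally show ?case .
    qed
  qed auto
  also have "\<dots> = C * nrm M (4/3) (\<lambda>x. 1 + norm (?c x))"
    using sc(2) \<open>C \<ge> 0\<close> by simp
  also have "\<dots> \<le> C * (nrm M (4/3) (\<lambda>x. 1 :: real) + nrm M 4 h ^ 3)"
    using s(2) \<open>C \<ge> 0\<close> unfolding n(2) by (intro mult_left_mono) auto
  finally show ?thesis .
qed

lemma locally_div_curl_closed_stress:
  assumes a: "a > 0" and bd: "b \<le> 2" "d \<le> 3 * a" "b \<ge> 0" "d \<ge> 0"
    and growth: "\<And>t. \<bar>\<gamma> t\<bar> \<le> b + d * \<bar>t\<bar>"
    and mono: "\<And>s t. 0 \<le> (\<gamma> s - \<gamma> t) * (s - t)"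
    and cont: "continuous_on UNIV \<gamma>"
  shows "locally_div_curl_closed 4 (4/3) (data_set (stress a \<gamma>))"
  unfolding locally_div_curl_closed_def
proof (intro allI impI, elim conjE exE)
  note assms = a bd growth mono cont
  fix \<omega> :: "(real^2) set" and F P :: "real^2^2" and Z :: "nat \<Rightarrow> 2 field_pair"
  assume bdd: "bounded \<omega>" and ne: "\<omega> \<noteq> {}" and \<omega>: "open \<omega>"
    and conv: "div_curl_converges 4 (4/3) \<omega> Z (\<lambda>x. F, \<lambda>x. P)"
    and data: "\<forall>m. AE x in lebesgue_on \<omega>. (fst (Z m) x, snd (Z m) x) \<in> data_set (stress a \<gamma>)"
  let ?M = "lebesgue_on \<omega>" and ?T = "stress a \<gamma>"
  define g0 where "g0 = \<gamma> (det F)"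
  have weak: "Xpq_weakly_converges 4 (4/3) \<omega> Z (\<lambda>x. F, \<lambda>x. P)"
    using conv by (simp add: div_curl_converges_def)
  have FL: "memL ?M 4 (fst (Z m))" and PL: "memL ?M (4/3) (snd (Z m))" for m
    using weak by (auto simp: Xpq_weakly_converges_def Xpq_def Lp_eq mem_Times_iff)
  have F0: "memL ?M 4 (\<lambda>x. F)" and P0: "memL ?M (4/3) (\<lambda>x. P)"
    using weak by (auto simp: Xpq_weakly_converges_def Xpq_def Lp_eq)
  have em: "emeasure lborel \<omega> < \<infinity>" by (rule emeasure_bounded_finite[OF bdd])
  have \<omega>M: "\<omega> \<in> sets ?M" using sets.top[of ?M] by simp
  have emM: "emeasure ?M \<omega> < \<infinity>" using em \<omega> by (simp add: emeasure_restrict_space)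
  have one: "memL ?M (4/3) (\<lambda>x. 1 :: real)"
    by (rule memL_bounded_support[OF _ \<omega>M emM, of _ 1]) auto
  obtain K where "K > 0" "\<omega> \<subseteq> ball 0 K" using bounded_subset_ballD[OF bdd] by blast
  note K = this(2,1)
  obtain x0 r where x0: "r > 0" "ball x0 r \<subseteq> \<omega>"
    using ne \<omega> open_contains_ball by blast
  obtain \<eta> :: "real^2 \<Rightarrow> real" where "\<eta> \<in> test_functions (ball x0 r)" and \<eta>0: "\<And>x. \<eta> x \<ge> 0" and \<eta>1: "(LINT x|lborel. \<eta> x) = 1"
    using bump_exists[OF x0(1)] by blast
  then have \<eta>: "\<eta> \<in> test_functions \<omega>" using test_functions_mono[OF x0(2)] by blast
  note \<eta>m [measurable] = test_functions_measurable[OF \<eta>]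
  have \<eta>i: "integrable lborel \<eta>" by (rule test_functions_integrable[OF \<eta>])
  obtain B where "\<And>x. norm (\<eta> x) \<le> B" using test_functions_bounded[OF \<eta>] by blast
  then have B: "\<And>x. \<bar>\<eta> x\<bar> \<le> B" by simp
  obtain \<epsilon> m0 where \<epsilon>: "\<And>m. \<epsilon> m \<ge> (0::real)" "\<epsilon> \<longlonglongrightarrow> 0" and test:
    "\<And>m i \<phi>. m \<ge> m0 \<Longrightarrow> \<phi> \<in> test_functions \<omega> \<Longrightarrow>
      \<bar>LINT x|?M. (fst (Z m) x - F) $ i \<bullet> perp (grad \<phi> x)\<bar> \<le> \<epsilon> m * (nrm lborel (4/3) \<phi> + nrm lborel (4/3) (grad \<phi>)) \<and>
      \<bar>LINT x|?M. (snd (Z m) x - P) $ i \<bullet> grad \<phi> x\<bar> \<le> \<epsilon> m * (nrm lborel 4 \<phi> + nrm lborel 4 (grad \<phi>))"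
    using div_curl_converges_test[OF conv \<omega> bdd] by blast
  \<comment> \<open>The index shift discards the finitely many terms for which \<open>test\<close>
    gives no estimate.\<close>
  define f where "f k x = fst (Z (k + m0)) x - F" for k x
  define q where "q k x = snd (Z (k + m0)) x - P" for k x
  have fL: "memL ?M 4 (f k)" and fN: "nrm ?M 4 (f k) \<le> nrm ?M 4 (fst (Z (k + m0))) + nrm ?M 4 (\<lambda>x. F)" for k
    unfolding f_def[abs_def] using Minkowski_diff[OF _ FL F0] by auto
  have qL: "memL ?M (4/3) (q k)" and qN: "nrm ?M (4/3) (q k) \<le> nrm ?M (4/3) (snd (Z (k + m0))) + nrm ?M (4/3) (\<lambda>x. P)" for k
    unfolding q_def[abs_def] using Minkowski_diff[OF _ PL P0] by auto
  note fm [measurable] = memL_measurable[OF fL] and qm [measurable] = memL_measurable[OF qL]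
  have "\<forall>k. \<exists>G. G \<in> borel_measurable borel \<and> (\<forall>x. x \<notin> \<omega> \<longrightarrow> G x = 0) \<and> (AE x in ?M. f k x = G x)"
    by (intro allI borel_representative[OF fm \<omega>])
  from choice[OF this] obtain G where Gm [measurable]: "\<And>k. G k \<in> borel_measurable borel"
    and G0: "\<And>k x. x \<notin> \<omega> \<Longrightarrow> G k x = 0" and Gf: "\<And>k. AE x in ?M. f k x = G k x" by blast
  have "\<forall>k. \<exists>Q. Q \<in> borel_measurable borel \<and> (\<forall>x. x \<notin> \<omega> \<longrightarrow> Q x = 0) \<and> (AE x in ?M. q k x = Q x)"
    by (intro allI borel_representative[OF qm \<omega>])
  from choice[OF this] obtain Q where Qm [measurable]: "\<And>k. Q k \<in> borel_measurable borel"
    and Q0: "\<And>k x. x \<notin> \<omega> \<Longrightarrow> Q k x = 0" and Qq: "\<And>k. AE x in ?M. q k x = Q k x" by blast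
  have GL: "memL lborel 4 (G k)" and GN: "nrm lborel 4 (G k) = nrm ?M 4 (f k)" for k
    using memL_cong_AE[OF fL Gf measurable_borel_lebesgue_on[OF Gm]] memL_lebesgue_on_iff[OF Gm G0 \<omega>, of 4] by auto
  have QL: "memL lborel (4/3) (Q k)" and QN: "nrm lborel (4/3) (Q k) = nrm ?M (4/3) (q k)" for k
    using memL_cong_AE[OF qL Qq measurable_borel_lebesgue_on[OF Qm]] memL_lebesgue_on_iff[OF Qm Q0 \<omega>, of "4/3"] by auto
  obtain M1 where M1: "\<And>k. nrm ?M 4 (fst (Z k)) \<le> M1" using weakly_convergent_bounded[OF weak] by blast
  define c0 where "c0 = 1 + a + b + d"
  have c0: "c0 \<ge> 0" using a bd by (simp add: c0_def)
  have stress_growth: "norm (?T X) \<le> c0 * (1 + norm X ^ 3)" for X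
  proof -
    let ?x = "norm X"
    have x: "?x \<le> 1 + ?x ^ 3"
    proof (cases "?x \<le> 1")
      case True
      then show ?thesis using zero_le_power[of ?x 3] by (auto intro: order_trans)
    next
      case False
      then show ?thesis using power_increasing[of 1 3 ?x] by simp
    qed
    have "norm (?T X) \<le> ?x + a * ?x ^ 3 + (b * ?x + d * ?x ^ 3)"
      using norm_stress_le[OF assms, of X] by (simp add: power2_eq_square power3_eq_cube algebra_simps)
    also have "\<dots> \<le> (1 + ?x ^ 3) + a * (1 + ?x ^ 3) + (b * (1 + ?x ^ 3) + d * (1 + ?x ^ 3))"
      using x a bd by (intro add_mono mult_left_mono) auto
    also have "\<dots> = c0 * (1 + ?x ^ 3)" by (simp add: c0_def algebra_simps)
    finally show ?thesis .
  qed
  have Zstress: "AE x in ?M. snd (Z m) x = ?T (fst (Z m) x)" for m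
    using data[rule_format, of m] by eventually_elim (auto simp: data_set_def)
  define M2 where "M2 = c0 * (nrm ?M (4/3) (\<lambda>x. 1 :: real) + M1 ^ 3) + nrm ?M (4/3) (\<lambda>x. P)"
  \<comment> \<open>The second component equals the stress of the first almost everywhere, so its
    bound comes from the growth of the stress and \<open>M1\<close>.\<close>
  have QM: "nrm lborel (4/3) (Q k) \<le> M2" for k
  proof -
    have "nrm ?M (4/3) (snd (Z (k + m0))) \<le> c0 * (nrm ?M (4/3) (\<lambda>x. 1 :: real) + nrm ?M 4 (fst (Z (k + m0))) ^ 3)"
      by (rule stress_nrm_le[OF stress_growth c0 FL PL one Zstress])
    also have "\<dots> \<le> c0 * (nrm ?M (4/3) (\<lambda>x. 1 :: real) + M1 ^ 3)"
      by (intro mult_left_mono add_left_mono power_mono M1 c0) simp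
    finally show ?thesis using qN[of k] unfolding QN M2_def by linarith
  qed
  define M3 where "M3 = M1 + nrm ?M 4 (\<lambda>x. F)"
  have GM: "nrm lborel 4 (G k) \<le> M3" for k using fN[of k] M1[of "k + m0"] unfolding GN M3_def by linarith
  define \<kappa> where "\<kappa> = measure lborel \<omega> powr (1 / (4/3) - 1 / 4)"
  have \<kappa>0: "\<kappa> \<ge> 0" by (simp add: \<kappa>_def)
  have L43: "memL lborel (4/3) Y" "nrm lborel (4/3) Y \<le> \<kappa> * nrm lborel 4 Y"
    if "memL lborel 4 Y" "\<And>x. x \<notin> \<omega> \<Longrightarrow> Y x = 0" for Y :: "real^2 \<Rightarrow> 'b::euclidean_space"
    using memL_finite_support[of "4/3" 4 lborel Y \<omega>] that em \<omega> by (auto simp: \<kappa>_def)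
  \<comment> \<open>As cof G . G = 2 det G, the subtracted field contributes g0 det G to S . G,
    which is the null Lagrangian in \<open>gap\<close>. The divergence of its rows is a curl of
    \<open>G\<close>, so \<open>S\<close> inherits the smallness of both.\<close>
  define S where "S k x = Q k x - (g0 / 2) *\<^sub>R cof (G k x)" for k x
  have S0: "S k x = 0" if "x \<notin> \<omega>" for k x
    using G0[OF that] Q0[OF that] by (simp add: S_def cof_def vec_eq_iff forall_2)
  have Sm [measurable]: "S k \<in> borel_measurable borel" for k unfolding S_def[abs_def] by measurable
  define M4 where "M4 = M2 + \<bar>g0 / 2\<bar> * (\<kappa> * M3)"
  have SL: "memL lborel (4/3) (S k)" and SM: "nrm lborel (4/3) (S k) \<le> M4" for k
  proof -
    have C: "memL lborel (4/3) (\<lambda>x. (g0 / 2) *\<^sub>R cof (G k x))"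
      "nrm lborel (4/3) (\<lambda>x. (g0 / 2) *\<^sub>R cof (G k x)) \<le> \<bar>g0 / 2\<bar> * nrm lborel (4/3) (G k)"
      using nrm_le_mult[OF L43(1)[OF GL[of k] G0], where f="\<lambda>x. (g0 / 2) *\<^sub>R cof (G k x)" and c="\<bar>g0 / 2\<bar>"] by auto
    show "memL lborel (4/3) (S k)" unfolding S_def[abs_def] by (rule Minkowski_diff(1)[OF _ QL C(1)]) simp
    have "nrm lborel (4/3) (S k) \<le> nrm lborel (4/3) (Q k) + nrm lborel (4/3) (\<lambda>x. (g0 / 2) *\<^sub>R cof (G k x))"
      unfolding S_def[abs_def] by (rule Minkowski_diff(2)[OF _ QL C(1)]) simp
    also have "\<dots> \<le> M2 + \<bar>g0 / 2\<bar> * (\<kappa> * M3)"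
    proof (intro add_mono QM order_trans[OF C(2)] mult_left_mono)
      show "nrm lborel (4/3) (G k) \<le> \<kappa> * M3"
        using L43(2)[OF GL G0] mult_left_mono[OF GM \<kappa>0] by (rule order_trans)
    qed simp
    finally show "nrm lborel (4/3) (S k) \<le> M4" by (simp add: M4_def)
  qed
  have curlG: "\<bar>LINT x|lborel. G k x $ i \<bullet> perp (grad \<phi> x)\<bar> \<le> \<epsilon> (k + m0) * (nrm lborel (4/3) \<phi> + nrm lborel (4/3) (grad \<phi>))"
    and divQ: "\<bar>LINT x|lborel. Q k x $ i \<bullet> grad \<phi> x\<bar> \<le> \<epsilon> (k + m0) * (nrm lborel 4 \<phi> + nrm lborel 4 (grad \<phi>))"
    if \<phi>: "\<phi> \<in> test_functions \<omega>" for k i \<phi>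
  proof -
    note gm [measurable] = test_functions_measurable[OF test_functions_grad[OF \<phi>]]
    note [measurable] = measurable_borel_lebesgue_on[OF gm, of \<omega>]
    have "(LINT x|?M. f k x $ i \<bullet> perp (grad \<phi> x)) = (LINT x|lborel. G k x $ i \<bullet> perp (grad \<phi> x))"
      by (rule integral_representative[OF \<omega>]; ((use Gf[of k] G0 in \<open>force elim: eventually_mono\<close>) | measurable))
    then show "\<bar>LINT x|lborel. G k x $ i \<bullet> perp (grad \<phi> x)\<bar> \<le> \<epsilon> (k + m0) * (nrm lborel (4/3) \<phi> + nrm lborel (4/3) (grad \<phi>))"
      using test[of "k + m0" \<phi> i] \<phi> by (simp add: f_def)
    have "(LINT x|?M. q k x $ i \<bullet> grad \<phi> x) = (LINT x|lborel. Q k x $ i \<bullet> grad \<phi> x)"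
      by (rule integral_representative[OF \<omega>]; ((use Qq[of k] Q0 in \<open>force elim: eventually_mono\<close>) | measurable))
    then show "\<bar>LINT x|lborel. Q k x $ i \<bullet> grad \<phi> x\<bar> \<le> \<epsilon> (k + m0) * (nrm lborel 4 \<phi> + nrm lborel 4 (grad \<phi>))"
      using test[of "k + m0" \<phi> i] \<phi> by (simp add: q_def)
  qed
  have weakG: "(\<lambda>k. LINT x|lborel. \<theta> x *\<^sub>R G k x) \<longlonglongrightarrow> 0" and weakQ: "(\<lambda>k. LINT x|lborel. \<theta> x *\<^sub>R Q k x) \<longlonglongrightarrow> 0"
    if \<theta>: "\<theta> \<in> test_functions UNIV" for \<theta>
  proof -
    note tm [measurable] = test_functions_measurable[OF \<theta>]
    note [measurable] = measurable_borel_lebesgue_on[OF tm, of \<omega>]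
    have 1: "(LINT x|?M. \<theta> x *\<^sub>R f k x) = (LINT x|lborel. \<theta> x *\<^sub>R G k x)" for k
      by (rule integral_representative[OF \<omega>]; ((use Gf[of k] G0 in \<open>force elim: eventually_mono\<close>) | measurable))
    have 2: "(LINT x|?M. \<theta> x *\<^sub>R q k x) = (LINT x|lborel. \<theta> x *\<^sub>R Q k x)" for k
      by (rule integral_representative[OF \<omega>]; ((use Qq[of k] Q0 in \<open>force elim: eventually_mono\<close>) | measurable))
    show "(\<lambda>k. LINT x|lborel. \<theta> x *\<^sub>R G k x) \<longlonglongrightarrow> 0"
      unfolding 1[symmetric] f_def by (rule LIMSEQ_ignore_initial_segment[OF weak_limit_test(1)[OF weak \<omega> bdd \<theta>]])
    show "(\<lambda>k. LINT x|lborel. \<theta> x *\<^sub>R Q k x) \<longlonglongrightarrow> 0"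
      unfolding 2[symmetric] q_def by (rule LIMSEQ_ignore_initial_segment[OF weak_limit_test(2)[OF weak \<omega> bdd \<theta>]])
  qed
  have cof_lin: "bounded_linear (\<lambda>X. (g0 / 2) *\<^sub>R cof X)"
  proof -
    have "linear (\<lambda>X. (g0 / 2) *\<^sub>R cof X)"
      by (rule linearI) (simp_all add: vec_eq_iff forall_2 algebra_simps)
    then show ?thesis by (simp add: linear_conv_bounded_linear)
  qed
  have int\<theta>: "integrable lborel (\<lambda>x. \<theta> x *\<^sub>R Y x)"
    if \<theta>: "\<theta> \<in> test_functions UNIV" and Y: "memL lborel p Y" "p > 1" "\<And>x. x \<notin> \<omega> \<Longrightarrow> Y x = 0" for \<theta> p and Y :: "real^2 \<Rightarrow> real^2^2"
  proof -
    obtain B' where B': "\<forall>x. norm (\<theta> x) \<le> B'" using test_functions_bounded[OF \<theta>] by (elim exE conjE)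
    have "memL lborel 1 Y"
      by (rule memL_finite_support(1)[OF _ Y(2,1) _ em Y(3)]) (use \<omega> in auto)
    from memL_integrable[OF this] have "integrable lborel Y"
      by (intro integrable_norm_cancel[OF _ memL_measurable[OF Y(1)]]) simp
    then show ?thesis
      by (rule integrable_scaleR_bounded[of _ _ _ B']) (use B' test_functions_measurable[OF \<theta>] in auto)
  qed
  have weakS: "(\<lambda>k. LINT x|lborel. \<theta> x *\<^sub>R S k x) \<longlonglongrightarrow> 0" if \<theta>: "\<theta> \<in> test_functions UNIV" for \<theta>
  proof -
    note iG = int\<theta>[OF \<theta> GL _ G0, simplified] and iQ = int\<theta>[OF \<theta> QL _ Q0, simplified]
    have "(LINT x|lborel. \<theta> x *\<^sub>R S k x) = (LINT x|lborel. \<theta> x *\<^sub>R Q k x) - (g0 / 2) *\<^sub>R cof (LINT x|lborel. \<theta> x *\<^sub>R G k x)" for k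
    proof -
      have "(LINT x|lborel. \<theta> x *\<^sub>R S k x) = (LINT x|lborel. \<theta> x *\<^sub>R Q k x - (g0 / 2) *\<^sub>R cof (\<theta> x *\<^sub>R G k x))"
        by (intro Bochner_Integration.integral_cong refl)
          (simp add: S_def scaleR_diff_right linear_scale[OF bounded_linear.linear[OF cof_lin]])
      also have "\<dots> = (LINT x|lborel. \<theta> x *\<^sub>R Q k x) - (LINT x|lborel. (g0 / 2) *\<^sub>R cof (\<theta> x *\<^sub>R G k x))"
        by (rule Bochner_Integration.integral_diff[OF iQ integrable_bounded_linear[OF cof_lin iG]])
      finally show ?thesis by (simp only: integral_bounded_linear[OF cof_lin iG])
    qed
    moreover have "(\<lambda>k. (LINT x|lborel. \<theta> x *\<^sub>R Q k x) - (g0 / 2) *\<^sub>R cof (LINT x|lborel. \<theta> x *\<^sub>R G k x)) \<longlonglongrightarrow> 0 - (g0 / 2) *\<^sub>R cof 0"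
      by (intro tendsto_diff weakQ \<theta> bounded_linear.tendsto[OF cof_lin] weakG)
    moreover have "cof 0 = 0" by (simp add: vec_eq_iff forall_2)
    ultimately show ?thesis by simp
  qed
  \<comment> \<open>The curl estimate for \<open>G\<close> is stated with L^(4/3) norms of the test
    function; on \<omega> these are at most \<kappa> times the L^4 norms in which the divergence of
    \<open>S\<close> is measured. Hence the extra factor |g0 / 2| \<kappa>.\<close>
  define \<epsilon>' where "\<epsilon>' k = (1 + \<bar>g0 / 2\<bar> * \<kappa>) * \<epsilon> (k + m0)" for k
  have \<epsilon>': "\<epsilon>' k \<ge> 0" "\<epsilon> (k + m0) \<le> \<epsilon>' k" for k
    using \<epsilon>(1)[of "k + m0"] \<kappa>0 mult_nonneg_nonneg[of "\<bar>g0 / 2\<bar> * \<kappa>" "\<epsilon> (k + m0)"] by (auto simp: \<epsilon>'_def distrib_right)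
  have \<epsilon>'0: "\<epsilon>' \<longlonglongrightarrow> 0"
    using tendsto_mult[OF tendsto_const[of "1 + \<bar>g0 / 2\<bar> * \<kappa>"] LIMSEQ_ignore_initial_segment[OF \<epsilon>(2), of m0]] by (simp add: \<epsilon>'_def[abs_def])
  have divS: "\<bar>LINT x|lborel. S k x $ i \<bullet> grad \<phi> x\<bar> \<le> \<epsilon>' k * (nrm lborel 4 \<phi> + nrm lborel 4 (grad \<phi>))"
    if \<phi>: "\<phi> \<in> test_functions \<omega>" for k i \<phi>
  proof -
    let ?n = "nrm lborel 4 \<phi> + nrm lborel 4 (grad \<phi>)"
    note g = test_functions_grad[OF \<phi>]
    have g4: "memL lborel 4 (grad \<phi>)" by (rule memL_test_functions[OF g]) simp
    have p43: "memL lborel (4/3) (\<lambda>x. perp (grad \<phi> x))"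
      by (rule memL_test_functions[OF test_functions_compose_linear[OF g perp_bounded_linear]]) simp
    have n43: "nrm lborel (4/3) \<phi> + nrm lborel (4/3) (grad \<phi>) \<le> \<kappa> * ?n"
      using L43(2)[OF memL_test_functions[OF \<phi>] test_functionsD(5)[OF \<phi>]] L43(2)[OF g4 test_functionsD(5)[OF g]]
      by (simp add: distrib_left)
    \<comment> \<open>\<open>j\<close> is the other row index and \<sigma> the sign from
      \<open>cof_row\<close>.\<close>
    obtain j and \<sigma> :: real where j: "\<And>X. cof X $ i = \<sigma> *\<^sub>R perp (X $ j)" and \<sigma>: "\<bar>\<sigma>\<bar> = 1"
    proof (cases "i = 1")
      case True
      then show ?thesis using that[of 1 2] by (simp add: cof_row)
    next
      case False
      then have "i = 2" using exhaust_2 by blast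
      then show ?thesis using that[of "-1" 1] by (simp add: cof_row)
    qed
    have 1: "integrable lborel (\<lambda>x. Q k x $ i \<bullet> grad \<phi> x)"
      by (rule Holder_inner(1)[OF conj_4_43(1-3) row_memL(1)[OF QL] g4]) simp
    have 2: "integrable lborel (\<lambda>x. G k x $ j \<bullet> perp (grad \<phi> x))"
      by (rule Holder_inner(1)[OF conj_4_43(2,1,4) row_memL(1)[OF GL] p43]) simp
    have "(LINT x|lborel. S k x $ i \<bullet> grad \<phi> x) = (LINT x|lborel. Q k x $ i \<bullet> grad \<phi> x + (g0 / 2 * \<sigma>) * (G k x $ j \<bullet> perp (grad \<phi> x)))"
      by (intro Bochner_Integration.integral_cong refl) (simp add: S_def j inner_diff_left perp_inner)
    also have "\<dots> = (LINT x|lborel. Q k x $ i \<bullet> grad \<phi> x) + (g0 / 2 * \<sigma>) * (LINT x|lborel. G k x $ j \<bullet> perp (grad \<phi> x))"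
      using 1 2 by simp
    finally have "\<bar>LINT x|lborel. S k x $ i \<bullet> grad \<phi> x\<bar> \<le> \<bar>LINT x|lborel. Q k x $ i \<bullet> grad \<phi> x\<bar> + \<bar>g0 / 2\<bar> * \<bar>LINT x|lborel. G k x $ j \<bullet> perp (grad \<phi> x)\<bar>"
      using \<sigma> abs_triangle_ineq[of "LINT x|lborel. Q k x $ i \<bullet> grad \<phi> x" "(g0 / 2 * \<sigma>) * (LINT x|lborel. G k x $ j \<bullet> perp (grad \<phi> x))"]
      by (simp add: abs_mult)
    also have "\<dots> \<le> \<epsilon> (k + m0) * ?n + \<bar>g0 / 2\<bar> * (\<epsilon> (k + m0) * (\<kappa> * ?n))"
      using order_trans[OF curlG[OF \<phi>, of k j] mult_left_mono[OF n43 \<epsilon>(1)]]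
      by (intro add_mono divQ \<phi> mult_left_mono) auto
    also have "\<dots> = \<epsilon>' k * ?n" by (simp add: \<epsilon>'_def algebra_simps)
    finally show ?thesis .
  qed
  have row: "(\<lambda>k. LINT x|lborel. \<eta> x * (S k x $ i \<bullet> G k x $ i)) \<longlonglongrightarrow> 0" for i
  proof (rule div_curl_lemma[OF \<omega> K \<eta>, where M="max M4 M3" and \<epsilon>=\<epsilon>'])
    show "memL lborel (4/3) (\<lambda>x. S k x $ i)" for k by (rule row_memL(1)[OF SL]) simp
    show "nrm lborel (4/3) (\<lambda>x. S k x $ i) \<le> max M4 M3" for k
      using row_memL(2)[OF SL[of k], of i] SM[of k] by simp
    show "memL lborel 4 (\<lambda>x. G k x $ i)" for k by (rule row_memL(1)[OF GL]) simp
    show "nrm lborel 4 (\<lambda>x. G k x $ i) \<le> max M4 M3" for k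
      using row_memL(2)[OF GL[of k], of i] GM[of k] by simp
    show "S k x $ i = 0" if "x \<notin> \<omega>" for k x using S0[OF that] by simp
    show "(\<lambda>k. LINT x|lborel. \<theta> x *\<^sub>R S k x $ i) \<longlonglongrightarrow> 0" if \<theta>: "\<theta> \<in> test_functions UNIV" for \<theta>
    proof -
      have "(LINT x|lborel. \<theta> x *\<^sub>R S k x $ i) = (LINT x|lborel. \<theta> x *\<^sub>R S k x) $ i" for k
        using integral_bounded_linear[OF bounded_linear_vec_nth[of i] int\<theta>[OF \<theta> SL[of k] _ S0]] by simp
      then show ?thesis using tendsto_vec_nth[OF weakS[OF \<theta>], of i] by simp
    qed
    show "\<bar>LINT x|lborel. G k x $ i \<bullet> perp (grad \<phi> x)\<bar> \<le> \<epsilon>' k * (nrm lborel (4/3) \<phi> + nrm lborel (4/3) (grad \<phi>))"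
      if "\<phi> \<in> test_functions \<omega>" for k \<phi>
      using order_trans[OF curlG[OF that, of k i] mult_right_mono[OF \<epsilon>'(2)]] by simp
  qed (use \<epsilon>' \<epsilon>'0 divS in auto)
  have SGi: "integrable lborel (\<lambda>x. \<eta> x * (S k x \<bullet> G k x))" for k
    by (rule weighted_Holder(1)[OF conj_4_43(1-3) SL GL _ B]) simp
  have SG: "(\<lambda>k. LINT x|lborel. \<eta> x * (S k x \<bullet> G k x)) \<longlonglongrightarrow> 0"
  proof -
    have i: "integrable lborel (\<lambda>x. \<eta> x * (S k x $ i \<bullet> G k x $ i))" for k i
      by (rule weighted_Holder(1)[OF conj_4_43(1-3) row_memL(1)[OF SL] row_memL(1)[OF GL] _ B]) simp_all
    have "(LINT x|lborel. \<eta> x * (S k x \<bullet> G k x)) = (LINT x|lborel. \<eta> x * (S k x $ 1 \<bullet> G k x $ 1)) + (LINT x|lborel. \<eta> x * (S k x $ 2 \<bullet> G k x $ 2))" for k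
      unfolding inner_rows distrib_left by (rule Bochner_Integration.integral_add[OF i i])
    then show ?thesis using tendsto_add[OF row[of 1] row[of 2]] by simp
  qed
  note \<eta>U = test_functions_UNIV[OF \<eta>]
  let ?W = "P - ?T F"
  have small: "norm ?W \<le> \<delta>" if \<delta>: "\<delta> > 0" for \<delta>
  proof -
    obtain C where C: "C \<ge> 0" "\<And>X. norm (?T (F + X) - ?T F) \<le> \<delta> + C * gap a \<gamma> F X"
      using stress_diff_le_gap[OF assms \<delta>] by blast
    \<comment> \<open>This is the integral of \<eta> times the gap. On \<omega>, T(F + G) - T(F) = Q
      + (P - T(F)), and hence the gap equals S . G + (P - T(F)) . G: the first part is handled by
      the div-curl lemma, the second is linear in \<open>G\<close>.\<close>
    let ?J = "\<lambda>k. (LINT x|lborel. \<eta> x * (S k x \<bullet> G k x)) + ?W \<bullet> (LINT x|lborel. \<eta> x *\<^sub>R G k x)"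
    \<comment> \<open>As \<eta> has integral 1, the left-hand side is the norm of the \<eta>-average
      of T(F + G) - T(F), and the pointwise bound by \<delta> + C times the gap may be
      integrated.\<close>
    have est: "norm ((LINT x|lborel. \<eta> x *\<^sub>R Q k x) + ?W) \<le> \<delta> + C * ?J k" for k
    proof -
      note iG = int\<theta>[OF \<eta>U GL _ G0, simplified] and iQ = int\<theta>[OF \<eta>U QL _ Q0, simplified]
      have iWG: "integrable lborel (\<lambda>x. \<eta> x * (?W \<bullet> G k x))"
        using integrable_inner_right[of ?W lborel "\<lambda>x. \<eta> x *\<^sub>R G k x"] iG by simp
      have eW: "(LINT x|lborel. \<eta> x * (?W \<bullet> G k x)) = ?W \<bullet> (LINT x|lborel. \<eta> x *\<^sub>R G k x)"
        using integral_inner_right[of ?W lborel "\<lambda>x. \<eta> x *\<^sub>R G k x"] iG by simp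
      have "(LINT x|lborel. \<eta> x *\<^sub>R Q k x) + ?W = (LINT x|lborel. \<eta> x *\<^sub>R Q k x) + (LINT x|lborel. \<eta> x *\<^sub>R ?W)"
        using \<eta>i \<eta>1 by simp
      also have "\<dots> = (LINT x|lborel. \<eta> x *\<^sub>R (Q k x + ?W))"
        unfolding scaleR_add_right using iQ \<eta>i by (intro Bochner_Integration.integral_add[symmetric] integrable_scaleR_left) auto
      also have "norm \<dots> \<le> (LINT x|lborel. \<delta> * \<eta> x + C * (\<eta> x * (S k x \<bullet> G k x) + \<eta> x * (?W \<bullet> G k x)))"
      proof (rule norm_integral_le)
        show "integrable lborel (\<lambda>x. \<delta> * \<eta> x + C * (\<eta> x * (S k x \<bullet> G k x) + \<eta> x * (?W \<bullet> G k x)))"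
          by (intro Bochner_Integration.integrable_add integrable_mult_right \<eta>i SGi iWG)
        have "AE x in ?M. Q k x = ?T (F + G k x) - P"
          using Gf[of k] Qq[of k] Zstress[of "k + m0"]
        proof eventually_elim
          case (elim x)
          have "F + G k x = fst (Z (k + m0)) x" using elim(1) by (simp add: f_def algebra_simps)
          then show ?case using elim(2,3) by (simp add: q_def)
        qed
        then have "AE x in lborel. x \<in> \<omega> \<longrightarrow> Q k x = ?T (F + G k x) - P"
          using \<omega> by (simp add: AE_restrict_space_iff AE_completion_iff)
        then show "AE x in lborel. norm (\<eta> x *\<^sub>R (Q k x + ?W)) \<le> \<delta> * \<eta> x + C * (\<eta> x * (S k x \<bullet> G k x) + \<eta> x * (?W \<bullet> G k x))"
        proof eventually_elim
          case (elim x)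
          show ?case
          proof (cases "x \<in> \<omega>")
            case True
            then have Q: "Q k x = ?T (F + G k x) - P" using elim by simp
            have c: "cof (G k x) \<bullet> G k x = 2 * det (G k x)" using cof_add_inner[of 0 "G k x"] by (simp add: inner_22)
            have gap: "gap a \<gamma> F (G k x) = S k x \<bullet> G k x + ?W \<bullet> G k x"
              by (simp add: gap_def S_def Q g0_def inner_diff_left c)
            have "norm (\<eta> x *\<^sub>R (Q k x + ?W)) = \<eta> x * norm (?T (F + G k x) - ?T F)"
              using \<eta>0[of x] by (simp add: Q)
            also have "\<dots> \<le> \<eta> x * (\<delta> + C * gap a \<gamma> F (G k x))"
              by (intro mult_left_mono C \<eta>0)
            also have "\<dots> = \<delta> * \<eta> x + C * (\<eta> x * (S k x \<bullet> G k x) + \<eta> x * (?W \<bullet> G k x))"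
              unfolding gap by (simp add: distrib_left mult_ac)
            finally show ?thesis .
          next
            case False
            then show ?thesis using test_functionsD(5)[OF \<eta> False] by simp
          qed
        qed
      qed
      also have "\<dots> = \<delta> * 1 + C * ((LINT x|lborel. \<eta> x * (S k x \<bullet> G k x)) + (LINT x|lborel. \<eta> x * (?W \<bullet> G k x)))"
        unfolding \<eta>1[symmetric] using \<eta>i SGi[of k] iWG by (simp only: Bochner_Integration.integral_add integral_mult_right_zero integrable_mult_right Bochner_Integration.integrable_add)
      finally show ?thesis unfolding eW by simp
    qed
    have l: "(\<lambda>k. norm ((LINT x|lborel. \<eta> x *\<^sub>R Q k x) + ?W)) \<longlonglongrightarrow> norm (0 + ?W)"
      by (intro tendsto_intros weakQ \<eta>U)
    have rr: "(\<lambda>k. \<delta> + C * ?J k) \<longlonglongrightarrow> \<delta> + C * (0 + ?W \<bullet> 0)"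
      by (intro tendsto_intros SG weakG \<eta>U)
    \<comment> \<open>The constant \<open>C\<close> depends on \<delta> but only multiplies a null
      sequence. It disappears in the limit, and \<delta> can be made arbitrarily small
      afterwards.\<close>
    have "norm (0 + ?W) \<le> \<delta> + C * (0 + ?W \<bullet> 0)"
      by (rule LIMSEQ_le[OF l rr]) (use est in blast)
    then show ?thesis by simp
  qed
  have "norm ?W \<le> 0"
  proof (rule field_le_epsilon)
    fix e :: real assume "e > 0"
    from small[OF this] show "norm ?W \<le> 0 + e" by (simp only: add_0)
  qed
  then have "P = ?T F" by simp
  then show "(F, P) \<in> data_set ?T" by (auto simp: data_set_def)
qed

theorem proposition4p11:
  fixes g :: "real \<Rightarrow> real" and a b d :: real
  assumes "g C1_differentiable_on UNIV"
    and "convex_on UNIV g"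
    and "b \<ge> 0" and "d \<ge> 0"
    and "\<And>t. \<bar>deriv g t\<bar> \<le> b + d * \<bar>t\<bar>"
    and "a > 0"
    and "b \<le> 2" and "d \<le> 3 * a"
  shows "strictly_quasimonotone (grad (W2 a g)) \<and>
    locally_div_curl_closed 4 (4 / 3) (data_set (grad (W2 a g)))"
proof -
  let ?\<gamma> = "deriv g"
  obtain D where D: "\<And>t. (g has_real_derivative D t) (at t)" and cont: "continuous_on UNIV D"
    using assms(1) by (auto simp: C1_differentiable_on_def has_real_derivative_iff_has_vector_derivative)
  have D_eq: "D = ?\<gamma>" using DERIV_imp_deriv[OF D] by auto
  \<comment> \<open>Sum of the tangent inequalities for the convex \<open>g\<close> at s and at
    t.\<close>
  have mono: "0 \<le> (?\<gamma> s - ?\<gamma> t) * (s - t)" for s t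
  proof -
    have tangent: "?\<gamma> y * (x - y) \<le> g x - g y" for x y
      using convex_on_imp_above_tangent[OF assms(2) _ _ _ D, of y x] by (simp add: D_eq)
    show ?thesis using tangent[of s t] tangent[of t s] by (simp add: algebra_simps)
  qed
  have grad: "grad (W2 a g) = stress a ?\<gamma>" using grad_W2[OF D] by (auto simp: D_eq)
  note hyps = assms(6-8,3-5) mono cont[unfolded D_eq]
  show ?thesis
    unfolding grad using strictly_quasimonotone_stress[OF hyps] locally_div_curl_closed_stress[OF hyps] by blast
qed

end
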